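(* Let $0<r\le 1$ and, for $\gamma>r$, consider the discrete-time dynamical system generated by the map $$V_\gamma(x,y)=\bigl(x(2-x)-xy,\ \gamma xy+(1-r)y\bigr)$$ on $\mathbb{R}^2$, with fixed point $E_2=E_2(\gamma)=\left(\frac{r}{\gamma},\frac{\gamma-r}{\gamma}\right)$. Let $\gamma_0=1+r$. If the parameter $\gamma$ varies within a small neighborhood of $\gamma_0$, then the system undergoes a Neimark-Sacker bifurcation at the fixed point $E_2$ at $\gamma=\gamma_0$. Furthermore, an attracting invariant closed curve bifurcates from the fixed point $E_2$ for $\gamma>\gamma_0$ (that is, for $\gamma>\gamma_0$ sufficiently close to $\gamma_0$).
   Context: A bifurcation is the appearance of a topologically nonequivalent phase portrait under variation of parameters. For a two-dimensional discrete-time system depending on a parameter, a bifurcation at a nonhyperbolic fixed point whose Jacobian matrix has a pair of complex conjugate eigenvalues $\mu_{1,2}$ of modulus one is called a Neimark-Sacker bifurcation. A closed invariant curve of $V_\gamma$ "bifurcates from the fixed point" if it is a closed curve around the fixed point, invariant under $V_\gamma$, which shrinks to the fixed point as $\gamma\to\gamma_0$; it is attracting if orbits starting sufficiently close to it converge to it under forward iteration. *)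

theory Defs
  imports "HOL-Analysis.Analysis"
begin

definition V :: "real \<Rightarrow> real \<Rightarrow> real^2 \<Rightarrow> real^2" where
  "V r \<gamma> z = vector [z$1 * (2 - z$1) - z$1 * z$2, \<gamma> * z$1 * z$2 + (1 - r) * z$2]"

definition E2 :: "real \<Rightarrow> real \<Rightarrow> real^2" where
  "E2 r \<gamma> = vector [r / \<gamma>, (\<gamma> - r) / \<gamma>]"

lemma V_E2: "V r \<gamma> (E2 r \<gamma>) = E2 r \<gamma>" if "0 < r" "r < \<gamma>"
  using that by (simp add: V_def E2_def vec_eq_iff forall_2 field_simps)

text \<open>The complex spectrum of a real square matrix, as the set of \<open>\<mu>\<close> having a
  nonzero complex eigenvector.\<close>

definition complex_eigenvalues :: "real^'n^'n \<Rightarrow> complex set" where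
  "complex_eigenvalues A =
     {\<mu>. \<exists>v::complex^'n. v \<noteq> 0 \<and> (\<chi> i j. complex_of_real (A$i$j)) *v v = \<mu> *s v}"

text \<open>Two discrete-time systems are topologically equivalent if a homeomorphism carries orbits
  onto orbits preserving the direction of time, that is, if it conjugates the two maps.
  Here this is taken locally, near a fixed point \<open>p\<close> of \<open>f\<close> and a fixed point \<open>q\<close> of \<open>g\<close>.
  An orbit may leave \<open>U\<close>, hence the premise \<open>f x \<in> U\<close>; for continuous \<open>f\<close>
  one can shrink \<open>U\<close> so that it becomes redundant on the smaller neighbourhood.\<close>

definition locally_topologically_equivalent ::
  "('a::topological_space \<Rightarrow> 'a) \<Rightarrow> 'a \<Rightarrow> ('b::topological_space \<Rightarrow> 'b) \<Rightarrow> 'b \<Rightarrow> bool" where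
  "locally_topologically_equivalent f p g q \<longleftrightarrow>
     (\<exists>U W h k. open U \<and> open W \<and> p \<in> U \<and> q \<in> W \<and> homeomorphism U W h k \<and> h p = q \<and>
        (\<forall>x\<in>U. f x \<in> U \<longrightarrow> h (f x) = g (h x)))"

text \<open>The phase portrait near the fixed point changes its topological type: parameters
  arbitrarily close to \<open>\<gamma>0\<close> have a local phase portrait not equivalent to the one at \<open>\<gamma>0\<close>.\<close>

definition bifurcation_at ::
  "(real \<Rightarrow> 'a::topological_space \<Rightarrow> 'a) \<Rightarrow> (real \<Rightarrow> 'a) \<Rightarrow> real \<Rightarrow> bool" where
  "bifurcation_at F p \<gamma>0 \<longleftrightarrow>
     (\<exists>\<^sub>F \<gamma> in nhds \<gamma>0. \<not> locally_topologically_equivalent (F \<gamma>) (p \<gamma>) (F \<gamma>0) (p \<gamma>0))"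

definition neimark_sacker_bifurcation ::
  "(real \<Rightarrow> real^2 \<Rightarrow> real^2) \<Rightarrow> (real \<Rightarrow> real^2) \<Rightarrow> real \<Rightarrow> bool" where
  "neimark_sacker_bifurcation F p \<gamma>0 \<longleftrightarrow>
     (\<forall>\<^sub>F \<gamma> in nhds \<gamma>0. F \<gamma> (p \<gamma>) = p \<gamma>) \<and> isCont p \<gamma>0 \<and>
     F \<gamma>0 differentiable at (p \<gamma>0) \<and>
     (\<exists>\<mu>. Im \<mu> \<noteq> 0 \<and> cmod \<mu> = 1 \<and>
        complex_eigenvalues (jacobian (F \<gamma>0) (at (p \<gamma>0))) = {\<mu>, cnj \<mu>}) \<and>
     bifurcation_at F p \<gamma>0"

definition closed_curve_around :: "(real^2) set \<Rightarrow> real^2 \<Rightarrow> bool" where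
  "closed_curve_around C p \<longleftrightarrow>
     (\<exists>c. simple_path c \<and> pathfinish c = pathstart c \<and> path_image c = C) \<and> p \<in> inside C"

definition attracting_set :: "('a::metric_space \<Rightarrow> 'a) \<Rightarrow> 'a set \<Rightarrow> bool" where
  "attracting_set f C \<longleftrightarrow>
     (\<exists>\<delta>>0. \<forall>x. infdist x C < \<delta> \<longrightarrow> (\<lambda>n. infdist ((f ^^ n) x) C) \<longlonglongrightarrow> 0)"

definition attracting_invariant_closed_curve_bifurcates_right ::
  "(real \<Rightarrow> real^2 \<Rightarrow> real^2) \<Rightarrow> (real \<Rightarrow> real^2) \<Rightarrow> real \<Rightarrow> bool" where
  "attracting_invariant_closed_curve_bifurcates_right F p \<gamma>0 \<longleftrightarrow>
     (\<exists>C. (\<forall>\<^sub>F \<gamma> in at_right \<gamma>0.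
             closed_curve_around (C \<gamma>) (p \<gamma>) \<and> F \<gamma> ` C \<gamma> = C \<gamma> \<and> attracting_set (F \<gamma>) (C \<gamma>)) \<and>
          (\<forall>\<epsilon>>0. \<forall>\<^sub>F \<gamma> in at_right \<gamma>0. C \<gamma> \<subseteq> ball (p \<gamma>0) \<epsilon>))"

end

theory Submission
  imports Defs
begin

text \<open>
  In a complex coordinate adapted to the eigenvector of the Jacobian, \<open>V r \<gamma>\<close> near \<open>E2 r \<gamma>\<close> becomes
  \<open>z \<mapsto> \<mu> z + a z\<^sup>2 + b z z' + c z'\<^sup>2\<close>, where \<open>z'\<close> is the conjugate of \<open>z\<close> and \<open>\<bar>\<mu>\<bar>\<^sup>2 = det\<close> crosses 1 at
  \<open>\<gamma>0\<close> without low-order resonance. A polynomial change of variables turns it into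
  \<open>w \<mapsto> \<mu> w + c1 w\<^sup>2 w' + E w\<close>, where \<open>E\<close> has Lipschitz constant of order \<open>\<bar>w\<bar>\<^sup>3\<close>, uniformly in \<open>\<gamma>\<close>.
  At \<open>\<gamma>0\<close> one finds \<open>Re (c1 / \<mu>) = - \<gamma>0\<^sup>2 / 2 < 0\<close>, so \<open>E2\<close> is stable there, while it is repelling for
  \<open>\<gamma> > \<gamma>0\<close>; hence the local phase portraits differ. For \<open>\<gamma> > \<gamma>0\<close> put \<open>w = \<rho> exp (s + i \<theta>)\<close> with
  \<open>- Re (c1 / \<mu>) \<rho>\<^sup>2 = ln \<bar>\<mu>\<bar>\<close>: the map becomes a rotation-like shift in \<open>\<theta>\<close> that contracts \<open>s\<close> by a factor
  \<open>1 - const \<rho>\<^sup>2\<close>, up to errors of order \<open>\<rho>\<^sup>3\<close>, and the graph transform on Lipschitz functions \<open>s = u \<theta>\<close>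
  has a fixed point whose graph is the attracting curve.
\<close>

section \<open>Graph transform for skew maps of the annulus\<close>

text \<open>The obstacle is that the contraction towards the curve is itself only of order \<rho>^2,
  where \<rho> tends to 0 together with \<gamma> - \<gamma>0. In logarithmic coordinates a term of
  degree n in w contributes order \<rho>^(n-1). Hence all quadratic terms and all cubic terms except
  w^2 w' have to go; a remainder of degree 4 leaves \<rho>^3, which a small \<rho> makes negligible.
  Because \<rho> and \<gamma> are coupled, every constant must be fixed before \<gamma>. Remainders
  are measured by sizes and Lipschitz constants on discs rather than by derivatives: this is what
  the contraction principle consumes, and it passes through sums, products, conjugates and an
  inverse that is itself found as a fixed point. Removing w'^3 requires \<mu>^4 \<noteq> 1 at
  \<gamma>0. There \<open>r \<le> 1\<close> gives Re \<mu> \<ge> 3/4, so the argument of \<mu> is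
  below \<pi>/3 and all resonances up to order four are excluded.\<close>

lemma graph_transform:
  fixes g k :: "real \<Rightarrow> real \<Rightarrow> real" and A B C D L \<sigma> P :: real
  assumes nn: "0 \<le> A" "0 \<le> B" "0 \<le> C" "0 \<le> D" "0 \<le> L" "0 \<le> \<sigma>"
    and per: "\<And>s \<theta>. \<bar>s\<bar> \<le> \<sigma> \<Longrightarrow> g s (\<theta> + P) = g s \<theta>" "\<And>s \<theta>. \<bar>s\<bar> \<le> \<sigma> \<Longrightarrow> k s (\<theta> + P) = k s \<theta>"
    and bd: "\<And>s \<theta>. \<bar>s\<bar> \<le> \<sigma> \<Longrightarrow> \<bar>g s \<theta>\<bar> < \<sigma>"
    and lipg: "\<And>s \<theta> s' \<theta>'. \<bar>s\<bar> \<le> \<sigma> \<Longrightarrow> \<bar>s'\<bar> \<le> \<sigma> \<Longrightarrow> \<bar>g s \<theta> - g s' \<theta>'\<bar> \<le> A * \<bar>s - s'\<bar> + B * \<bar>\<theta> - \<theta>'\<bar>"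
    and lipk: "\<And>s \<theta> s' \<theta>'. \<bar>s\<bar> \<le> \<sigma> \<Longrightarrow> \<bar>s'\<bar> \<le> \<sigma> \<Longrightarrow> \<bar>k s \<theta> - k s' \<theta>'\<bar> \<le> C * \<bar>s - s'\<bar> + D * \<bar>\<theta> - \<theta>'\<bar>"
    and c1: "C * L + D < 1" and c2: "A * L + B \<le> L * (1 - C * L - D)" and c3: "A + L * C < 1"
  obtains u where "continuous_on UNIV u" "\<And>\<theta>. u (\<theta> + P) = u \<theta>" "\<And>\<theta>. \<bar>u \<theta>\<bar> < \<sigma>"
    "\<And>\<theta>. g (u \<theta>) \<theta> = u (\<theta> + k (u \<theta>) \<theta>)" "\<And>\<theta>'. \<exists>\<theta>. \<theta> + k (u \<theta>) \<theta> = \<theta>'"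
    "\<And>s \<theta>. \<bar>s\<bar> \<le> \<sigma> \<Longrightarrow> \<bar>g s \<theta> - u (\<theta> + k s \<theta>)\<bar> \<le> (A + L * C) * \<bar>s - u \<theta>\<bar>"
proof -
  define good where "good = (\<lambda>f::real\<Rightarrow>real. (\<forall>\<theta>. \<bar>f \<theta>\<bar> \<le> \<sigma>) \<and> (\<forall>\<theta> \<theta>'. \<bar>f \<theta> - f \<theta>'\<bar> \<le> L * \<bar>\<theta> - \<theta>'\<bar>) \<and> (\<forall>\<theta>. f (\<theta> + P) = f \<theta>))"
  \<comment> \<open>Compares the image of an arbitrary point with the image of a point of the graph
    of \<open>f\<close>. It is used three times: for the slope of the new graph, for the contraction
    between two graphs, and for the attraction of points. Since the horizontal distance before the
    step is bounded through the one after it, \<open>c2\<close> is exactly what brings the slope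
    back to \<open>L\<close>.\<close>
  have est: "\<bar>g s \<theta> - g (f \<theta>') \<theta>'\<bar> \<le> (A + L * C) * \<bar>s - f \<theta>\<bar> + L * \<bar>(\<theta> + k s \<theta>) - (\<theta>' + k (f \<theta>') \<theta>')\<bar>"
    if f: "good f" and s: "\<bar>s\<bar> \<le> \<sigma>" for f s \<theta> \<theta>'
  proof -
    let ?e = "\<bar>s - f \<theta>\<bar>" and ?t = "\<bar>\<theta> - \<theta>'\<bar>" and ?t' = "\<bar>(\<theta> + k s \<theta>) - (\<theta>' + k (f \<theta>') \<theta>')\<bar>"
    have f': "\<bar>f \<theta>'\<bar> \<le> \<sigma>" "\<bar>f \<theta> - f \<theta>'\<bar> \<le> L * ?t" using f unfolding good_def by blast+
    have d: "\<bar>s - f \<theta>'\<bar> \<le> ?e + L * ?t" using f'(2) by linarith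
    have "\<bar>k s \<theta> - k (f \<theta>') \<theta>'\<bar> \<le> C * (?e + L * ?t) + D * ?t"
      using lipk[OF s f'(1), of \<theta> \<theta>'] mult_left_mono[OF d nn(3)] by linarith
    then have "?t \<le> ?t' + (C * (?e + L * ?t) + D * ?t)" by linarith
    then have "(1 - C * L - D) * ?t \<le> ?t' + C * ?e" by (simp add: algebra_simps)
    from mult_left_mono[OF this nn(5)]
    have 1: "L * (1 - C * L - D) * ?t \<le> L * ?t' + L * C * ?e" by (simp add: algebra_simps)
    have "\<bar>g s \<theta> - g (f \<theta>') \<theta>'\<bar> \<le> A * (?e + L * ?t) + B * ?t"
      using lipg[OF s f'(1), of \<theta> \<theta>'] mult_left_mono[OF d nn(1)] by linarith
    also have "\<dots> = A * ?e + (A * L + B) * ?t" by (simp add: algebra_simps)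
    also have "(A * L + B) * ?t \<le> L * (1 - C * L - D) * ?t" by (rule mult_right_mono[OF c2]) simp
    finally show ?thesis using 1 by (simp add: algebra_simps)
  qed
  \<comment> \<open>A preimage of \<theta>' is a fixed point of \<theta> \<mapsto> \<theta>' - k (f
    \<theta>) \<theta>, which contracts by \<open>C * L + D\<close> along any graph of slope
    \<open>L\<close>.\<close>
  have surj: "\<exists>!\<theta>. \<theta> + k (f \<theta>) \<theta> = \<theta>'" if f: "good f" for f \<theta>'
  proof -
    have "\<exists>!\<theta>. (\<lambda>\<theta>. \<theta>' - k (f \<theta>) \<theta>) \<theta> = \<theta>"
    proof (rule banach_fix_type[where c = "C * L + D"])
      show "\<forall>x y. dist (\<theta>' - k (f x) x) (\<theta>' - k (f y) y) \<le> (C * L + D) * dist x y"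
      proof (intro allI)
        fix x y
        have f': "\<bar>f x\<bar> \<le> \<sigma>" "\<bar>f y\<bar> \<le> \<sigma>" "\<bar>f x - f y\<bar> \<le> L * \<bar>x - y\<bar>" using f unfolding good_def by blast+
        show "dist (\<theta>' - k (f x) x) (\<theta>' - k (f y) y) \<le> (C * L + D) * dist x y"
          using lipk[OF f'(1,2), of x y] mult_left_mono[OF f'(3) nn(3)]
          unfolding dist_real_def by (simp add: algebra_simps)
      qed
    qed (use nn c1 in auto)
    moreover have "(\<theta> + k (f \<theta>) \<theta> = \<theta>') \<longleftrightarrow> ((\<lambda>\<theta>. \<theta>' - k (f \<theta>) \<theta>) \<theta> = \<theta>)" for \<theta> by auto
    ultimately show ?thesis by simp
  qed
  define \<tau> where "\<tau> = (\<lambda>f \<theta>'. THE \<theta>. \<theta> + k (f \<theta>) \<theta> = \<theta>')"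
  have \<tau>: "\<tau> f \<theta>' + k (f (\<tau> f \<theta>')) (\<tau> f \<theta>') = \<theta>'" if "good f" for f \<theta>'
    unfolding \<tau>_def using theI'[OF surj[OF that]] .
  have \<tau>_eq: "\<tau> f \<theta>' = \<theta>" if "good f" "\<theta> + k (f \<theta>) \<theta> = \<theta>'" for f \<theta> \<theta>'
    using surj[OF that(1)] \<tau>[OF that(1)] that(2) by blast
  define \<Gamma> where "\<Gamma> = (\<lambda>f \<theta>'. g (f (\<tau> f \<theta>')) (\<tau> f \<theta>'))"
  have good_\<Gamma>: "good (\<Gamma> f)" if f: "good f" for f
    unfolding good_def
  proof (intro conjI allI)
    fix \<theta> \<theta>'
    have b: "\<bar>f x\<bar> \<le> \<sigma>" for x using f unfolding good_def by blast
    show "\<bar>\<Gamma> f \<theta>\<bar> \<le> \<sigma>" unfolding \<Gamma>_def using bd[OF b] less_imp_le by blast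
    show "\<bar>\<Gamma> f \<theta> - \<Gamma> f \<theta>'\<bar> \<le> L * \<bar>\<theta> - \<theta>'\<bar>"
      using est[OF f b, of "\<tau> f \<theta>" "\<tau> f \<theta>" "\<tau> f \<theta>'"] unfolding \<Gamma>_def by (simp add: \<tau>[OF f])
    have p: "f (x + P) = f x" for x using f unfolding good_def by blast
    have "\<tau> f (\<theta> + P) = \<tau> f \<theta> + P"
      by (rule \<tau>_eq[OF f]) (use \<tau>[OF f, of \<theta>] in \<open>simp add: p per b\<close>)
    then show "\<Gamma> f (\<theta> + P) = \<Gamma> f \<theta>" unfolding \<Gamma>_def by (simp add: p per b)
  qed
  have cont: "continuous_on UNIV f" if "good f" for f
  proof (rule lipschitz_on_continuous_on[where L = L], rule lipschitz_onI)
    fix x y show "dist (f x) (f y) \<le> L * dist x y" using that unfolding good_def dist_real_def by blast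
  qed (rule nn)
  have bc: "f \<in> bcontfun" if "good f" for f
    using that cont[OF that] unfolding bcontfun_def good_def
    by (auto intro!: boundedI[where B = \<sigma>])
  define S where "S = {f :: real \<Rightarrow>\<^sub>C real. good (apply_bcontfun f)}"
  \<comment> \<open>Bounds, slopes and periods survive uniform limits, so \<open>S\<close> is closed
    in the complete space of bounded continuous functions.\<close>
  have ex: "\<exists>!f\<in>S. Bcontfun (\<Gamma> (apply_bcontfun f)) = f"
  proof (rule Banach_fix[where c = "A + L * C"])
    show "complete S"
      unfolding complete_eq_closed
    proof (unfold closed_sequential_limits, intro allI impI)
      fix X l assume X: "(\<forall>n. X n \<in> S) \<and> X \<longlonglongrightarrow> l"
      have lim: "(\<lambda>n. X n \<theta>) \<longlonglongrightarrow> l \<theta>" for \<theta>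
      proof (rule metric_tendsto_imp_tendsto[of X l])
        show "X \<longlonglongrightarrow> l" using X by blast
        show "\<forall>\<^sub>F n in sequentially. dist (X n \<theta>) (l \<theta>) \<le> dist (X n) l"
          by (simp add: dist_bounded)
      qed
      have Xg: "good (X n)" for n using X by (simp add: S_def)
      have "\<bar>l \<theta>\<bar> \<le> \<sigma>" for \<theta>
        by (rule LIMSEQ_le_const2[OF tendsto_rabs[OF lim]]) (use Xg in \<open>auto simp: good_def\<close>)
      moreover have "\<bar>l \<theta> - l \<theta>'\<bar> \<le> L * \<bar>\<theta> - \<theta>'\<bar>" for \<theta> \<theta>'
        by (rule LIMSEQ_le_const2[OF tendsto_rabs[OF tendsto_diff[OF lim lim]]]) (use Xg in \<open>auto simp: good_def\<close>)
      moreover have "l (\<theta> + P) = l \<theta>" for \<theta>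
      proof (rule LIMSEQ_unique[OF lim])
        have "(\<lambda>n. X n (\<theta> + P)) = (\<lambda>n. X n \<theta>)" using Xg by (auto simp: good_def)
        then show "(\<lambda>n. X n (\<theta> + P)) \<longlonglongrightarrow> l \<theta>" using lim by simp
      qed
      ultimately show "l \<in> S" by (simp add: S_def good_def)
    qed
    show "S \<noteq> {}"
    proof -
      have "good (\<lambda>_. 0)" using nn by (simp add: good_def)
      then have "Bcontfun (\<lambda>_. 0) \<in> S" by (simp add: S_def Bcontfun_inverse bc)
      then show ?thesis by blast
    qed
    show "(\<lambda>f. Bcontfun (\<Gamma> (apply_bcontfun f))) ` S \<subseteq> S"
      by (auto simp: S_def Bcontfun_inverse bc good_\<Gamma>)
    show "dist (Bcontfun (\<Gamma> (apply_bcontfun x))) (Bcontfun (\<Gamma> (apply_bcontfun y))) \<le> (A + L * C) * dist x y"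
      if "x \<in> S" "y \<in> S" for x y
    proof (rule dist_bound)
      fix \<theta>
      have x: "good x" and y: "good y" using that by (auto simp: S_def)
      \<comment> \<open>Both preimages land on the same angle \<theta>, so the horizontal term of
        \<open>est\<close> vanishes.\<close>
      let ?a = "\<tau> x \<theta>" and ?b = "\<tau> y \<theta>"
      have "\<bar>\<Gamma> x \<theta> - \<Gamma> y \<theta>\<bar> \<le> (A + L * C) * \<bar>x ?a - y ?a\<bar>"
        using est[OF y, of "x ?a" ?a ?b] x unfolding \<Gamma>_def by (simp add: \<tau>[OF x] \<tau>[OF y] good_def)
      also have "\<dots> \<le> (A + L * C) * dist x y"
        using dist_bounded[of x ?a y] nn by (intro mult_left_mono) (auto simp: dist_real_def)
      finally show "dist (Bcontfun (\<Gamma> x) \<theta>) (Bcontfun (\<Gamma> y) \<theta>) \<le> (A + L * C) * dist x y"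
        by (simp add: Bcontfun_inverse bc good_\<Gamma> x y dist_real_def)
    qed
  qed (use nn c3 in auto)
  then obtain f where f: "f \<in> S" "Bcontfun (\<Gamma> (apply_bcontfun f)) = f" by blast
  define u where "u = apply_bcontfun f"
  have u: "good u" using f by (simp add: S_def u_def)
  have u_eq: "u = \<Gamma> u" using f(2) Bcontfun_inverse[OF bc[OF good_\<Gamma>[OF u]]] by (simp add: u_def)
  have ub: "\<bar>u \<theta>\<bar> \<le> \<sigma>" for \<theta> using u by (simp add: good_def)
  have inv: "g (u \<theta>) \<theta> = u (\<theta> + k (u \<theta>) \<theta>)" for \<theta>
    using fun_cong[OF u_eq, of "\<theta> + k (u \<theta>) \<theta>"] by (simp add: \<Gamma>_def \<tau>_eq[OF u])
  show ?thesis
  proof (rule that)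
    show "continuous_on UNIV u" by (rule cont[OF u])
    show "u (\<theta> + P) = u \<theta>" for \<theta> using u by (simp add: good_def)
    \<comment> \<open>The graph is its own image, so it inherits the strict bound of
      \<open>bd\<close>; later this places the curve in the interior of an annulus.\<close>
    show "\<bar>u \<theta>\<bar> < \<sigma>" for \<theta> by (subst u_eq) (simp add: \<Gamma>_def bd ub)
    show "g (u \<theta>) \<theta> = u (\<theta> + k (u \<theta>) \<theta>)" for \<theta> by (rule inv)
    show "\<exists>\<theta>. \<theta> + k (u \<theta>) \<theta> = \<theta>'" for \<theta>' using surj[OF u] by blast
    show "\<bar>g s \<theta> - u (\<theta> + k s \<theta>)\<bar> \<le> (A + L * C) * \<bar>s - u \<theta>\<bar>" if "\<bar>s\<bar> \<le> \<sigma>" for s \<theta>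
    proof -
      obtain \<theta>' where t: "\<theta>' + k (u \<theta>') \<theta>' = \<theta> + k s \<theta>" using surj[OF u] by blast
      show ?thesis using est[OF u that, of \<theta> \<theta>'] inv[of \<theta>'] t by simp
    qed
  qed
qed

section \<open>Truncated normal form in logarithmic coordinates\<close>

text \<open>The remainder of the logarithm has derivative -z / (1 + z), which is at most \<delta> /
  (1/2) in norm on the disc.\<close>

lemma Ln_1_plus_lipschitz:
  fixes X Y :: complex
  assumes "norm X \<le> \<delta>" "norm Y \<le> \<delta>" "\<delta> \<le> 1/2"
  shows "norm ((Ln (1 + X) - X) - (Ln (1 + Y) - Y)) \<le> 2 * \<delta> * norm (X - Y)"
proof (rule field_differentiable_bound[where S = "cball 0 \<delta>" and f' = "\<lambda>z. 1 / (1 + z) - 1"])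
  fix z :: complex assume "z \<in> cball 0 \<delta>"
  then have z: "norm z \<le> \<delta>" by simp
  have n: "norm (1 + z) \<ge> 1/2" using norm_triangle_ineq2[of 1 "-z"] z assms(3) by simp
  have "Re (1 + z) > 0" using abs_Re_le_cmod[of z] z assms(3) by simp
  then have "1 + z \<notin> \<real>\<^sub>\<le>\<^sub>0" by (auto simp: complex_nonpos_Reals_iff)
  then show "((\<lambda>z. Ln (1 + z) - z) has_field_derivative 1 / (1 + z) - 1) (at z within cball 0 \<delta>)"
    by (auto intro!: derivative_eq_intros simp: inverse_eq_divide)
  have "1 + z \<noteq> 0" using n by auto
  then have "1 / (1 + z) - 1 = - z / (1 + z)" by (simp add: field_simps)
  then have "norm (1 / (1 + z) - 1) = norm z / norm (1 + z)" by (simp add: norm_divide)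
  also have "\<dots> \<le> \<delta> / (1/2)" using z n norm_ge_zero[of z] by (intro frac_le) linarith+
  finally show "norm (1 / (1 + z) - 1) \<le> 2 * \<delta>" by simp
qed (use assms in auto)

lemma exp_lipschitz:
  fixes a b :: complex
  assumes "Re a \<le> 1/4" "Re b \<le> 1/4"
  shows "norm (exp a - exp b) \<le> 2 * norm (a - b)"
proof (rule field_differentiable_bound[where S = "{z. Re z \<le> 1/4}" and f' = exp])
  fix z :: complex assume "z \<in> {z. Re z \<le> 1/4}"
  then have "exp (Re z) \<le> exp (1/4)" by simp
  also have "\<dots> \<le> 2" using exp_bound_half[of "1/4::real"] by simp
  finally show "norm (exp z) \<le> 2" by simp
qed (use assms convex_halfspace_Re_le[of "1/4"] in \<open>auto intro!: derivative_eq_intros\<close>)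

text \<open>Put w = \<rho> exp \<zeta>. The image divided by \<mu> w is 1 + X with X = Q + e, where
  Q is the cubic term and e = E w / (\<mu> w) has order \<rho>^3. The logarithm turns the product
  into a sum, and Z consists of e and the remainder of Ln (1 + X), which is quadratic in X and so of
  order \<rho>^4. Constants: \<bar>Re \<zeta>\<bar> \<le> 1/4 keeps the modulus of w between
  \<rho>/2 and 2\<rho>; X is bounded by 34 K \<rho>^2 \<le> 1/2 and has Lipschitz constant 68 K
  \<rho>^2; 5000 majorises 68^2 = 4624.\<close>

lemma log_coordinates:
  fixes \<mu> c :: complex and E :: "complex \<Rightarrow> complex" and \<rho> K R :: real
  assumes \<rho>: "0 < \<rho>" "\<rho> \<le> 1" "2 * \<rho> \<le> R" "68 * K * \<rho>^2 \<le> 1" and K: "0 < K"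
    and \<mu>: "1 \<le> cmod \<mu>" and c: "cmod (c / \<mu>) \<le> K" and E0: "E 0 = 0"
    and E: "\<And>m x y. m \<le> R \<Longrightarrow> cmod x \<le> m \<Longrightarrow> cmod y \<le> m \<Longrightarrow> cmod (E x - E y) \<le> K * m^3 * cmod (x - y)"
  defines "M \<equiv> (64 * K + 5000 * K^2) * \<rho>^3"
  obtains Z where
    "\<And>\<zeta>::complex. \<bar>Re \<zeta>\<bar> \<le> 1/4 \<Longrightarrow> \<mu> * (\<rho> * exp \<zeta>) + c * (\<rho> * exp \<zeta>)^2 * cnj (\<rho> * exp \<zeta>) + E (\<rho> * exp \<zeta>)
        = \<rho> * exp (\<zeta> + (Ln \<mu> + c / \<mu> * of_real (\<rho>^2 * exp (2 * Re \<zeta>)) + Z \<zeta>))"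
    "\<And>\<zeta>. \<bar>Re \<zeta>\<bar> \<le> 1/4 \<Longrightarrow> cmod (Z \<zeta>) \<le> M"
    "\<And>\<zeta> \<xi>. \<bar>Re \<zeta>\<bar> \<le> 1/4 \<Longrightarrow> \<bar>Re \<xi>\<bar> \<le> 1/4 \<Longrightarrow> cmod (Z \<zeta> - Z \<xi>) \<le> M * cmod (\<zeta> - \<xi>)"
    "\<And>\<zeta>. Z (\<zeta> + of_real (2 * pi) * \<i>) = Z \<zeta>"
proof -
  define w where "w = (\<lambda>\<zeta>. complex_of_real \<rho> * exp \<zeta>)"
  define e where "e = (\<lambda>\<zeta>. E (w \<zeta>) / (\<mu> * w \<zeta>))"
  define Q where "Q = (\<lambda>\<zeta>. c / \<mu> * of_real (\<rho>^2 * exp (2 * Re \<zeta>)))"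
  define X where "X = (\<lambda>\<zeta>. Q \<zeta> + e \<zeta>)"
  define Z where "Z = (\<lambda>\<zeta>. e \<zeta> + (Ln (1 + X \<zeta>) - X \<zeta>))"
  define S where "S = {\<zeta>. \<bar>Re \<zeta>\<bar> \<le> 1/4}"
  have \<mu>0: "\<mu> \<noteq> 0" using \<mu> by auto
  have w0: "w \<zeta> \<noteq> 0" for \<zeta> using \<rho> by (simp add: w_def)
  have e14: "exp (1/4) \<le> (2::real)" using exp_bound_half[of "1/4::real"] by simp
  have e12: "exp (1/2) \<le> (2::real)" using exp_bound_half[of "1/2::real"] by simp
  have wle: "cmod (w \<zeta>) \<le> 2 * \<rho>" if "\<zeta> \<in> S" for \<zeta>
  proof -
    have "exp (Re \<zeta>) \<le> exp (1/4)" using that by (simp add: S_def)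
    then have "exp (Re \<zeta>) \<le> 2" using e14 by linarith
    then show ?thesis using \<rho> by (simp add: w_def norm_mult)
  qed
  have iw: "cmod (1 / w \<zeta>) \<le> 2 / \<rho>" if "\<zeta> \<in> S" for \<zeta>
  proof -
    have "exp (- Re \<zeta>) \<le> exp (1/4)" using that by (simp add: S_def)
    then have "exp (- Re \<zeta>) \<le> 2" using e14 by linarith
    then show ?thesis using \<rho> by (simp add: w_def norm_mult norm_divide divide_simps exp_minus)
  qed
  have wd: "cmod (w \<zeta> - w \<xi>) \<le> 2 * \<rho> * cmod (\<zeta> - \<xi>)" if "\<zeta> \<in> S" "\<xi> \<in> S" for \<zeta> \<xi>
  proof -
    have "cmod (exp \<zeta> - exp \<xi>) \<le> 2 * cmod (\<zeta> - \<xi>)" using that by (intro exp_lipschitz) (auto simp: S_def)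
    moreover have "cmod (w \<zeta> - w \<xi>) = \<rho> * cmod (exp \<zeta> - exp \<xi>)"
      unfolding w_def using \<rho> by (simp flip: right_diff_distrib add: norm_mult)
    ultimately show ?thesis using \<rho> by simp
  qed
  have iwd: "cmod (1 / w \<zeta> - 1 / w \<xi>) \<le> 2 / \<rho> * cmod (\<zeta> - \<xi>)" if "\<zeta> \<in> S" "\<xi> \<in> S" for \<zeta> \<xi>
  proof -
    have "cmod (exp (- \<zeta>) - exp (- \<xi>)) \<le> 2 * cmod (- \<zeta> - - \<xi>)" using that by (intro exp_lipschitz) (auto simp: S_def)
    also have "cmod (- \<zeta> - - \<xi>) = cmod (\<zeta> - \<xi>)" by (simp add: norm_minus_commute)
    also have "exp (- \<zeta>) - exp (- \<xi>) = \<rho> * (1 / w \<zeta> - 1 / w \<xi>)" using \<rho> by (simp add: w_def exp_minus divide_simps)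
    finally have "\<rho> * cmod (1 / w \<zeta> - 1 / w \<xi>) \<le> 2 * cmod (\<zeta> - \<xi>)"
      using \<rho> by (simp only: norm_mult norm_of_real abs_of_pos)
    then show ?thesis using \<rho>(1) by (simp add: pos_le_divide_eq mult.commute)
  qed
  have Ed: "cmod (E (w \<zeta>) - E (w \<xi>)) \<le> 16 * K * \<rho>^4 * cmod (\<zeta> - \<xi>)" if "\<zeta> \<in> S" "\<xi> \<in> S" for \<zeta> \<xi>
  proof -
    have "cmod (E (w \<zeta>) - E (w \<xi>)) \<le> K * (2 * \<rho>)^3 * cmod (w \<zeta> - w \<xi>)"
      using E[OF \<rho>(3) wle wle] that by blast
    also have "\<dots> \<le> K * (2 * \<rho>)^3 * (2 * \<rho> * cmod (\<zeta> - \<xi>))"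
      using K \<rho> by (intro mult_left_mono wd that) auto
    finally show ?thesis by (simp add: power_mult_distrib eval_nat_numeral algebra_simps)
  qed
  have Ele: "cmod (E (w \<zeta>)) \<le> 16 * K * \<rho>^4" if "\<zeta> \<in> S" for \<zeta>
  proof -
    have "cmod (E (w \<zeta>)) \<le> K * (2 * \<rho>)^3 * cmod (w \<zeta>)"
      using E[OF \<rho>(3) wle[OF that], of 0] \<rho> E0 by simp
    also have "\<dots> \<le> K * (2 * \<rho>)^3 * (2 * \<rho>)"
      using K \<rho> by (intro mult_left_mono wle that) auto
    finally show ?thesis by (simp add: power_mult_distrib eval_nat_numeral algebra_simps)
  qed
  have ie: "e \<zeta> = E (w \<zeta>) * (1 / w \<zeta>) * (1 / \<mu>)" for \<zeta> by (simp add: e_def divide_simps)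
  have i\<mu>: "cmod (z * (1 / \<mu>)) \<le> cmod z" for z
  proof -
    have "cmod z * 1 \<le> cmod z * cmod \<mu>" using \<mu> by (intro mult_left_mono) auto
    then show ?thesis using \<mu>0 by (simp add: norm_divide field_simps)
  qed
  have ele: "cmod (e \<zeta>) \<le> 32 * K * \<rho>^3" if "\<zeta> \<in> S" for \<zeta>
  proof -
    have "cmod (e \<zeta>) \<le> cmod (E (w \<zeta>) * (1 / w \<zeta>))" unfolding ie by (rule i\<mu>)
    also have "\<dots> \<le> (16 * K * \<rho>^4) * (2 / \<rho>)"
      unfolding norm_mult by (intro mult_mono Ele iw that) (use K in auto)
    finally show ?thesis using \<rho> by (simp add: eval_nat_numeral)
  qed
  have ed: "cmod (e \<zeta> - e \<xi>) \<le> 64 * K * \<rho>^3 * cmod (\<zeta> - \<xi>)" if "\<zeta> \<in> S" "\<xi> \<in> S" for \<zeta> \<xi>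
  proof -
    have "e \<zeta> - e \<xi> = ((E (w \<zeta>) - E (w \<xi>)) * (1 / w \<zeta>) + E (w \<xi>) * (1 / w \<zeta> - 1 / w \<xi>)) * (1 / \<mu>)"
      unfolding ie by (simp add: algebra_simps)
    then have "cmod (e \<zeta> - e \<xi>) \<le> cmod ((E (w \<zeta>) - E (w \<xi>)) * (1 / w \<zeta>) + E (w \<xi>) * (1 / w \<zeta> - 1 / w \<xi>))"
      using i\<mu> by metis
    also have "\<dots> \<le> cmod (E (w \<zeta>) - E (w \<xi>)) * cmod (1 / w \<zeta>) + cmod (E (w \<xi>)) * cmod (1 / w \<zeta> - 1 / w \<xi>)"
      by (rule order_trans[OF norm_triangle_ineq]) (simp only: norm_mult order_refl)
    also have "\<dots> \<le> (16 * K * \<rho>^4 * cmod (\<zeta> - \<xi>)) * (2 / \<rho>) + (16 * K * \<rho>^4) * (2 / \<rho> * cmod (\<zeta> - \<xi>))"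
      using K \<rho> by (intro add_mono mult_mono Ed iw Ele iwd that) auto
    finally show ?thesis using \<rho> by (simp add: eval_nat_numeral)
  qed
  have Qle: "cmod (Q \<zeta>) \<le> 2 * K * \<rho>^2" if "\<zeta> \<in> S" for \<zeta>
  proof -
    have "exp (2 * Re \<zeta>) \<le> exp (1/2)" using that by (simp add: S_def)
    then have "exp (2 * Re \<zeta>) \<le> 2" using e12 by linarith
    then have q: "\<rho>^2 * exp (2 * Re \<zeta>) \<le> \<rho>^2 * 2" by (intro mult_left_mono) auto
    have "cmod (c / \<mu>) * (\<rho>^2 * exp (2 * Re \<zeta>)) \<le> K * (\<rho>^2 * 2)"
      by (rule mult_mono[OF c q]) (use K in auto)
    moreover have "cmod (Q \<zeta>) = cmod (c / \<mu>) * (\<rho>^2 * exp (2 * Re \<zeta>))"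
      by (simp only: Q_def norm_mult norm_of_real abs_mult abs_power2 abs_exp_cancel)
    ultimately show ?thesis by linarith
  qed
  have Qd: "cmod (Q \<zeta> - Q \<xi>) \<le> 4 * K * \<rho>^2 * cmod (\<zeta> - \<xi>)" if "\<zeta> \<in> S" "\<xi> \<in> S" for \<zeta> \<xi>
  proof -
    have "\<bar>exp (2 * Re \<zeta>) - exp (2 * Re \<xi>)\<bar> \<le> 4 * \<bar>Re \<zeta> - Re \<xi>\<bar>"
    proof -
      have "norm (exp (2 * Re \<zeta>) - exp (2 * Re \<xi>)) \<le> 4 * norm (Re \<zeta> - Re \<xi>)"
      proof (rule field_differentiable_bound[where S = "{-1/4..1/4}" and f' = "\<lambda>x. 2 * exp (2 * x)" and f = "\<lambda>x. exp (2 * x)"])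
        fix x :: real assume "x \<in> {-1/4..1/4}"
        then have "exp (2 * x) \<le> exp (1/2)" by simp
        then show "norm (2 * exp (2 * x)) \<le> 4" using e12 by (smt (verit) real_norm_def exp_gt_zero)
      qed (use that in \<open>auto intro!: derivative_eq_intros simp: S_def\<close>)
      then show ?thesis by simp
    qed
    also have "\<bar>Re \<zeta> - Re \<xi>\<bar> \<le> cmod (\<zeta> - \<xi>)" using abs_Re_le_cmod[of "\<zeta> - \<xi>"] by simp
    finally have 1: "\<bar>exp (2 * Re \<zeta>) - exp (2 * Re \<xi>)\<bar> \<le> 4 * cmod (\<zeta> - \<xi>)" by simp
    have "Q \<zeta> - Q \<xi> = c / \<mu> * of_real (\<rho>^2 * (exp (2 * Re \<zeta>) - exp (2 * Re \<xi>)))"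
      by (simp add: Q_def algebra_simps diff_divide_distrib)
    then have "cmod (Q \<zeta> - Q \<xi>) = cmod (c / \<mu>) * (\<rho>^2 * \<bar>exp (2 * Re \<zeta>) - exp (2 * Re \<xi>)\<bar>)"
      by (simp only: norm_mult norm_of_real abs_mult abs_power2)
    also have "\<dots> \<le> K * (\<rho>^2 * (4 * cmod (\<zeta> - \<xi>)))"
      by (rule mult_mono[OF c mult_left_mono[OF 1]]) (use K in auto)
    finally show ?thesis by (simp add: algebra_simps)
  qed
  have \<rho>3: "\<rho>^3 \<le> \<rho>^2" using \<rho> by (intro power_decreasing) auto
  have \<rho>4: "\<rho>^4 \<le> \<rho>^3" using \<rho> by (intro power_decreasing) auto
  have K3: "K * \<rho>^3 \<le> K * \<rho>^2" using K \<rho>3 by simp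
  have Xle: "cmod (X \<zeta>) \<le> 34 * K * \<rho>^2" if "\<zeta> \<in> S" for \<zeta>
    using norm_triangle_ineq[of "Q \<zeta>" "e \<zeta>"] Qle[OF that] ele[OF that] K3 unfolding X_def by linarith
  have Xd: "cmod (X \<zeta> - X \<xi>) \<le> 68 * K * \<rho>^2 * cmod (\<zeta> - \<xi>)" if "\<zeta> \<in> S" "\<xi> \<in> S" for \<zeta> \<xi>
  proof -
    have "X \<zeta> - X \<xi> = (Q \<zeta> - Q \<xi>) + (e \<zeta> - e \<xi>)" by (simp add: X_def)
    then have "cmod (X \<zeta> - X \<xi>) \<le> cmod (Q \<zeta> - Q \<xi>) + cmod (e \<zeta> - e \<xi>)" by (metis norm_triangle_ineq)
    also have "\<dots> \<le> 4 * K * \<rho>^2 * cmod (\<zeta> - \<xi>) + 64 * K * \<rho>^3 * cmod (\<zeta> - \<xi>)"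
      by (intro add_mono Qd ed that)
    also have "64 * K * \<rho>^3 * cmod (\<zeta> - \<xi>) \<le> 64 * K * \<rho>^2 * cmod (\<zeta> - \<xi>)"
      using K3 by (intro mult_right_mono) auto
    finally show ?thesis by (simp add: algebra_simps)
  qed
  have half: "34 * K * \<rho>^2 \<le> 1/2" using \<rho>(4) by simp
  have Ln1: "cmod ((Ln (1 + X \<zeta>) - X \<zeta>) - (Ln (1 + y) - y)) \<le> 68 * K * \<rho>^2 * cmod (X \<zeta> - y)"
    if "\<zeta> \<in> S" "cmod y \<le> 34 * K * \<rho>^2" for \<zeta> y
    using Ln_1_plus_lipschitz[OF Xle[OF that(1)] that(2) half] by simp
  have q: "K^2 * \<rho>^4 \<le> K^2 * \<rho>^3" using \<rho>4 by (intro mult_left_mono) auto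
  have M_eq: "M = 64 * (K * \<rho>^3) + 5000 * (K^2 * \<rho>^3)" by (simp add: M_def distrib_right)
  have nn: "0 \<le> K * \<rho>^3" "0 \<le> K^2 * \<rho>^3" using K \<rho> by auto
  show thesis
  proof (rule that[of Z])
    fix \<zeta> :: complex assume "\<bar>Re \<zeta>\<bar> \<le> 1/4"
    then have \<zeta>: "\<zeta> \<in> S" by (simp add: S_def)
    have X0: "1 + X \<zeta> \<noteq> 0"
    proof
      assume "1 + X \<zeta> = 0" then have "X \<zeta> = -1" by (simp add: add_eq_0_iff)
      then show False using Xle[OF \<zeta>] half by simp
    qed
    have ww: "w \<zeta> * cnj (w \<zeta>) = of_real (\<rho>^2 * exp (2 * Re \<zeta>))"
    proof -
      have "(cmod (w \<zeta>))^2 = \<rho>^2 * exp (2 * Re \<zeta>)"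
        by (simp add: w_def norm_mult power_mult_distrib exp_double)
      then show ?thesis by (simp only: flip: complex_norm_square)
    qed
    have "\<mu> * w \<zeta> + c * (w \<zeta>)^2 * cnj (w \<zeta>) + E (w \<zeta>) = \<mu> * w \<zeta> + c * w \<zeta> * (w \<zeta> * cnj (w \<zeta>)) + E (w \<zeta>)"
      by (simp add: power2_eq_square algebra_simps)
    also have "\<dots> = w \<zeta> * (\<mu> * (1 + X \<zeta>))"
      unfolding ww using \<mu>0 w0[of \<zeta>] by (simp add: X_def Q_def e_def field_simps)
    also have "\<dots> = \<rho> * exp (\<zeta> + (Ln \<mu> + Ln (1 + X \<zeta>)))"
      using X0 \<mu>0 by (simp add: w_def exp_add)
    also have "Ln \<mu> + Ln (1 + X \<zeta>) = Ln \<mu> + Q \<zeta> + Z \<zeta>" by (simp add: Z_def X_def)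
    finally show "\<mu> * (\<rho> * exp \<zeta>) + c * (\<rho> * exp \<zeta>)^2 * cnj (\<rho> * exp \<zeta>) + E (\<rho> * exp \<zeta>)
        = \<rho> * exp (\<zeta> + (Ln \<mu> + c / \<mu> * of_real (\<rho>^2 * exp (2 * Re \<zeta>)) + Z \<zeta>))"
      unfolding w_def Q_def .
    have "cmod (Z \<zeta>) \<le> cmod (e \<zeta>) + cmod (Ln (1 + X \<zeta>) - X \<zeta>)" unfolding Z_def by (rule norm_triangle_ineq)
    also have "cmod (Ln (1 + X \<zeta>) - X \<zeta>) \<le> 68 * K * \<rho>^2 * cmod (X \<zeta>)"
      using Ln1[OF \<zeta>, of 0] K by simp
    also have "\<dots> \<le> 68 * K * \<rho>^2 * (34 * K * \<rho>^2)" using K by (intro mult_left_mono Xle \<zeta>) auto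
    also have "\<dots> = 2312 * (K^2 * \<rho>^4)" by (simp add: eval_nat_numeral)
    finally show "cmod (Z \<zeta>) \<le> M" using ele[OF \<zeta>] q M_eq nn by linarith
  next
    fix \<zeta> \<xi> :: complex assume "\<bar>Re \<zeta>\<bar> \<le> 1/4" "\<bar>Re \<xi>\<bar> \<le> 1/4"
    then have \<zeta>: "\<zeta> \<in> S" and \<xi>: "\<xi> \<in> S" by (auto simp: S_def)
    have "cmod (Z \<zeta> - Z \<xi>) \<le> cmod (e \<zeta> - e \<xi>) + cmod ((Ln (1 + X \<zeta>) - X \<zeta>) - (Ln (1 + X \<xi>) - X \<xi>))"
      unfolding Z_def by (rule order_trans[OF _ norm_triangle_ineq]) (simp add: algebra_simps)
    also have "cmod ((Ln (1 + X \<zeta>) - X \<zeta>) - (Ln (1 + X \<xi>) - X \<xi>)) \<le> 68 * K * \<rho>^2 * cmod (X \<zeta> - X \<xi>)"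
      by (rule Ln1[OF \<zeta> Xle[OF \<xi>]])
    also have "\<dots> \<le> 68 * K * \<rho>^2 * (68 * K * \<rho>^2 * cmod (\<zeta> - \<xi>))" using K by (intro mult_left_mono Xd \<zeta> \<xi>) auto
    also have "\<dots> = 4624 * (K^2 * \<rho>^4) * cmod (\<zeta> - \<xi>)" by (simp add: eval_nat_numeral)
    finally have "cmod (Z \<zeta> - Z \<xi>) \<le> (64 * K * \<rho>^3 + 4624 * (K^2 * \<rho>^4)) * cmod (\<zeta> - \<xi>)"
      using ed[OF \<zeta> \<xi>] by (simp add: distrib_right)
    also have "\<dots> \<le> M * cmod (\<zeta> - \<xi>)"
      by (rule mult_right_mono) (use q M_eq nn in \<open>linarith, simp\<close>)
    finally show "cmod (Z \<zeta> - Z \<xi>) \<le> M * cmod (\<zeta> - \<xi>)" .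
  next
    fix \<zeta> :: complex
    have "w (\<zeta> + of_real (2 * pi) * \<i>) = w \<zeta>" by (simp add: w_def exp_add exp_two_pi_i)
    then show "Z (\<zeta> + of_real (2 * pi) * \<i>) = Z \<zeta>" by (simp add: Z_def X_def Q_def e_def)
  qed
qed

section \<open>Invariant curves as graphs over the angle in exponential polar coordinates\<close>

definition polar_point :: "real \<Rightarrow> real \<Rightarrow> real \<Rightarrow> complex" where
  "polar_point \<rho> s \<theta> = complex_of_real \<rho> * exp (Complex s \<theta>)"

definition polar_curve :: "real \<Rightarrow> (real \<Rightarrow> real) \<Rightarrow> complex set" where
  "polar_curve \<rho> u = range (\<lambda>\<theta>. polar_point \<rho> (u \<theta>) \<theta>)"

text \<open>Recording that whole orbits stay in the annulus \<bar>s\<bar> \<le> 1/4 allows the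
  attraction to be carried over by a semiconjugacy that is valid only on a disc.\<close>

definition attracting_polar_curve :: "(complex \<Rightarrow> complex) \<Rightarrow> real \<Rightarrow> (real \<Rightarrow> real) \<Rightarrow> bool" where
  "attracting_polar_curve F \<rho> u \<longleftrightarrow>
     continuous_on UNIV u \<and> (\<forall>\<theta>. u (\<theta> + 2 * pi) = u \<theta>) \<and> (\<forall>\<theta>. \<bar>u \<theta>\<bar> < 1/4) \<and>
     F ` polar_curve \<rho> u = polar_curve \<rho> u \<and>
     (\<forall>s \<theta>. \<bar>s\<bar> \<le> 1/4 \<longrightarrow>
        (\<forall>n. \<exists>s' \<theta>'. \<bar>s'\<bar> \<le> 1/4 \<and> (F ^^ n) (polar_point \<rho> s \<theta>) = polar_point \<rho> s' \<theta>') \<and>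
        (\<lambda>n. infdist ((F ^^ n) (polar_point \<rho> s \<theta>)) (polar_curve \<rho> u)) \<longlonglongrightarrow> 0)"

text \<open>Along each orbit the vertical distance \<bar>s - u \<theta>\<bar> to the graph shrinks
  by the factor \<open>A + L * C\<close> per step; it dominates the distance in the plane up to the
  factor 2\<rho>, as exp is 2-Lipschitz on the strip.\<close>

lemma attracting_polar_curve_of_skew:
  fixes g k :: "real \<Rightarrow> real \<Rightarrow> real" and A B C D L \<rho> :: real
  assumes \<rho>: "0 < \<rho>"
    and conj: "\<And>s \<theta>. \<bar>s\<bar> \<le> 1/4 \<Longrightarrow> F (polar_point \<rho> s \<theta>) = polar_point \<rho> (g s \<theta>) (\<theta> + k s \<theta>)"
    and nn: "0 \<le> A" "0 \<le> B" "0 \<le> C" "0 \<le> D" "0 \<le> L"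
    and per: "\<And>s \<theta>. \<bar>s\<bar> \<le> 1/4 \<Longrightarrow> g s (\<theta> + 2 * pi) = g s \<theta>" "\<And>s \<theta>. \<bar>s\<bar> \<le> 1/4 \<Longrightarrow> k s (\<theta> + 2 * pi) = k s \<theta>"
    and bd: "\<And>s \<theta>. \<bar>s\<bar> \<le> 1/4 \<Longrightarrow> \<bar>g s \<theta>\<bar> < 1/4"
    and lip: "\<And>s \<theta> s' \<theta>'. \<bar>s\<bar> \<le> 1/4 \<Longrightarrow> \<bar>s'\<bar> \<le> 1/4 \<Longrightarrow> \<bar>g s \<theta> - g s' \<theta>'\<bar> \<le> A * \<bar>s - s'\<bar> + B * \<bar>\<theta> - \<theta>'\<bar>"
      "\<And>s \<theta> s' \<theta>'. \<bar>s\<bar> \<le> 1/4 \<Longrightarrow> \<bar>s'\<bar> \<le> 1/4 \<Longrightarrow> \<bar>k s \<theta> - k s' \<theta>'\<bar> \<le> C * \<bar>s - s'\<bar> + D * \<bar>\<theta> - \<theta>'\<bar>"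
    and c: "C * L + D < 1" "A * L + B \<le> L * (1 - C * L - D)" "A + L * C < 1"
  shows "\<exists>u. attracting_polar_curve F \<rho> u"
proof -
  obtain u where u: "continuous_on UNIV u" "\<And>\<theta>. u (\<theta> + 2 * pi) = u \<theta>" "\<And>\<theta>. \<bar>u \<theta>\<bar> < 1/4"
    "\<And>\<theta>. g (u \<theta>) \<theta> = u (\<theta> + k (u \<theta>) \<theta>)" "\<And>\<theta>'. \<exists>\<theta>. \<theta> + k (u \<theta>) \<theta> = \<theta>'"
    "\<And>s \<theta>. \<bar>s\<bar> \<le> 1/4 \<Longrightarrow> \<bar>g s \<theta> - u (\<theta> + k s \<theta>)\<bar> \<le> (A + L * C) * \<bar>s - u \<theta>\<bar>"
  proof (rule graph_transform[where \<sigma> = "1/4" and P = "2 * pi" and g = g and k = k and A = A and B = B and C = C and D = D and L = L])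
  qed (use nn per bd lip c in auto)
  have ub: "\<bar>u \<theta>\<bar> \<le> 1/4" for \<theta> using u(3)[of \<theta>] by simp
  have inv: "F (polar_point \<rho> (u \<theta>) \<theta>) = polar_point \<rho> (u (\<theta> + k (u \<theta>) \<theta>)) (\<theta> + k (u \<theta>) \<theta>)" for \<theta>
    using conj[OF ub] u(4) by simp
  have "F ` polar_curve \<rho> u = polar_curve \<rho> u"
  proof
    show "F ` polar_curve \<rho> u \<subseteq> polar_curve \<rho> u" by (auto simp: polar_curve_def inv)
    show "polar_curve \<rho> u \<subseteq> F ` polar_curve \<rho> u"
    proof
      fix z assume "z \<in> polar_curve \<rho> u"
      then obtain \<theta>' where z: "z = polar_point \<rho> (u \<theta>') \<theta>'" by (auto simp: polar_curve_def)
      obtain \<theta> where "\<theta> + k (u \<theta>) \<theta> = \<theta>'" using u(5) by blast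
      then have "z = F (polar_point \<rho> (u \<theta>) \<theta>)" by (simp add: z inv)
      then show "z \<in> F ` polar_curve \<rho> u" by (auto simp: polar_curve_def)
    qed
  qed
  moreover have "(\<forall>n. \<exists>s' \<theta>'. \<bar>s'\<bar> \<le> 1/4 \<and> (F ^^ n) (polar_point \<rho> s \<theta>) = polar_point \<rho> s' \<theta>') \<and>
        (\<lambda>n. infdist ((F ^^ n) (polar_point \<rho> s \<theta>)) (polar_curve \<rho> u)) \<longlonglongrightarrow> 0" if s: "\<bar>s\<bar> \<le> 1/4" for s \<theta>
  proof -
    let ?q = "A + L * C"
    have q: "0 \<le> ?q" using nn by simp
    have orb: "\<exists>s' \<theta>'. \<bar>s'\<bar> \<le> 1/4 \<and> (F ^^ n) (polar_point \<rho> s \<theta>) = polar_point \<rho> s' \<theta>' \<and> \<bar>s' - u \<theta>'\<bar> \<le> ?q ^ n * \<bar>s - u \<theta>\<bar>" for n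
    proof (induction n)
      case 0 show ?case using s by auto
    next
      case (Suc n)
      then obtain s' \<theta>' where 1: "\<bar>s'\<bar> \<le> 1/4" "(F ^^ n) (polar_point \<rho> s \<theta>) = polar_point \<rho> s' \<theta>'" "\<bar>s' - u \<theta>'\<bar> \<le> ?q ^ n * \<bar>s - u \<theta>\<bar>" by blast
      have "\<bar>g s' \<theta>' - u (\<theta>' + k s' \<theta>')\<bar> \<le> ?q * (?q ^ n * \<bar>s - u \<theta>\<bar>)"
        using u(6)[OF 1(1), of \<theta>'] mult_left_mono[OF 1(3) q] by linarith
      moreover have "\<bar>g s' \<theta>'\<bar> \<le> 1/4" using bd[OF 1(1), of \<theta>'] by simp
      ultimately show ?case using 1(2) conj[OF 1(1)] by (intro exI[of _ "g s' \<theta>'"] exI[of _ "\<theta>' + k s' \<theta>'"]) (simp add: mult.assoc)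
    qed
    have est: "infdist ((F ^^ n) (polar_point \<rho> s \<theta>)) (polar_curve \<rho> u) \<le> 2 * \<rho> * \<bar>s - u \<theta>\<bar> * ?q ^ n" for n
    proof -
      obtain s' \<theta>' where 1: "\<bar>s'\<bar> \<le> 1/4" "(F ^^ n) (polar_point \<rho> s \<theta>) = polar_point \<rho> s' \<theta>'" "\<bar>s' - u \<theta>'\<bar> \<le> ?q ^ n * \<bar>s - u \<theta>\<bar>" using orb by blast
      have "infdist (polar_point \<rho> s' \<theta>') (polar_curve \<rho> u) \<le> dist (polar_point \<rho> s' \<theta>') (polar_point \<rho> (u \<theta>') \<theta>')"
        by (rule infdist_le) (auto simp: polar_curve_def)
      also have "\<dots> = \<rho> * cmod (exp (Complex s' \<theta>') - exp (Complex (u \<theta>') \<theta>'))"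
        using \<rho> by (simp add: polar_point_def dist_norm norm_mult flip: right_diff_distrib)
      also have "\<dots> \<le> \<rho> * (2 * cmod (Complex s' \<theta>' - Complex (u \<theta>') \<theta>'))"
        using \<rho> 1(1) ub[of \<theta>'] by (intro mult_left_mono exp_lipschitz) auto
      also have "cmod (Complex s' \<theta>' - Complex (u \<theta>') \<theta>') = \<bar>s' - u \<theta>'\<bar>"
        by (simp add: cmod_def complex_diff)
      also have "\<rho> * (2 * \<bar>s' - u \<theta>'\<bar>) \<le> \<rho> * (2 * (?q ^ n * \<bar>s - u \<theta>\<bar>))"
        using \<rho> 1(3) by simp
      finally show ?thesis unfolding 1(2) by (simp add: algebra_simps)
    qed
    have lim: "(\<lambda>n. 2 * \<rho> * \<bar>s - u \<theta>\<bar> * ?q ^ n) \<longlonglongrightarrow> 0"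
      by (rule tendsto_mult_right_zero[OF LIMSEQ_realpow_zero]) (use q c in auto)
    have "(\<lambda>n. infdist ((F ^^ n) (polar_point \<rho> s \<theta>)) (polar_curve \<rho> u)) \<longlonglongrightarrow> 0"
      by (rule Lim_null_comparison[OF _ lim]) (simp add: infdist_nonneg est)
    then show ?thesis using orb by blast
  qed
  ultimately have "attracting_polar_curve F \<rho> u" unfolding attracting_polar_curve_def using u(1-3) by blast
  then show ?thesis by blast
qed

text \<open>The relation between \<rho> and ln \<bar>\<mu>\<bar> makes the circle s = 0 invariant
  for the map without Z. The contraction gap in s and the shear in \<theta> are then both of order
  \<rho>^2, so the slope \<open>L\<close> must be small compared with d / K, while everything coming
  from Z has order \<rho>^3 and is absorbed by a small \<rho>. The threshold \<epsilon> depends on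
  K, d and R alone.\<close>

lemma invariant_curve:
  fixes K d R :: real
  assumes K: "0 < K" and d: "0 < d" and R: "0 < R"
  shows "\<exists>\<epsilon>>0. \<forall>\<rho> \<mu> c E. 0 < \<rho> \<longrightarrow> \<rho> < \<epsilon> \<longrightarrow> 1 \<le> cmod \<mu> \<longrightarrow> cmod (c / \<mu>) \<le> K \<longrightarrow> d \<le> - Re (c / \<mu>) \<longrightarrow>
       ln (cmod \<mu>) = - Re (c / \<mu>) * \<rho>^2 \<longrightarrow> E 0 = 0 \<longrightarrow>
       (\<forall>k x y. k \<le> R \<longrightarrow> cmod x \<le> k \<longrightarrow> cmod y \<le> k \<longrightarrow> cmod (E x - E y) \<le> K * k^3 * cmod (x - y)) \<longrightarrow>
       (\<exists>u. attracting_polar_curve (\<lambda>w. \<mu> * w + c * w^2 * cnj w + E w) \<rho> u)"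
proof -
  define K' where "K' = 64 * K + 5000 * K^2"
  \<comment> \<open>With r = \<rho>^2, the shear constant is at most 5 K r, and L * 5 K r = d r / 2
    spends half of the contraction gap.\<close>
  define L where "L = d / (10 * K)"
  have K': "K' > 0" using K by (simp add: K'_def add_pos_nonneg)
  have L: "L > 0" using K d by (simp add: L_def)
  \<comment> \<open>The first three entries serve \<open>log_coordinates\<close>. The others compare
    M = K' \<rho>^3 with r = \<rho>^2: M \<le> K r for the shear, M (2 L + 1) \<le> d L r / 2 for
    the slope condition, M < d r / 4 for staying in the annulus and for contraction.\<close>
  define \<epsilon> where "\<epsilon> = Min {1, R / 2, 1 / (68 * K), K / K', d * L / 2 / (K' * (2 * L + 1)), d / (4 * K')}"
  have "0 < \<epsilon>" unfolding \<epsilon>_def using K K' L d R by (subst Min_gr_iff) auto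
  moreover have "\<exists>u. attracting_polar_curve (\<lambda>w. \<mu> * w + c * w^2 * cnj w + E w) \<rho> u"
    if \<rho>: "0 < \<rho>" "\<rho> < \<epsilon>" and \<mu>: "1 \<le> cmod \<mu>" and c: "cmod (c / \<mu>) \<le> K" "d \<le> - Re (c / \<mu>)"
      and ln: "ln (cmod \<mu>) = - Re (c / \<mu>) * \<rho>^2" and E0: "E 0 = 0"
      and E: "\<forall>k x y. k \<le> R \<longrightarrow> cmod x \<le> k \<longrightarrow> cmod y \<le> k \<longrightarrow> cmod (E x - E y) \<le> K * k^3 * cmod (x - y)"
    for \<rho> \<mu> c E
  proof -
    define \<kappa> where "\<kappa> = - Re (c / \<mu>)"
    define b where "b = Im (c / \<mu>)"
    have \<kappa>: "d \<le> \<kappa>" "\<kappa> \<le> K" and b: "\<bar>b\<bar> \<le> K"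
      using c abs_Re_le_cmod[of "c / \<mu>"] abs_Im_le_cmod[of "c / \<mu>"] unfolding \<kappa>_def b_def by linarith+
    have \<rho>s: "\<rho> < 1" "\<rho> < R / 2" "\<rho> < 1 / (68 * K)" "\<rho> < K / K'" "\<rho> < d * L / 2 / (K' * (2 * L + 1))" "\<rho> < d / (4 * K')"
      using \<rho>(2) unfolding \<epsilon>_def by auto
    define r where "r = \<rho>^2"
    define M where "M = K' * \<rho>^3"
    have r: "0 < r" "r \<le> \<rho>" using \<rho> \<rho>s(1) by (auto simp: r_def power2_eq_square mult_left_le)
    have Kr: "68 * K * r \<le> 1"
    proof -
      have "68 * K * \<rho> \<le> 1" using \<rho>s(3) K by (simp add: field_simps)
      then show ?thesis using mult_left_mono[OF r(2), of "68 * K"] K by linarith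
    qed
    have Mr: "M = (K' * \<rho>) * r" by (simp add: M_def r_def eval_nat_numeral)
    have M0: "M > 0" using K' \<rho> by (simp add: M_def)
    have M1: "M \<le> K * r" unfolding Mr using \<rho>s(4) K' r by (intro mult_right_mono) (auto simp: field_simps)
    have M2: "M * (2 * L + 1) \<le> d * L / 2 * r"
    proof -
      have "K' * \<rho> * (2 * L + 1) \<le> d * L / 2" using \<rho>s(5) K' L by (simp add: pos_less_divide_eq mult_ac)
      from mult_right_mono[OF this, of r] show ?thesis unfolding Mr using r by (simp add: mult_ac)
    qed
    have M3: "M < d / 4 * r" unfolding Mr using \<rho>s(6) K' r by (intro mult_strict_right_mono) (auto simp: field_simps)
    obtain Z where Z:
      "\<And>\<zeta>::complex. \<bar>Re \<zeta>\<bar> \<le> 1/4 \<Longrightarrow> \<mu> * (\<rho> * exp \<zeta>) + c * (\<rho> * exp \<zeta>)^2 * cnj (\<rho> * exp \<zeta>) + E (\<rho> * exp \<zeta>)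
        = \<rho> * exp (\<zeta> + (Ln \<mu> + c / \<mu> * of_real (\<rho>^2 * exp (2 * Re \<zeta>)) + Z \<zeta>))"
      "\<And>\<zeta>. \<bar>Re \<zeta>\<bar> \<le> 1/4 \<Longrightarrow> cmod (Z \<zeta>) \<le> M"
      "\<And>\<zeta> \<xi>. \<bar>Re \<zeta>\<bar> \<le> 1/4 \<Longrightarrow> \<bar>Re \<xi>\<bar> \<le> 1/4 \<Longrightarrow> cmod (Z \<zeta> - Z \<xi>) \<le> M * cmod (\<zeta> - \<xi>)"
      "\<And>\<zeta>. Z (\<zeta> + of_real (2 * pi) * \<i>) = Z \<zeta>"
      unfolding M_def K'_def
      by (rule log_coordinates[where \<rho> = \<rho> and K = K and R = R and E = E and \<mu> = \<mu> and c = c])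
         (use \<rho> \<rho>s Kr K \<mu> c E0 E in \<open>auto simp: r_def\<close>)
    \<comment> \<open>The logarithmic radius under the map without Z; ln \<bar>\<mu>\<bar> =
      \<kappa> r was substituted, so that h 0 = 0.\<close>
    define h where "h = (\<lambda>s::real. s + \<kappa> * r * (1 - exp (2 * s)))"
    define g where "g = (\<lambda>s \<theta>. h s + Re (Z (Complex s \<theta>)))"
    define k where "k = (\<lambda>s \<theta>. Im (Ln \<mu>) + b * r * exp (2 * s) + Im (Z (Complex s \<theta>)))"
    have e2: "exp (2 * s) \<le> 2" "1/2 \<le> exp (2 * s)" if "\<bar>s\<bar> \<le> 1/4" for s :: real
    proof -
      have "exp (2 * s) \<le> exp (1/2)" "exp (- (1/2)) \<le> exp (2 * s)" using that by auto
      moreover have e12: "exp (1/2) \<le> (2::real)" using exp_bound_half[of "1/2::real"] by simp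
      moreover have "1/2 \<le> exp (- (1/2::real))" using e12 by (simp add: exp_minus field_simps)
      ultimately show "exp (2 * s) \<le> 2" "1/2 \<le> exp (2 * s)" by linarith+
    qed
    \<comment> \<open>The derivative 1 - 2 \<kappa> r exp (2 s) lies between 0 and 1 - \<kappa> r,
      because 1/2 \<le> exp (2 s) \<le> 2 and 4 \<kappa> r \<le> 1.\<close>
    have hd: "\<bar>h s - h s'\<bar> \<le> (1 - \<kappa> * r) * \<bar>s - s'\<bar>" if "\<bar>s\<bar> \<le> 1/4" "\<bar>s'\<bar> \<le> 1/4" for s s'
    proof -
      have "norm (h s - h s') \<le> (1 - \<kappa> * r) * norm (s - s')"
      proof (rule field_differentiable_bound[where S = "{-1/4..1/4}" and f' = "\<lambda>x. 1 - \<kappa> * r * (2 * exp (2 * x))"])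
        fix x :: real assume "x \<in> {-1/4..1/4}"
        then have x: "\<bar>x\<bar> \<le> 1/4" by auto
        show "(h has_field_derivative 1 - \<kappa> * r * (2 * exp (2 * x))) (at x within {-1/4..1/4})"
          unfolding h_def by (auto intro!: derivative_eq_intros)
        have k0: "0 \<le> \<kappa> * r" using \<kappa> d r by simp
        have "\<kappa> * r \<le> K * r" using \<kappa> r by simp
        then have "4 * (\<kappa> * r) \<le> 1" using Kr k0 by linarith
        moreover have "\<kappa> * r * (2 * exp (2 * x)) \<le> \<kappa> * r * 4" "\<kappa> * r * 1 \<le> \<kappa> * r * (2 * exp (2 * x))"
          using e2[OF x] by (intro mult_left_mono k0; simp)+
        ultimately show "norm (1 - \<kappa> * r * (2 * exp (2 * x))) \<le> 1 - \<kappa> * r" unfolding real_norm_def by linarith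
      qed (use that in auto)
      then show ?thesis by simp
    qed
    have ed: "\<bar>exp (2 * s) - exp (2 * s')\<bar> \<le> 4 * \<bar>s - s'\<bar>" if "\<bar>s\<bar> \<le> 1/4" "\<bar>s'\<bar> \<le> 1/4" for s s' :: real
    proof -
      have "norm (exp (2 * s) - exp (2 * s')) \<le> 4 * norm (s - s')"
      proof (rule field_differentiable_bound[where S = "{-1/4..1/4}" and f' = "\<lambda>x. 2 * exp (2 * x)" and f = "\<lambda>x. exp (2 * x)"])
        fix x :: real assume "x \<in> {-1/4..1/4}"
        then have x: "\<bar>x\<bar> \<le> 1/4" by auto
        show "norm (2 * exp (2 * x)) \<le> 4" using e2[OF x] by simp
      qed (use that in \<open>auto intro!: derivative_eq_intros\<close>)
      then show ?thesis by simp
    qed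
    have Zd: "cmod (Z (Complex s \<theta>) - Z (Complex s' \<theta>')) \<le> M * \<bar>s - s'\<bar> + M * \<bar>\<theta> - \<theta>'\<bar>"
      if "\<bar>s\<bar> \<le> 1/4" "\<bar>s'\<bar> \<le> 1/4" for s s' \<theta> \<theta>'
    proof -
      have "cmod (Z (Complex s \<theta>) - Z (Complex s' \<theta>')) \<le> M * cmod (Complex s \<theta> - Complex s' \<theta>')"
        using that by (intro Z(3)) auto
      also have "\<dots> \<le> M * (\<bar>s - s'\<bar> + \<bar>\<theta> - \<theta>'\<bar>)"
        using M0 cmod_le[of "Complex s \<theta> - Complex s' \<theta>'"] by (intro mult_left_mono) auto
      finally show ?thesis by (simp add: distrib_left)
    qed
    have k0: "0 \<le> \<kappa> * r" using \<kappa> d r by simp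
    have kr: "d * r \<le> \<kappa> * r" "\<kappa> * r \<le> K * r" "\<bar>b\<bar> * r \<le> K * r" using \<kappa> b r by auto
    have LC: "L * (4 * K * r + M) \<le> d * r / 2"
    proof -
      have "L * (4 * K * r + M) \<le> L * (5 * K * r)" using M1 L by (intro mult_left_mono) auto
      also have "\<dots> = d * r / 2" using K by (simp add: L_def)
      finally show ?thesis .
    qed
    show ?thesis
    proof (rule attracting_polar_curve_of_skew[where g = g and k = k and A = "1 - \<kappa> * r + M" and B = M and C = "4 * K * r + M" and D = M and L = L])
      fix s \<theta> :: real assume s: "\<bar>s\<bar> \<le> 1/4"
      have "Complex s \<theta> + (Ln \<mu> + c / \<mu> * of_real (\<rho>^2 * exp (2 * Re (Complex s \<theta>))) + Z (Complex s \<theta>)) = Complex (g s \<theta>) (\<theta> + k s \<theta>)"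
      proof -
        have gR: "Re (q * of_real x) = Re q * x" "Im (q * of_real x) = Im q * x" for q x by simp_all
        have cm: "Re (c / \<mu>) = - \<kappa>" "Im (c / \<mu>) = b" by (simp_all only: \<kappa>_def b_def minus_minus)
        have "Re (Ln \<mu>) = ln (cmod \<mu>)" using \<mu> by (intro Re_Ln) auto
        then have "Re (Ln \<mu>) = \<kappa> * r" unfolding ln by (simp only: \<kappa>_def r_def)
        then show ?thesis
          unfolding complex_eq_iff plus_complex.sel complex.sel gR cm g_def k_def h_def r_def by (simp add: algebra_simps)
      qed
      then show "\<mu> * polar_point \<rho> s \<theta> + c * (polar_point \<rho> s \<theta>)^2 * cnj (polar_point \<rho> s \<theta>) + E (polar_point \<rho> s \<theta>) = polar_point \<rho> (g s \<theta>) (\<theta> + k s \<theta>)"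
        using Z(1)[of "Complex s \<theta>"] s unfolding polar_point_def by simp
      have "Complex s (\<theta> + 2 * pi) = Complex s \<theta> + of_real (2 * pi) * \<i>" by (simp add: complex_eq_iff)
      then show "g s (\<theta> + 2 * pi) = g s \<theta>" "k s (\<theta> + 2 * pi) = k s \<theta>" by (simp_all only: g_def k_def Z(4))
      have "\<bar>h s\<bar> \<le> (1 - \<kappa> * r) * \<bar>s\<bar>" using hd[OF s, of 0] by (simp add: h_def)
      also have "\<dots> \<le> (1 - \<kappa> * r) * (1/4)" using s kr Kr k0 by (intro mult_left_mono) linarith+
      finally have "\<bar>h s\<bar> \<le> (1 - \<kappa> * r) / 4" by simp
      moreover have "\<bar>Re (Z (Complex s \<theta>))\<bar> \<le> M" using abs_Re_le_cmod[of "Z (Complex s \<theta>)"] Z(2)[of "Complex s \<theta>"] s by simp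
      ultimately show "\<bar>g s \<theta>\<bar> < 1/4" unfolding g_def using M3 kr(1) by argo
    next
      fix s \<theta> s' \<theta>' :: real assume s: "\<bar>s\<bar> \<le> 1/4" "\<bar>s'\<bar> \<le> 1/4"
      let ?z = "Z (Complex s \<theta>) - Z (Complex s' \<theta>')"
      have "\<bar>g s \<theta> - g s' \<theta>'\<bar> \<le> \<bar>h s - h s'\<bar> + \<bar>Re ?z\<bar>" unfolding g_def by simp
      also have "\<dots> \<le> (1 - \<kappa> * r) * \<bar>s - s'\<bar> + (M * \<bar>s - s'\<bar> + M * \<bar>\<theta> - \<theta>'\<bar>)"
        using hd[OF s] Zd[OF s, of \<theta> \<theta>'] abs_Re_le_cmod[of ?z] by linarith
      finally show "\<bar>g s \<theta> - g s' \<theta>'\<bar> \<le> (1 - \<kappa> * r + M) * \<bar>s - s'\<bar> + M * \<bar>\<theta> - \<theta>'\<bar>" by (simp add: algebra_simps)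
      have "k s \<theta> - k s' \<theta>' = b * r * (exp (2 * s) - exp (2 * s')) + Im ?z" unfolding k_def by (simp add: algebra_simps)
      then have "\<bar>k s \<theta> - k s' \<theta>'\<bar> \<le> \<bar>b * r * (exp (2 * s) - exp (2 * s'))\<bar> + \<bar>Im ?z\<bar>" by linarith
      also have "\<bar>b * r * (exp (2 * s) - exp (2 * s'))\<bar> = (\<bar>b\<bar> * r) * \<bar>exp (2 * s) - exp (2 * s')\<bar>"
        using r by (simp add: abs_mult)
      also have "\<dots> \<le> (K * r) * (4 * \<bar>s - s'\<bar>)" by (rule mult_mono[OF kr(3) ed[OF s]]) (use K r in auto)
      finally show "\<bar>k s \<theta> - k s' \<theta>'\<bar> \<le> (4 * K * r + M) * \<bar>s - s'\<bar> + M * \<bar>\<theta> - \<theta>'\<bar>"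
        using Zd[OF s, of \<theta> \<theta>'] abs_Im_le_cmod[of ?z] by (simp add: algebra_simps)
    next
      show "(4 * K * r + M) * L + M < 1"
      proof -
        have "0 < d * r" using d r by simp
        moreover have "K * r \<le> 1 / 68" using Kr by simp
        ultimately show ?thesis unfolding mult.commute[of _ L] using LC M3 kr by linarith
      qed
      \<comment> \<open>With C = 4 K r + M the slope condition amounts to M (2 L + 1) + L^2 C \<le>
        \<kappa> r L; each summand takes at most half of d r L.\<close>
      have "L * (L * (4 * K * r + M)) \<le> L * (d * r / 2)" using LC L by (intro mult_left_mono) auto
      moreover have "L * (d * r) \<le> L * (\<kappa> * r)" using kr L by (intro mult_left_mono) auto
      ultimately show "(1 - \<kappa> * r + M) * L + M \<le> L * (1 - (4 * K * r + M) * L - M)"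
        using M2 by (simp add: algebra_simps)
      show "1 - \<kappa> * r + M + L * (4 * K * r + M) < 1" using LC M3 kr(1) mult_pos_pos[OF d r(1)] by linarith
      show "0 \<le> 1 - \<kappa> * r + M" using kr Kr k0 M0 by linarith
    qed (use \<rho> M0 K r L in auto)
  qed
  ultimately show ?thesis by blast
qed

section \<open>Closed curves in the plane\<close>

lemma norm_polar_point: "0 \<le> \<rho> \<Longrightarrow> cmod (polar_point \<rho> s \<theta>) = \<rho> * exp s"
  by (simp add: polar_point_def norm_mult)

lemma polar_point_eq_iff:
  assumes "\<rho> \<noteq> 0"
  shows "polar_point \<rho> s \<theta> = polar_point \<rho> s' \<theta>' \<longleftrightarrow> s = s' \<and> (\<exists>n::int. \<theta> = \<theta>' + of_int (2 * n) * pi)"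
  using assms by (simp add: polar_point_def exp_eq) (auto simp: complex_eq_iff)

lemma polar_point_Arg:
  assumes "0 < \<rho>" "w \<noteq> 0"
  shows "w = polar_point \<rho> (ln (cmod w / \<rho>)) (Arg w)"
proof -
  have "polar_point \<rho> (ln (cmod w / \<rho>)) (Arg w) = complex_of_real (cmod w) * exp (\<i> * Arg w)"
    using assms by (simp add: polar_point_def Complex_eq exp_add exp_of_real)
  from Arg_eq[OF assms(2)] this[symmetric] show ?thesis by (rule trans)
qed

lemma periodic_2pi_int:
  assumes "\<And>\<theta>. u (\<theta> + 2 * pi) = u \<theta>"
  shows "u (\<theta> + of_int (2 * n) * pi) = (u \<theta> :: 'a)"
proof -
  interpret periodic_fun_simple u "2 * pi" by unfold_locales (rule assms)
  show ?thesis using plus_of_int[of \<theta> n] by (simp add: mult_ac)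
qed

text \<open>The jump of \<open>Arg\<close> by 2\<pi> is invisible to the periodic u. Near w0 the
  angle may therefore be replaced by Arg (w / w0) + Arg w0, whose first argument is close to 1, away
  from the cut.\<close>

lemma continuous_on_periodic_Arg:
  fixes u :: "real \<Rightarrow> real"
  assumes "continuous_on UNIV u" and per: "\<And>\<theta>. u (\<theta> + 2 * pi) = u \<theta>"
  shows "continuous_on (- {0}) (\<lambda>w. u (Arg w))"
proof (intro continuous_at_imp_continuous_on ballI)
  fix w0 :: complex assume w0: "w0 \<in> - {0}"
  have eq: "u (Arg w) = u (Arg (w / w0) + Arg w0)" if "w \<noteq> 0" for w
  proof -
    have e: "exp (\<i> * Arg z) = z / cmod z" if "z \<noteq> 0" for z
      using Arg_eq[OF that] that by (metis nonzero_mult_div_cancel_left norm_eq_zero of_real_eq_0_iff)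
    have "exp (\<i> * Arg w) = exp (\<i> * (Arg (w / w0) + Arg w0))"
      using that w0 by (simp add: exp_add distrib_left e norm_divide)
    then obtain n :: int where "\<i> * Arg w = \<i> * (Arg (w / w0) + Arg w0) + (of_int (2 * n) * pi) * \<i>"
      unfolding exp_eq by blast
    then have "Arg w = (Arg (w / w0) + Arg w0) + of_int (2 * n) * pi" by (simp add: complex_eq_iff)
    then show ?thesis using periodic_2pi_int[of u, OF per] by simp
  qed
  have "isCont (\<lambda>w. Arg (w / w0)) w0"
    by (rule isCont_o2[where g = Arg]) (use w0 in \<open>auto intro!: continuous_intros continuous_at_Arg\<close>)
  then have c: "isCont (\<lambda>w. Arg (w / w0) + Arg w0) w0" by (rule isCont_add) simp
  have "isCont u x" for x using assms(1) by (simp add: continuous_on_eq_continuous_at)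
  then have "isCont (\<lambda>w. u (Arg (w / w0) + Arg w0)) w0" by (rule isCont_o2[OF c])
  moreover have "\<forall>\<^sub>F w in nhds w0. w \<in> - {0}" using w0 by (intro eventually_nhds_in_open) auto
  then have "\<forall>\<^sub>F w in nhds w0. u (Arg w) = u (Arg (w / w0) + Arg w0)"
    by (rule eventually_mono) (rule eq, simp)
  ultimately show "isCont (\<lambda>w. u (Arg w)) w0" by (metis isCont_cong)
qed

lemma closed_curve_around_polar_image:
  fixes T :: "complex \<Rightarrow> real^2"
  assumes \<rho>: "0 < \<rho>" "2 * \<rho> \<le> m"
    and T: "continuous_on (ball 0 m) T" "inj_on T (ball 0 m)"
    and u: "continuous_on UNIV u" "\<And>\<theta>. u (\<theta> + 2 * pi) = u \<theta>" "\<And>\<theta>. \<bar>u \<theta>\<bar> < 1/4"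
  shows "closed_curve_around (T ` polar_curve \<rho> u) (T 0)"
proof -
  define q where "q = (\<lambda>w. \<rho> * exp (u (Arg w)) - cmod w)"
  have q_cont: "continuous_on (- {0}) q"
    unfolding q_def by (intro continuous_intros continuous_on_periodic_Arg u)
  have small: "\<rho> * exp s < m" if "s < 1/4" for s
  proof -
    have "exp s < exp (1/4)" using that by simp
    moreover have "exp (1/4) \<le> (2::real)" using exp_bound_half[of "1/4::real"] by simp
    ultimately have "exp s < 2" by linarith
    then have "\<rho> * exp s < \<rho> * 2" using \<rho>(1) by (intro mult_strict_left_mono)
    then show ?thesis using \<rho>(2) by simp
  qed
  have curve_ball: "polar_curve \<rho> u \<subseteq> ball 0 m"
  proof -
    have "u \<theta> < 1/4" for \<theta> using u(3)[of \<theta>] by simp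
    then show ?thesis using \<rho> small by (auto simp: polar_curve_def norm_polar_point)
  qed
  have cb: "polar_point \<rho> (u \<theta>) \<theta> \<in> ball 0 m" for \<theta> using curve_ball unfolding polar_curve_def by blast
  have curve_iff: "w \<in> polar_curve \<rho> u \<longleftrightarrow> w \<noteq> 0 \<and> q w = 0" for w
  proof
    assume "w \<in> polar_curve \<rho> u"
    then obtain \<theta> where w: "w = polar_point \<rho> (u \<theta>) \<theta>" by (auto simp: polar_curve_def)
    have n: "cmod w = \<rho> * exp (u \<theta>)" using \<rho> by (simp add: w norm_polar_point)
    then have w0: "w \<noteq> 0" using \<rho> by auto
    from polar_point_Arg[OF \<rho>(1) w0] w obtain k :: int where "\<theta> = Arg w + of_int (2 * k) * pi"
      using polar_point_eq_iff[of \<rho>] \<rho> by (metis less_irrefl)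
    then have "u \<theta> = u (Arg w)" using periodic_2pi_int[of u, OF u(2)] by metis
    then show "w \<noteq> 0 \<and> q w = 0" using w0 n by (simp add: q_def)
  next
    assume w: "w \<noteq> 0 \<and> q w = 0"
    then have "cmod w / \<rho> = exp (u (Arg w))" using \<rho> by (simp add: q_def field_simps)
    then have "ln (cmod w / \<rho>) = u (Arg w)" by simp
    then have "w = polar_point \<rho> (u (Arg w)) (Arg w)" using polar_point_Arg[OF \<rho>(1)] w by metis
    then show "w \<in> polar_curve \<rho> u" unfolding polar_curve_def by blast
  qed
  define a where "a = \<rho> * exp (- 1/4)"
  have a: "0 < a" using \<rho> by (simp add: a_def)
  have q_pos: "0 < q w" if "cmod w \<le> a" for w
  proof -
    have "a < \<rho> * exp (u (Arg w))" unfolding a_def using \<rho> u(3)[of "Arg w"] by (intro mult_strict_left_mono) auto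
    then show ?thesis using that by (simp add: q_def)
  qed
  define D where "D = {w. 0 < q w}"
  define D' where "D' = {w. 0 \<le> q w}"
  have q_lt: "cmod w < m" if "0 \<le> q w" for w
  proof -
    have "u (Arg w) < 1/4" using u(3)[of "Arg w"] by linarith
    from small[OF this] show ?thesis using that by (simp add: q_def)
  qed
  \<comment> \<open>Continuity of q is available only away from 0, so a disc on which q is positive
    is added separately.\<close>
  have "open D"
  proof -
    have "D = ball 0 a \<union> (- {0} \<inter> q -` {0<..})"
      using q_pos a by (auto simp: D_def)
    moreover have "open (- {0} \<inter> q -` {0<..})" by (rule continuous_open_preimage[OF q_cont]) auto
    ultimately show ?thesis by (metis open_Un open_ball)
  qed
  have "compact D'"
  proof -
    have "- D' = - {0} \<inter> q -` {..<0}"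
      using q_pos[of 0] a by (auto simp: D'_def)
    moreover have "open (- {0} \<inter> q -` {..<0})" by (rule continuous_open_preimage[OF q_cont]) auto
    ultimately have "open (- D')" by metis
    then have "closed D'" by (simp add: closed_def)
    moreover have "bounded D'" unfolding bounded_iff using q_lt by (intro exI[of _ m]) (auto simp: D'_def intro: less_imp_le)
    ultimately show ?thesis by (simp add: compact_eq_bounded_closed)
  qed
  have D'_ball: "D' \<subseteq> ball 0 m" using q_lt by (auto simp: D'_def)
  have D_D': "D' = D \<union> polar_curve \<rho> u" using q_pos[of 0] a by (auto simp: D_def D'_def curve_iff)
  have 0: "0 \<in> D" "0 \<notin> polar_curve \<rho> u" using q_pos[of 0] a by (auto simp: D_def curve_iff)
  have zm: "0 \<in> ball (0::complex) m" using \<rho> by simp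
  have notin: "T 0 \<notin> T ` polar_curve \<rho> u"
    using 0(2) inj_onD[OF T(2) _ zm] curve_ball by blast
  have open_TD: "open (T ` D)"
  proof (rule invariance_of_domain_gen[OF \<open>open D\<close>])
    show "continuous_on D T" "inj_on T D" using T D'_ball D_D' by (auto intro: continuous_on_subset inj_on_subset)
  qed simp
  have compact_TD': "compact (T ` D')"
    using T D'_ball by (intro compact_continuous_image \<open>compact D'\<close>) (auto intro: continuous_on_subset)
  define c where "c = (\<lambda>t. T (polar_point \<rho> (u (2 * pi * t)) (2 * pi * t)))"
  have "simple_path c"
    unfolding simple_path_def path_def loop_free_def
  proof (intro conjI ballI impI)
    have "continuous_on {0..1} (\<lambda>t. polar_point \<rho> (u (2 * pi * t)) (2 * pi * t))"
      unfolding polar_point_def Complex_eq by (intro continuous_intros continuous_on_compose2[OF u(1)]) auto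
    then show "continuous_on {0..1} c"
      unfolding c_def using curve_ball by (intro continuous_on_compose2[OF T(1)]) (auto simp: polar_curve_def)
    fix x y :: real assume xy: "x \<in> {0..1}" "y \<in> {0..1}" "c x = c y"
    have "polar_point \<rho> (u (2 * pi * x)) (2 * pi * x) = polar_point \<rho> (u (2 * pi * y)) (2 * pi * y)"
      using inj_onD[OF T(2) xy(3)[unfolded c_def] cb cb] .
    then obtain n :: int where "2 * pi * x = 2 * pi * y + of_int (2 * n) * pi"
      using polar_point_eq_iff[of \<rho>] \<rho> by (metis less_irrefl)
    then have "2 * pi * x = 2 * pi * (y + of_int n)" by (simp add: algebra_simps)
    then have n: "x = y + of_int n" by simp
    then have "\<bar>real_of_int n\<bar> \<le> 1" using xy by auto
    then have "n = 0 \<or> n = 1 \<or> n = -1" by linarith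
    then show "x = y \<or> x = 0 \<and> y = 1 \<or> x = 1 \<and> y = 0" using n xy by auto
  qed
  moreover have "pathfinish c = pathstart c"
  proof -
    have "polar_point \<rho> (u (2 * pi * 1)) (2 * pi * 1) = polar_point \<rho> (u (2 * pi * 0)) (2 * pi * 0)"
      using u(2)[of 0] \<rho> by (subst polar_point_eq_iff) (auto intro!: exI[of _ 1])
    then show ?thesis by (simp add: c_def pathfinish_def pathstart_def)
  qed
  moreover have "path_image c = T ` polar_curve \<rho> u"
  proof -
    have "polar_curve \<rho> u = (\<lambda>t. polar_point \<rho> (u (2 * pi * t)) (2 * pi * t)) ` {0..1}"
    proof (intro equalityI subsetI)
      fix z assume "z \<in> polar_curve \<rho> u"
      then obtain \<theta> where z: "z = polar_point \<rho> (u \<theta>) \<theta>" by (auto simp: polar_curve_def)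
      define t where "t = frac (\<theta> / (2 * pi))"
      have \<theta>: "\<theta> = 2 * pi * t + of_int (2 * \<lfloor>\<theta> / (2 * pi)\<rfloor>) * pi"
        by (simp add: t_def frac_def field_simps)
      then have "u \<theta> = u (2 * pi * t)" using periodic_2pi_int[of u, OF u(2)] by metis
      then have "z = polar_point \<rho> (u (2 * pi * t)) (2 * pi * t)"
        unfolding z using \<theta> \<rho> by (subst polar_point_eq_iff) auto
      moreover have "t \<in> {0..1}" by (simp add: t_def frac_lt_1 less_imp_le)
      ultimately show "z \<in> (\<lambda>t. polar_point \<rho> (u (2 * pi * t)) (2 * pi * t)) ` {0..1}" by blast
    qed (auto simp: polar_curve_def)
    then show ?thesis by (simp add: c_def path_image_def image_image)
  qed
  moreover have "T 0 \<in> inside (T ` polar_curve \<rho> u)"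
  proof -
    let ?S = "connected_component_set (- (T ` polar_curve \<rho> u)) (T 0)"
    have S: "?S \<subseteq> - (T ` polar_curve \<rho> u)" by (rule connected_component_subset)
    have TD': "T ` D' = T ` D \<union> T ` polar_curve \<rho> u" by (simp add: D_D' image_Un)
    have "T ` D \<inter> ?S = {} \<or> - (T ` D') \<inter> ?S = {}"
    proof (rule connectedD[OF connected_connected_component open_TD])
      show "open (- T ` D')" using compact_TD' by (simp add: compact_imp_closed open_Compl)
      show "T ` D \<inter> - T ` D' \<inter> ?S = {}" using TD' by blast
      show "?S \<subseteq> T ` D \<union> - T ` D'" using TD' S by blast
    qed
    moreover have "T 0 \<in> T ` D \<inter> ?S" using 0 notin by (simp add: connected_component_refl)
    ultimately have "?S \<subseteq> T ` D'" by blast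
    then have "bounded ?S" using compact_imp_bounded[OF compact_TD'] bounded_subset by blast
    then show ?thesis unfolding inside_def using notin by blast
  qed
  ultimately show ?thesis unfolding closed_curve_around_def by blast
qed

text \<open>Orbits starting in the annulus never leave it, hence never leave the disc where f and F
  are semiconjugate. By invariance of domain the image of the open annulus is an open neighbourhood
  of the compact curve, so it contains all points within some distance \<delta> of the
  curve.\<close>

lemma attracting_polar_image:
  fixes T :: "complex \<Rightarrow> real^2"
  assumes \<rho>: "0 < \<rho>" "2 * \<rho> \<le> m"
    and T: "\<And>x y. x \<in> ball 0 m \<Longrightarrow> y \<in> ball 0 m \<Longrightarrow> dist (T x) (T y) \<le> K * dist x y" "inj_on T (ball 0 m)"
    and semiconj: "\<And>w. w \<in> ball 0 m \<Longrightarrow> f (T w) = T (F w)"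
    and A: "attracting_polar_curve F \<rho> u"
  shows "closed_curve_around (T ` polar_curve \<rho> u) (T 0)"
    and "f ` T ` polar_curve \<rho> u = T ` polar_curve \<rho> u"
    and "attracting_set f (T ` polar_curve \<rho> u)"
proof -
  let ?C = "polar_curve \<rho> u"
  have u: "continuous_on UNIV u" "\<And>\<theta>. u (\<theta> + 2 * pi) = u \<theta>" "\<And>\<theta>. \<bar>u \<theta>\<bar> < 1/4"
    and FC: "F ` ?C = ?C"
    and orb: "\<And>s \<theta> n. \<bar>s\<bar> \<le> 1/4 \<Longrightarrow> \<exists>s' \<theta>'. \<bar>s'\<bar> \<le> 1/4 \<and> (F ^^ n) (polar_point \<rho> s \<theta>) = polar_point \<rho> s' \<theta>'"
    and lim: "\<And>s \<theta>. \<bar>s\<bar> \<le> 1/4 \<Longrightarrow> (\<lambda>n. infdist ((F ^^ n) (polar_point \<rho> s \<theta>)) ?C) \<longlonglongrightarrow> 0"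
    using A unfolding attracting_polar_curve_def by blast+
  have Tc: "continuous_on (ball 0 m) T"
  proof (rule lipschitz_on_continuous_on[where L = "\<bar>K\<bar>"], rule lipschitz_onI)
    fix x y :: complex assume xy: "x \<in> ball 0 m" "y \<in> ball 0 m"
    have "K * dist x y \<le> \<bar>K\<bar> * dist x y" by (intro mult_right_mono) auto
    then show "dist (T x) (T y) \<le> \<bar>K\<bar> * dist x y" using T(1)[OF xy] by linarith
  qed simp
  have small: "\<rho> * exp s < m" if "\<bar>s\<bar> \<le> 1/4" for s
  proof -
    have "exp s \<le> exp (1/4)" "exp (1/4::real) < exp (1/2)" using that by auto
    moreover have "exp (1/2) \<le> (2::real)" using exp_bound_half[of "1/2::real"] by simp
    ultimately have "exp s < 2" by linarith
    then have "\<rho> * exp s < \<rho> * 2" using \<rho>(1) by (intro mult_strict_left_mono)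
    then show ?thesis using \<rho>(2) by simp
  qed
  have pb: "polar_point \<rho> s \<theta> \<in> ball 0 m" if "\<bar>s\<bar> \<le> 1/4" for s \<theta>
    using small[OF that] \<rho> by (simp add: norm_polar_point)
  have Cb: "?C \<subseteq> ball 0 m" unfolding polar_curve_def using pb[OF less_imp_le[OF u(3)]] by blast
  show cc: "closed_curve_around (T ` ?C) (T 0)"
    by (rule closed_curve_around_polar_image[OF \<rho> Tc T(2) u])
  have "f ` T ` ?C = T ` F ` ?C"
    unfolding image_image by (rule image_cong[OF refl]) (use semiconj Cb in blast)
  then show "f ` T ` ?C = T ` ?C" by (simp add: FC)
  have compTC: "compact (T ` ?C)"
  proof -
    obtain c where "simple_path c" "path_image c = T ` ?C" using cc unfolding closed_curve_around_def by blast
    then show ?thesis using compact_simple_path_image[of c] by simp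
  qed
  define O' where "O' = {w. \<rho> * exp (- 1/4) < cmod w \<and> cmod w < \<rho> * exp (1/4)}"
  have O': "\<exists>s \<theta>. \<bar>s\<bar> \<le> 1/4 \<and> w = polar_point \<rho> s \<theta>" if "w \<in> O'" for w
  proof -
    have w: "\<rho> * exp (- 1/4) < cmod w" "cmod w < \<rho> * exp (1/4)" using that by (auto simp: O'_def)
    have "0 < \<rho> * exp (- 1/4)" using \<rho> by simp
    then have w0: "w \<noteq> 0" using w(1) by auto
    have p: "0 < cmod w / \<rho>" using w0 \<rho> by simp
    have "exp (- 1/4) < cmod w / \<rho>" "cmod w / \<rho> < exp (1/4)" using w \<rho> by (simp_all add: field_simps)
    then have "exp (- 1/4) < exp (ln (cmod w / \<rho>))" "exp (ln (cmod w / \<rho>)) < exp (1/4)"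
      unfolding exp_ln[OF p] .
    then have "- 1/4 < ln (cmod w / \<rho>)" "ln (cmod w / \<rho>) < 1/4"
      by (simp_all only: exp_less_cancel_iff)
    then show ?thesis using polar_point_Arg[OF \<rho>(1) w0] by (intro exI[of _ "ln (cmod w / \<rho>)"] exI[of _ "Arg w"]) auto
  qed
  have O'b: "O' \<subseteq> ball 0 m" using O' pb by blast
  have "open O'"
    unfolding O'_def by (intro open_Collect_conj open_Collect_less continuous_intros)
  have open_TO: "open (T ` O')"
    by (rule invariance_of_domain_gen[OF \<open>open O'\<close>])
       (use Tc T(2) O'b in \<open>auto intro: continuous_on_subset inj_on_subset\<close>)
  have CO: "?C \<subseteq> O'"
  proof
    fix w assume "w \<in> ?C"
    then obtain \<theta> where w: "w = polar_point \<rho> (u \<theta>) \<theta>" by (auto simp: polar_curve_def)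
    have "exp (- 1/4) < exp (u \<theta>)" "exp (u \<theta>) < exp (1/4)" using u(3)[of \<theta>] by auto
    then show "w \<in> O'" using \<rho> by (simp add: w O'_def norm_polar_point)
  qed
  have attr: "(\<lambda>n. infdist ((f ^^ n) x) (T ` ?C)) \<longlonglongrightarrow> 0" if xO: "x \<in> T ` O'" for x
  proof -
    obtain s \<theta> where s: "\<bar>s\<bar> \<le> 1/4" and x: "x = T (polar_point \<rho> s \<theta>)" using xO O' by blast
    let ?w = "\<lambda>n. (F ^^ n) (polar_point \<rho> s \<theta>)"
    have wb: "?w n \<in> ball 0 m" for n using orb[OF s, of n \<theta>] pb by metis
    have fx: "(f ^^ n) x = T (?w n)" for n
      by (induction n) (simp_all add: x semiconj[OF wb])
    have "infdist (T (?w n)) (T ` ?C) \<le> \<bar>K\<bar> * infdist (?w n) ?C" for n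
    proof -
      have ne: "?C \<noteq> {}" by (simp add: polar_curve_def)
      have 1: "infdist (T (?w n)) (T ` ?C) \<le> \<bar>K\<bar> * dist (?w n) c" if "c \<in> ?C" for c
      proof -
        have "infdist (T (?w n)) (T ` ?C) \<le> dist (T (?w n)) (T c)" using that by (intro infdist_le) auto
        also have "\<dots> \<le> K * dist (?w n) c" using T(1)[OF wb] that Cb by blast
        also have "\<dots> \<le> \<bar>K\<bar> * dist (?w n) c" by (intro mult_right_mono) auto
        finally show ?thesis .
      qed
      show ?thesis
      proof (cases "K = 0")
        case True
        then show ?thesis using 1 ne infdist_nonneg by (metis abs_zero all_not_in_conv mult_zero_left)
      next
        case False
        then have "infdist (T (?w n)) (T ` ?C) / \<bar>K\<bar> \<le> dist (?w n) c" if "c \<in> ?C" for c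
          using 1[OF that] by (simp add: divide_le_eq mult.commute)
        then have "infdist (T (?w n)) (T ` ?C) / \<bar>K\<bar> \<le> infdist (?w n) ?C"
          using ne by (auto simp: infdist_def intro!: cINF_greatest)
        then show ?thesis using False by (simp add: divide_le_eq mult.commute)
      qed
    qed
    moreover have "(\<lambda>n. \<bar>K\<bar> * infdist (?w n) ?C) \<longlonglongrightarrow> 0"
      by (rule tendsto_mult_right_zero[OF lim[OF s]])
    ultimately show ?thesis
      unfolding fx by (intro Lim_null_comparison[of "\<lambda>n. infdist (T (?w n)) (T ` ?C)"]) (auto simp: infdist_nonneg)
  qed
  obtain \<delta> where \<delta>: "\<delta> > 0" "(\<Union>x\<in>T ` ?C. ball x \<delta>) \<subseteq> T ` O'"
    using compact_subset_open_imp_ball_epsilon_subset[OF compTC open_TO] CO by blast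
  have sub: "x \<in> T ` O'" if "infdist x (T ` ?C) < \<delta>" for x
  proof -
    have "T ` ?C \<noteq> {}" by (simp add: polar_curve_def)
    then obtain y where "y \<in> T ` ?C" "infdist x (T ` ?C) = dist x y"
      using infdist_attains_inf[OF compact_imp_closed[OF compTC]] by blast
    then show ?thesis using that \<delta>(2) by (force simp: dist_commute)
  qed
  show "attracting_set f (T ` ?C)"
    unfolding attracting_set_def by (intro exI[of _ \<delta>] conjI allI impI \<delta>(1) attr sub)
qed

section \<open>Third-order normal form\<close>

text \<open>Big-O of order \<open>n\<close> together with the corresponding Lipschitz bound; the latter is multiplied by \<open>m\<close> so
  that the calculus also covers constants (\<open>n = 0\<close>).\<close>

definition lip_bound :: "real \<Rightarrow> nat \<Rightarrow> (complex \<Rightarrow> complex) \<Rightarrow> bool" where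
  "lip_bound K n f \<longleftrightarrow> (\<forall>m x y. 0 < m \<longrightarrow> m \<le> 1 \<longrightarrow> cmod x \<le> m \<longrightarrow> cmod y \<le> m \<longrightarrow>
     cmod (f x) \<le> K * m^n \<and> m * cmod (f x - f y) \<le> K * m^n * cmod (x - y))"

text \<open>One constant for all parameters close to the limit: this is how uniformity in \<gamma>
  is carried through the normal form computation.\<close>

definition big_lip :: "'p filter \<Rightarrow> nat \<Rightarrow> ('p \<Rightarrow> complex \<Rightarrow> complex) \<Rightarrow> bool" where
  "big_lip F n R \<longleftrightarrow> (\<exists>K>0. \<forall>\<^sub>F p in F. lip_bound K n (R p))"

lemma lip_boundD:
  assumes "lip_bound K n f" "0 < m" "m \<le> 1" "cmod x \<le> m"
  shows "cmod (f x) \<le> K * m^n" "cmod y \<le> m \<Longrightarrow> m * cmod (f x - f y) \<le> K * m^n * cmod (x - y)"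
  using assms unfolding lip_bound_def by (blast, blast)

lemma big_lip_const:
  assumes "isCont f p0"
  shows "big_lip (nhds p0) 0 (\<lambda>p z. f p)"
proof -
  have "((\<lambda>p. cmod (f p)) \<longlongrightarrow> cmod (f p0)) (nhds p0)"
    using assms by (intro tendsto_norm) (simp add: continuous_at tendsto_at_iff_tendsto_nhds)
  then have "\<forall>\<^sub>F p in nhds p0. cmod (f p) < cmod (f p0) + 1" by (rule order_tendstoD) simp
  then have "\<forall>\<^sub>F p in nhds p0. lip_bound (cmod (f p0) + 1) 0 (\<lambda>z. f p)"
    by eventually_elim (auto simp: lip_bound_def)
  moreover have "0 < cmod (f p0) + 1" by (simp add: add_nonneg_pos)
  ultimately show ?thesis unfolding big_lip_def by blast
qed

lemma big_lip_id: "big_lip F 1 (\<lambda>p z. z)"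
  unfolding big_lip_def lip_bound_def by (intro exI[of _ 1]) simp

lemma big_lip_cnj: "big_lip F n R \<Longrightarrow> big_lip F n (\<lambda>p z. cnj (R p z))"
  unfolding big_lip_def lip_bound_def by (simp flip: complex_cnj_diff)

lemma big_lip_mono:
  assumes "big_lip F n R" "k \<le> n"
  shows "big_lip F k R"
proof -
  obtain K where K: "0 < K" "\<forall>\<^sub>F p in F. lip_bound K n (R p)" using assms(1) unfolding big_lip_def by blast
  have "lip_bound K k f" if f: "lip_bound K n f" for f
    unfolding lip_bound_def
  proof (intro allI impI)
    fix m :: real and x y :: complex assume m: "0 < m" "m \<le> 1" and xy: "cmod x \<le> m" "cmod y \<le> m"
    have le: "K * m^n \<le> K * m^k" using m K(1) assms(2) by (intro mult_left_mono power_decreasing) auto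
    show "cmod (f x) \<le> K * m^k \<and> m * cmod (f x - f y) \<le> K * m^k * cmod (x - y)"
      using lip_boundD[OF f m xy(1)] xy(2) le mult_right_mono[OF le, of "cmod (x - y)"] by fastforce
  qed
  then have "\<forall>\<^sub>F p in F. lip_bound K k (R p)" by (rule eventually_mono[OF K(2)])
  then show ?thesis unfolding big_lip_def using K(1) by blast
qed

lemma lip_bound_add:
  assumes f: "lip_bound K n f" and g: "lip_bound L n g"
  shows "lip_bound (K + L) n (\<lambda>z. f z + g z)"
  unfolding lip_bound_def
proof (intro allI impI conjI)
  fix m :: real and x y :: complex assume m: "0 < m" "m \<le> 1" and xy: "cmod x \<le> m" "cmod y \<le> m"
  note f' = lip_boundD(1)[OF f m xy(1)] lip_boundD(2)[OF f m xy]
  note g' = lip_boundD(1)[OF g m xy(1)] lip_boundD(2)[OF g m xy]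
  show "cmod (f x + g x) \<le> (K + L) * m^n"
    using norm_triangle_ineq[of "f x" "g x"] f'(1) g'(1) by (simp add: distrib_right)
  have "f x + g x - (f y + g y) = (f x - f y) + (g x - g y)" by simp
  then have "cmod (f x + g x - (f y + g y)) \<le> cmod (f x - f y) + cmod (g x - g y)" by (metis norm_triangle_ineq)
  then have "m * cmod (f x + g x - (f y + g y)) \<le> m * (cmod (f x - f y) + cmod (g x - g y))"
    using m by (intro mult_left_mono) auto
  then show "m * cmod (f x + g x - (f y + g y)) \<le> (K + L) * m^n * cmod (x - y)"
    using f'(2) g'(2) by (simp add: distrib_left distrib_right)
qed

lemma lip_bound_mult:
  assumes f: "lip_bound K i f" and g: "lip_bound L j g" and KL: "0 < K" "0 < L"
  shows "lip_bound (2 * K * L) (i + j) (\<lambda>z. f z * g z)"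
  unfolding lip_bound_def
proof (intro allI impI conjI)
  fix m :: real and x y :: complex assume m: "0 < m" "m \<le> 1" and xy: "cmod x \<le> m" "cmod y \<le> m"
  note f' = lip_boundD(1)[OF f m xy(1)] lip_boundD(2)[OF f m xy]
  note g' = lip_boundD(1)[OF g m xy(1)] lip_boundD(1)[OF g m xy(2)] lip_boundD(2)[OF g m xy]
  have "cmod (f x * g x) \<le> (K * m^i) * (L * m^j)"
    unfolding norm_mult by (intro mult_mono f' g') (use KL m in auto)
  also have "\<dots> = 1 * (K * L * m^(i + j))" by (simp add: power_add)
  also have "\<dots> \<le> 2 * (K * L * m^(i + j))" using KL m by (intro mult_right_mono) auto
  finally show "cmod (f x * g x) \<le> 2 * K * L * m^(i + j)" by (simp add: mult.assoc)
  have "f x * g x - f y * g y = f x * (g x - g y) + (f x - f y) * g y" by (simp add: algebra_simps)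
  then have "cmod (f x * g x - f y * g y) \<le> cmod (f x) * cmod (g x - g y) + cmod (f x - f y) * cmod (g y)"
    by (metis norm_triangle_ineq norm_mult)
  then have "m * cmod (f x * g x - f y * g y) \<le> m * (cmod (f x) * cmod (g x - g y) + cmod (f x - f y) * cmod (g y))"
    using m by (intro mult_left_mono) auto
  also have "\<dots> = cmod (f x) * (m * cmod (g x - g y)) + (m * cmod (f x - f y)) * cmod (g y)" by (simp add: algebra_simps)
  also have "\<dots> \<le> (K * m^i) * (L * m^j * cmod (x - y)) + (K * m^i * cmod (x - y)) * (L * m^j)"
    by (intro add_mono mult_mono f' g') (use KL m in auto)
  also have "\<dots> = 2 * K * L * m^(i + j) * cmod (x - y)" by (simp add: power_add)
  finally show "m * cmod (f x * g x - f y * g y) \<le> 2 * K * L * m^(i + j) * cmod (x - y)" .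
qed

lemma big_lip_add:
  assumes "big_lip F n R" "big_lip F n S"
  shows "big_lip F n (\<lambda>p z. R p z + S p z)"
proof -
  obtain K where K: "0 < K" "\<forall>\<^sub>F p in F. lip_bound K n (R p)" using assms(1) unfolding big_lip_def by blast
  obtain L where L: "0 < L" "\<forall>\<^sub>F p in F. lip_bound L n (S p)" using assms(2) unfolding big_lip_def by blast
  have "\<forall>\<^sub>F p in F. lip_bound (K + L) n (\<lambda>z. R p z + S p z)"
    using K(2) L(2) by eventually_elim (rule lip_bound_add)
  moreover have "0 < K + L" using K(1) L(1) by simp
  ultimately show ?thesis unfolding big_lip_def by blast
qed

lemma big_lip_mult:
  assumes "big_lip F i R" "big_lip F j S" "n \<le> i + j"
  shows "big_lip F n (\<lambda>p z. R p z * S p z)"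
proof -
  obtain K where K: "0 < K" "\<forall>\<^sub>F p in F. lip_bound K i (R p)" using assms(1) unfolding big_lip_def by blast
  obtain L where L: "0 < L" "\<forall>\<^sub>F p in F. lip_bound L j (S p)" using assms(2) unfolding big_lip_def by blast
  have "\<forall>\<^sub>F p in F. lip_bound (2 * K * L) (i + j) (\<lambda>z. R p z * S p z)"
    using K(2) L(2) by eventually_elim (rule lip_bound_mult[OF _ _ K(1) L(1)])
  moreover have "0 < 2 * K * L" using K(1) L(1) by simp
  ultimately have "big_lip F (i + j) (\<lambda>p z. R p z * S p z)" unfolding big_lip_def by blast
  then show ?thesis using assms(3) by (rule big_lip_mono)
qed

lemma big_lip_cong:
  assumes "big_lip F n R" "\<forall>\<^sub>F p in F. S p = R p"
  shows "big_lip F n S"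
proof -
  obtain K where K: "0 < K" "\<forall>\<^sub>F p in F. lip_bound K n (R p)" using assms(1) unfolding big_lip_def by blast
  have "\<forall>\<^sub>F p in F. lip_bound K n (S p)" using K(2) assms(2) by eventually_elim simp
  then show ?thesis unfolding big_lip_def using K(1) by blast
qed

text \<open>For w in the half-size disc, z \<mapsto> w - h z is a 1/2-contraction of the disc of
  radius m, and its fixed point solves z + h z = w. The same bound on h shows that z \<mapsto> z + h
  z shrinks distances at most by 2, which gives uniqueness and the Lipschitz constant of
  \<psi>.\<close>

lemma near_identity_inverse:
  fixes h :: "complex \<Rightarrow> complex"
  assumes m: "0 < m" and h0: "h 0 = 0"
    and h: "\<And>x y. cmod x \<le> m \<Longrightarrow> cmod y \<le> m \<Longrightarrow> cmod (h x - h y) \<le> cmod (x - y) / 2"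
  obtains \<psi> where "\<And>w. cmod w \<le> m / 2 \<Longrightarrow> cmod (\<psi> w) \<le> m \<and> \<psi> w + h (\<psi> w) = w"
    "\<And>z. cmod z \<le> m \<Longrightarrow> cmod (z + h z) \<le> m / 2 \<Longrightarrow> \<psi> (z + h z) = z"
    "\<And>x y. cmod x \<le> m / 2 \<Longrightarrow> cmod y \<le> m / 2 \<Longrightarrow> cmod (\<psi> x - \<psi> y) \<le> 2 * cmod (x - y)"
proof -
  have inj: "cmod (x - y) \<le> 2 * cmod ((x + h x) - (y + h y))" if "cmod x \<le> m" "cmod y \<le> m" for x y
  proof -
    have "x - y = ((x + h x) - (y + h y)) - (h x - h y)" by simp
    then have "cmod (x - y) \<le> cmod ((x + h x) - (y + h y)) + cmod (h x - h y)" by (metis norm_triangle_ineq4)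
    then show ?thesis using h[OF that] by simp
  qed
  have ex: "\<exists>z. cmod z \<le> m \<and> z + h z = w" if w: "cmod w \<le> m / 2" for w
  proof -
    have "\<exists>!z\<in>cball 0 m. w - h z = z"
    proof (rule Banach_fix[where c = "1/2"])
      show "complete (cball (0::complex) m)" by (simp add: complete_eq_closed)
      show "(\<lambda>z. w - h z) ` cball 0 m \<subseteq> cball 0 m"
      proof clarify
        fix z :: complex assume z: "z \<in> cball 0 m"
        then have "cmod (h z) \<le> m / 2" using h[of z 0] h0 m by simp
        then show "w - h z \<in> cball 0 m" using norm_triangle_ineq4[of w "h z"] w by simp
      qed
      show "dist (w - h x) (w - h y) \<le> 1/2 * dist x y" if "x \<in> cball 0 m" "y \<in> cball 0 m" for x y
        using h[of x y] that by (simp add: dist_norm norm_minus_commute)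
    qed (use m in auto)
    then obtain z where z: "z \<in> cball 0 m" "w - h z = z" by blast
    then have "z + h z = w" by (metis diff_add_cancel)
    then show ?thesis using z(1) by auto
  qed
  define \<psi> where "\<psi> = (\<lambda>w. SOME z. cmod z \<le> m \<and> z + h z = w)"
  have \<psi>: "cmod (\<psi> w) \<le> m \<and> \<psi> w + h (\<psi> w) = w" if "cmod w \<le> m / 2" for w
    unfolding \<psi>_def using someI_ex[OF ex[OF that]] .
  show thesis
  proof (rule that[of \<psi>])
    show "cmod (\<psi> w) \<le> m \<and> \<psi> w + h (\<psi> w) = w" if "cmod w \<le> m / 2" for w by (rule \<psi>[OF that])
    show "\<psi> (z + h z) = z" if "cmod z \<le> m" "cmod (z + h z) \<le> m / 2" for z
      using inj[OF _ that(1), of "\<psi> (z + h z)"] \<psi>[OF that(2)] by simp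
    show "cmod (\<psi> x - \<psi> y) \<le> 2 * cmod (x - y)" if "cmod x \<le> m / 2" "cmod y \<le> m / 2" for x y
      using inj[of "\<psi> x" "\<psi> y"] \<psi>[OF that(1)] \<psi>[OF that(2)] by simp
  qed
qed

text \<open>Primed letters stand for complex conjugates. Once the terms of degree 2 and 3 cancel (the last two
  assumptions), everything left on the right-hand side visibly has degree at least 4.\<close>

lemma normal_form_identity:
  fixes z z' :: "'a :: comm_ring_1"
  assumes f: "f = \<mu> * z + Q" and f': "f' = \<mu>' * z' + Q'"
    and h2: "h2 = p * z^2 + q * z * z' + s * z'^2"
    and h3: "h3 = t * z^3 + k * z * z'^2 + v * z'^3"
    and \<phi>: "\<phi> = z + (h2 + h3)" and \<phi>': "\<phi>' = z' + h'"
    and H2: "Q + (p * \<mu>^2 * z^2 + q * \<mu> * \<mu>' * z * z' + s * \<mu>'^2 * z'^2) = \<mu> * h2"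
    and H3: "2 * p * \<mu> * z * Q + q * (\<mu> * z * Q' + \<mu>' * z' * Q) + 2 * s * \<mu>' * z' * Q'
       + (t * \<mu>^3 * z^3 + k * \<mu> * \<mu>'^2 * z * z'^2 + v * \<mu>'^3 * z'^3) = \<mu> * h3 + c * z^2 * z'"
  shows "f + (p * f^2 + q * f * f' + s * f'^2 + (t * f^3 + k * f * f'^2 + v * f'^3)) - \<mu> * \<phi> - c * \<phi>^2 * \<phi>' =
     (p * Q * Q + q * Q * Q' + s * Q' * Q')
     + (t * (Q * (f * f + f * (\<mu> * z) + (\<mu> * z) * (\<mu> * z)))
        + k * (Q * (f' * f') + (\<mu> * z) * (Q' * (f' + \<mu>' * z')))
        + v * (Q' * (f' * f' + f' * (\<mu>' * z') + (\<mu>' * z') * (\<mu>' * z'))))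
     + - c * ((h2 + h3) * (\<phi>' * (\<phi> + z)) + z * z * h')" (is "?L = ?R")
proof -
  have "f + (p * f^2 + q * f * f' + s * f'^2 + (t * f^3 + k * f * f'^2 + v * f'^3)) =
     \<mu> * z + (Q + (p * \<mu>^2 * z^2 + q * \<mu> * \<mu>' * z * z' + s * \<mu>'^2 * z'^2))
     + (2 * p * \<mu> * z * Q + q * (\<mu> * z * Q' + \<mu>' * z' * Q) + 2 * s * \<mu>' * z' * Q'
       + (t * \<mu>^3 * z^3 + k * \<mu> * \<mu>'^2 * z * z'^2 + v * \<mu>'^3 * z'^3))
     + ((p * Q * Q + q * Q * Q' + s * Q' * Q')
     + (t * (Q * (f * f + f * (\<mu> * z) + (\<mu> * z) * (\<mu> * z)))
        + k * (Q * (f' * f') + (\<mu> * z) * (Q' * (f' + \<mu>' * z')))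
        + v * (Q' * (f' * f' + f' * (\<mu>' * z') + (\<mu>' * z') * (\<mu>' * z')))))"
    unfolding f f' by (simp add: algebra_simps power2_eq_square power3_eq_cube)
  also have "\<dots> = \<mu> * \<phi> + c * z^2 * z'
     + ((p * Q * Q + q * Q * Q' + s * Q' * Q')
     + (t * (Q * (f * f + f * (\<mu> * z) + (\<mu> * z) * (\<mu> * z)))
        + k * (Q * (f' * f') + (\<mu> * z) * (Q' * (f' + \<mu>' * z')))
        + v * (Q' * (f' * f' + f' * (\<mu>' * z') + (\<mu>' * z') * (\<mu>' * z')))))"
    unfolding H2 H3 \<phi> by (simp add: algebra_simps)
  finally have 1: "f + (p * f^2 + q * f * f' + s * f'^2 + (t * f^3 + k * f * f'^2 + v * f'^3)) = \<dots>" .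
  have 2: "c * \<phi>^2 * \<phi>' = c * z^2 * z' + c * ((h2 + h3) * (\<phi>' * (\<phi> + z)) + z * z * h')"
    unfolding \<phi> \<phi>' by (simp add: algebra_simps power2_eq_square)
  show ?thesis unfolding 1 2 by simp
qed

text \<open>The coordinate change is given through its inverse \<open>\<psi>\<close>, so that the new map is defined on a fixed disc.
  Its polynomial coefficients solve the homological equations, whose divisors are the differences in \<open>nr\<close>.\<close>

lemma normal_form:
  fixes \<mu> a b c :: "real \<Rightarrow> complex" and g0 :: real
  assumes cont: "isCont \<mu> g0" "isCont a g0" "isCont b g0" "isCont c g0"
    and nr: "\<mu> g0 \<noteq> (\<mu> g0)^2" "\<mu> g0 \<noteq> \<mu> g0 * cnj (\<mu> g0)" "\<mu> g0 \<noteq> (cnj (\<mu> g0))^2"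
      "\<mu> g0 \<noteq> (\<mu> g0)^3" "\<mu> g0 \<noteq> \<mu> g0 * (cnj (\<mu> g0))^2" "\<mu> g0 \<noteq> (cnj (\<mu> g0))^3"
  obtains K m M c1 where "0 < K" "0 < m" "m \<le> M" "isCont c1 g0"
    "c1 g0 = 2 * (a g0 / (\<mu> g0 - (\<mu> g0)^2)) * \<mu> g0 * b g0
       + b g0 / (\<mu> g0 - \<mu> g0 * cnj (\<mu> g0)) * (\<mu> g0 * cnj (b g0) + cnj (\<mu> g0) * a g0)
       + 2 * (c g0 / (\<mu> g0 - (cnj (\<mu> g0))^2)) * cnj (\<mu> g0) * cnj (c g0)"
    "\<forall>\<^sub>F g in nhds g0. \<exists>\<psi> E. \<psi> 0 = 0 \<and> E 0 = 0 \<and> inj_on \<psi> (cball 0 M) \<and>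
       (\<forall>x\<in>cball 0 M. \<forall>y\<in>cball 0 M. cmod (\<psi> x - \<psi> y) \<le> 2 * cmod (x - y)) \<and>
       (\<forall>k x y. k \<le> m \<longrightarrow> cmod x \<le> k \<longrightarrow> cmod y \<le> k \<longrightarrow> cmod (E x - E y) \<le> K * k^3 * cmod (x - y)) \<and>
       (\<forall>w\<in>cball 0 m. let w' = \<mu> g * w + c1 g * w^2 * cnj w + E w in
          w' \<in> cball 0 M \<and> \<psi> w' = \<mu> g * \<psi> w + (a g * (\<psi> w)^2 + b g * \<psi> w * cnj (\<psi> w) + c g * (cnj (\<psi> w))^2))"
proof -
  \<comment> \<open>The coefficients p, q, s remove the quadratic terms. Substituting Q into h2
    creates cubic terms, which are collected by monomial: z^3 in t, z^2 z' in c1, z z'^2 in k, z'^3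
    in v.\<close>
  define p where "p = (\<lambda>g. a g / (\<mu> g - (\<mu> g)^2))"
  define q where "q = (\<lambda>g. b g / (\<mu> g - \<mu> g * cnj (\<mu> g)))"
  define s where "s = (\<lambda>g. c g / (\<mu> g - (cnj (\<mu> g))^2))"
  define t where "t = (\<lambda>g. (2 * p g * \<mu> g * a g + q g * \<mu> g * cnj (c g)) / (\<mu> g - (\<mu> g)^3))"
  \<comment> \<open>For z^2 z' the divisor would be \<mu> - \<mu>^2 cnj \<mu> = \<mu> (1 -
    \<bar>\<mu>\<bar>^2), which vanishes for a multiplier on the unit circle. This monomial is
    therefore kept, and h3 has no such term.\<close>
  define c1 where "c1 = (\<lambda>g. 2 * p g * \<mu> g * b g + q g * (\<mu> g * cnj (b g) + cnj (\<mu> g) * a g) + 2 * s g * cnj (\<mu> g) * cnj (c g))"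
  define k where "k = (\<lambda>g. (2 * p g * \<mu> g * c g + q g * (\<mu> g * cnj (a g) + cnj (\<mu> g) * b g) + 2 * s g * cnj (\<mu> g) * cnj (b g)) / (\<mu> g - \<mu> g * (cnj (\<mu> g))^2))"
  define v where "v = (\<lambda>g. (q g * cnj (\<mu> g) * c g + 2 * s g * cnj (\<mu> g) * cnj (a g)) / (\<mu> g - (cnj (\<mu> g))^3))"
  have cp: "isCont p g0" unfolding p_def using cont nr by (intro continuous_intros) auto
  have cq: "isCont q g0" unfolding q_def using cont nr by (intro continuous_intros) auto
  have cs: "isCont s g0" unfolding s_def using cont nr by (intro continuous_intros) auto
  have ct: "isCont t g0" unfolding t_def using cont nr cp cq cs by (intro continuous_intros) auto
  have ck: "isCont k g0" unfolding k_def using cont nr cp cq cs by (intro continuous_intros) auto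
  have cv: "isCont v g0" unfolding v_def using cont nr cp cq cs by (intro continuous_intros) auto
  have cc1: "isCont c1 g0" unfolding c1_def using cont nr cp cq cs by (intro continuous_intros) auto
  define Q where "Q = (\<lambda>g z. a g * z^2 + b g * z * cnj z + c g * (cnj z)^2)"
  define f where "f = (\<lambda>g z. \<mu> g * z + Q g z)"
  define h2 where "h2 = (\<lambda>g z. p g * z^2 + q g * z * cnj z + s g * (cnj z)^2)"
  define h3 where "h3 = (\<lambda>g z. t g * z^3 + k g * z * (cnj z)^2 + v g * (cnj z)^3)"
  define h where "h = (\<lambda>g z. h2 g z + h3 g z)"
  define \<phi> where "\<phi> = (\<lambda>g z. z + h g z)"
  \<comment> \<open>The defect of the normal form, written in the old coordinate z; eventually E w =
    R (\<psi> w). Its order is not visible in this shape, so it is compared with S, each summand of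
    which is a product of factors of known order.\<close>
  define R where "R = (\<lambda>g z. \<phi> g (f g z) - \<mu> g * \<phi> g z - c1 g * (\<phi> g z)^2 * cnj (\<phi> g z))"
  define S where "S = (\<lambda>g z. (p g * Q g z * Q g z + q g * Q g z * cnj (Q g z) + s g * cnj (Q g z) * cnj (Q g z))
     + (t g * (Q g z * (f g z * f g z + f g z * (\<mu> g * z) + (\<mu> g * z) * (\<mu> g * z)))
        + k g * (Q g z * (cnj (f g z) * cnj (f g z)) + (\<mu> g * z) * (cnj (Q g z) * (cnj (f g z) + cnj (\<mu> g) * cnj z)))
        + v g * (cnj (Q g z) * (cnj (f g z) * cnj (f g z) + cnj (f g z) * (cnj (\<mu> g) * cnj z) + (cnj (\<mu> g) * cnj z) * (cnj (\<mu> g) * cnj z))))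
     + - c1 g * ((h2 g z + h3 g z) * (cnj (\<phi> g z) * (\<phi> g z + z)) + z * z * cnj (h g z)))"
  note const = big_lip_const
  have cnj_const: "isCont (\<lambda>g. cnj (\<mu> g)) g0" using cont by (intro continuous_intros)
  note I = big_lip_id[where F = "nhds g0"]
  note C = big_lip_cnj
  have zz: "big_lip (nhds g0) 2 (\<lambda>p z. z * z)" "big_lip (nhds g0) 2 (\<lambda>p z. z * cnj z)" "big_lip (nhds g0) 2 (\<lambda>p z. cnj z * cnj z)"
    by (rule big_lip_mult[OF I I], simp, rule big_lip_mult[OF I C[OF I]], simp, rule big_lip_mult[OF C[OF I] C[OF I]], simp)
  have bQ: "big_lip (nhds g0) 2 Q"
    unfolding Q_def power2_eq_square mult.assoc
    by (intro big_lip_add big_lip_mult[OF const zz(1)] big_lip_mult[OF const zz(2)] big_lip_mult[OF const zz(3)] cont) simp_all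
  have bh2: "big_lip (nhds g0) 2 h2"
    unfolding h2_def power2_eq_square mult.assoc
    by (intro big_lip_add big_lip_mult[OF const zz(1)] big_lip_mult[OF const zz(2)] big_lip_mult[OF const zz(3)] cp cq cs) simp_all
  have zzz: "big_lip (nhds g0) 3 (\<lambda>p z. z * (z * z))" "big_lip (nhds g0) 3 (\<lambda>p z. z * (cnj z * cnj z))" "big_lip (nhds g0) 3 (\<lambda>p z. cnj z * (cnj z * cnj z))"
    by (rule big_lip_mult[OF I zz(1)], simp, rule big_lip_mult[OF I zz(3)], simp, rule big_lip_mult[OF C[OF I] zz(3)], simp)
  have bh3: "big_lip (nhds g0) 3 h3"
    unfolding h3_def power2_eq_square power3_eq_cube mult.assoc
    by (intro big_lip_add big_lip_mult[OF const zzz(1)] big_lip_mult[OF const zzz(2)] big_lip_mult[OF const zzz(3)] ct ck cv) simp_all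
  have bh: "big_lip (nhds g0) 2 h"
    unfolding h_def by (intro big_lip_add bh2 big_lip_mono[OF bh3]) simp
  have b\<mu>: "big_lip (nhds g0) 1 (\<lambda>g z. \<mu> g * z)"
    by (rule big_lip_mult[OF const[OF cont(1)] I]) simp
  have b\<mu>': "big_lip (nhds g0) 1 (\<lambda>g z. cnj (\<mu> g) * cnj z)"
    by (rule big_lip_mult[OF const[OF cnj_const] C[OF I]]) simp
  have bf: "big_lip (nhds g0) 1 f"
    unfolding f_def by (intro big_lip_add b\<mu> big_lip_mono[OF bQ]) simp
  have b\<phi>: "big_lip (nhds g0) 1 \<phi>"
    unfolding \<phi>_def by (intro big_lip_add I big_lip_mono[OF bh]) simp
  have two: "big_lip (nhds g0) 2 (\<lambda>g z. A g z * B g z)" if "big_lip (nhds g0) 1 A" "big_lip (nhds g0) 1 B" for A B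
    by (rule big_lip_mult[OF that]) simp
  have four: "big_lip (nhds g0) 4 (\<lambda>g z. A g z * B g z)" if "big_lip (nhds g0) 2 A" "big_lip (nhds g0) 2 B" for A B
    by (rule big_lip_mult[OF that]) simp
  have four0: "big_lip (nhds g0) 4 (\<lambda>g z. A g * B g z)" if "isCont A g0" "big_lip (nhds g0) 4 B" for A B
    by (rule big_lip_mult[OF const[OF that(1)] that(2)]) simp
  have four1: "big_lip (nhds g0) 4 (\<lambda>g z. A g z * B g z)" if "big_lip (nhds g0) 1 A" "big_lip (nhds g0) 3 B" for A B
    by (rule big_lip_mult[OF that]) simp
  have three: "big_lip (nhds g0) 3 (\<lambda>g z. A g z * B g z)" if "big_lip (nhds g0) 2 A" "big_lip (nhds g0) 1 B" for A B
    by (rule big_lip_mult[OF that]) simp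
  have bS: "big_lip (nhds g0) 4 S"
  proof -
    have 1: "big_lip (nhds g0) 4 (\<lambda>g z. p g * Q g z * Q g z + q g * Q g z * cnj (Q g z) + s g * cnj (Q g z) * cnj (Q g z))"
      unfolding mult.assoc by (intro big_lip_add four0[OF cp] four0[OF cq] four0[OF cs] four C bQ)
    have 2: "big_lip (nhds g0) 4 (\<lambda>g z. t g * (Q g z * (f g z * f g z + f g z * (\<mu> g * z) + (\<mu> g * z) * (\<mu> g * z))))"
      by (intro four0[OF ct] four[OF bQ] big_lip_add two bf b\<mu>)
    have 3: "big_lip (nhds g0) 4 (\<lambda>g z. k g * (Q g z * (cnj (f g z) * cnj (f g z)) + (\<mu> g * z) * (cnj (Q g z) * (cnj (f g z) + cnj (\<mu> g) * cnj z))))"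
      by (intro four0[OF ck] big_lip_add[OF four[OF bQ two] four1[OF b\<mu> three]] big_lip_add C bf bQ b\<mu>')
    have 4: "big_lip (nhds g0) 4 (\<lambda>g z. v g * (cnj (Q g z) * (cnj (f g z) * cnj (f g z) + cnj (f g z) * (cnj (\<mu> g) * cnj z) + (cnj (\<mu> g) * cnj z) * (cnj (\<mu> g) * cnj z))))"
      by (intro four0[OF cv] four[OF C[OF bQ]] big_lip_add two C[OF bf] b\<mu>')
    have 5: "big_lip (nhds g0) 4 (\<lambda>g z. - c1 g * ((h2 g z + h3 g z) * (cnj (\<phi> g z) * (\<phi> g z + z)) + z * z * cnj (h g z)))"
      by (intro four0 big_lip_add[OF four[OF big_lip_add[OF bh2 big_lip_mono[OF bh3]] two] four[OF zz(1) C[OF bh]]] big_lip_add C b\<phi> I)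
         (use cc1 in \<open>auto intro: continuous_intros\<close>)
    show ?thesis unfolding S_def by (intro big_lip_add 1 2 3 4 5)
  qed
  have ne: "\<forall>\<^sub>F g in nhds g0. A g \<noteq> B g" if "isCont A g0" "isCont B g0" "A g0 \<noteq> B g0" for A B :: "real \<Rightarrow> complex"
  proof -
    have "((\<lambda>g. A g - B g) \<longlongrightarrow> A g0 - B g0) (nhds g0)"
      using that by (intro tendsto_diff) (simp_all add: continuous_at tendsto_at_iff_tendsto_nhds)
    then have "\<forall>\<^sub>F g in nhds g0. A g - B g \<noteq> 0" by (rule tendsto_imp_eventually_ne) (use that in simp)
    then show ?thesis by eventually_elim auto
  qed
  have RS: "\<forall>\<^sub>F g in nhds g0. R g = S g"
  proof -
    have "\<forall>\<^sub>F g in nhds g0. \<mu> g \<noteq> (\<mu> g)^2" "\<forall>\<^sub>F g in nhds g0. \<mu> g \<noteq> \<mu> g * cnj (\<mu> g)"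
      "\<forall>\<^sub>F g in nhds g0. \<mu> g \<noteq> (cnj (\<mu> g))^2" "\<forall>\<^sub>F g in nhds g0. \<mu> g \<noteq> (\<mu> g)^3"
      "\<forall>\<^sub>F g in nhds g0. \<mu> g \<noteq> \<mu> g * (cnj (\<mu> g))^2" "\<forall>\<^sub>F g in nhds g0. \<mu> g \<noteq> (cnj (\<mu> g))^3"
      by (rule ne; use cont nr in \<open>auto intro!: continuous_intros\<close>)+
    then show ?thesis
    proof eventually_elim
      case (elim g)
      have pqs: "a g = p g * (\<mu> g - (\<mu> g)^2)" "b g = q g * (\<mu> g - \<mu> g * cnj (\<mu> g))" "c g = s g * (\<mu> g - (cnj (\<mu> g))^2)"
        using elim by (simp_all add: p_def q_def s_def)
      have tkv: "2 * p g * \<mu> g * a g + q g * \<mu> g * cnj (c g) = t g * (\<mu> g - (\<mu> g)^3)"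
        "2 * p g * \<mu> g * c g + q g * (\<mu> g * cnj (a g) + cnj (\<mu> g) * b g) + 2 * s g * cnj (\<mu> g) * cnj (b g) = k g * (\<mu> g - \<mu> g * (cnj (\<mu> g))^2)"
        "q g * cnj (\<mu> g) * c g + 2 * s g * cnj (\<mu> g) * cnj (a g) = v g * (\<mu> g - (cnj (\<mu> g))^3)"
        using elim by (simp_all add: t_def k_def v_def)
      show "R g = S g"
      proof
        fix z
        let ?z = "cnj z" and ?\<mu> = "cnj (\<mu> g)"
        have fz: "\<phi> g (f g z) = f g z + (p g * (f g z)^2 + q g * f g z * cnj (f g z) + s g * (cnj (f g z))^2
            + (t g * (f g z)^3 + k g * f g z * (cnj (f g z))^2 + v g * (cnj (f g z))^3))"
          by (simp add: \<phi>_def h_def h2_def h3_def)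
        show "R g z = S g z"
          unfolding R_def S_def fz
        proof (rule normal_form_identity)
          show "f g z = \<mu> g * z + Q g z" by (simp add: f_def)
          show "cnj (f g z) = ?\<mu> * ?z + cnj (Q g z)" by (simp add: f_def)
          show "h2 g z = p g * z^2 + q g * z * ?z + s g * ?z^2" by (simp add: h2_def)
          show "h3 g z = t g * z^3 + k g * z * ?z^2 + v g * ?z^3" by (simp add: h3_def)
          show "\<phi> g z = z + (h2 g z + h3 g z)" by (simp add: \<phi>_def h_def)
          show "cnj (\<phi> g z) = ?z + cnj (h g z)" by (simp add: \<phi>_def)
          show "Q g z + (p g * (\<mu> g)^2 * z^2 + q g * \<mu> g * ?\<mu> * z * ?z + s g * ?\<mu>^2 * ?z^2) = \<mu> g * h2 g z"
            unfolding Q_def h2_def pqs by (simp add: algebra_simps)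
          have "2 * p g * \<mu> g * z * Q g z + q g * (\<mu> g * z * cnj (Q g z) + ?\<mu> * ?z * Q g z) + 2 * s g * ?\<mu> * ?z * cnj (Q g z)
            = (2 * p g * \<mu> g * a g + q g * \<mu> g * cnj (c g)) * z^3 + c1 g * z^2 * ?z
             + (2 * p g * \<mu> g * c g + q g * (\<mu> g * cnj (a g) + cnj (\<mu> g) * b g) + 2 * s g * cnj (\<mu> g) * cnj (b g)) * z * ?z^2
             + (q g * cnj (\<mu> g) * c g + 2 * s g * cnj (\<mu> g) * cnj (a g)) * ?z^3"
            unfolding Q_def c1_def by (simp add: algebra_simps power2_eq_square power3_eq_cube)
          also have "\<dots> = t g * (\<mu> g - (\<mu> g)^3) * z^3 + c1 g * z^2 * ?z + k g * (\<mu> g - \<mu> g * (cnj (\<mu> g))^2) * z * ?z^2 + v g * (\<mu> g - (cnj (\<mu> g))^3) * ?z^3"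
            unfolding tkv ..
          finally show "2 * p g * \<mu> g * z * Q g z + q g * (\<mu> g * z * cnj (Q g z) + ?\<mu> * ?z * Q g z) + 2 * s g * ?\<mu> * ?z * cnj (Q g z)
             + (t g * (\<mu> g)^3 * z^3 + k g * \<mu> g * ?\<mu>^2 * z * ?z^2 + v g * ?\<mu>^3 * ?z^3) = \<mu> g * h3 g z + c1 g * z^2 * ?z"
            unfolding h3_def by (simp add: algebra_simps)
        qed
      qed
    qed
  qed
  have bR: "big_lip (nhds g0) 4 R" by (rule big_lip_cong[OF bS RS])
  obtain Kh where Kh: "0 < Kh" "\<forall>\<^sub>F g in nhds g0. lip_bound Kh 2 (h g)" using bh unfolding big_lip_def by blast
  obtain Kf where Kf: "0 < Kf" "\<forall>\<^sub>F g in nhds g0. lip_bound Kf 1 (f g)" using bf unfolding big_lip_def by blast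
  obtain KR where KR: "0 < KR" "\<forall>\<^sub>F g in nhds g0. lip_bound KR 4 (R g)" using bR unfolding big_lip_def by blast
  \<comment> \<open>On the disc of radius m0 the map h has Lipschitz constant Kh m0 \<le> 1/2. The
    bound on m gives \<bar>f (\<psi> w)\<bar> \<le> 2 Kf m \<le> m0 / 3, so the image under \<phi>,
    at most 3/2 times as large, stays within M = m0 / 2, where \<psi> inverts \<phi>.\<close>
  define m0 where "m0 = min (1/2) (1 / (2 * Kh))"
  define m where "m = min (m0 / 4) (m0 / (6 * Kf))"
  have m0: "0 < m0" "m0 \<le> 1/2" "Kh * m0 \<le> 1/2"
  proof -
    have "m0 \<le> 1 / (2 * Kh)" by (simp add: m0_def)
    then show "Kh * m0 \<le> 1/2" using Kh(1) by (simp add: field_simps)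
  qed (use Kh(1) in \<open>auto simp: m0_def\<close>)
  have m: "0 < m" "m \<le> m0 / 4" "6 * Kf * m \<le> m0"
  proof -
    have "m \<le> m0 / (6 * Kf)" by (simp add: m_def)
    then show "6 * Kf * m \<le> m0" using Kf(1) by (simp add: field_simps)
  qed (use Kf(1) m0 in \<open>auto simp: m_def\<close>)
  show thesis
  proof (rule that[where K = "16 * KR" and m = m and M = "m0 / 2" and ?c1.0 = c1])
    show "0 < 16 * KR" "0 < m" "m \<le> m0 / 2" using KR m m0 by auto
    show "isCont c1 g0" by (rule cc1)
    show "c1 g0 = 2 * (a g0 / (\<mu> g0 - (\<mu> g0)^2)) * \<mu> g0 * b g0
       + b g0 / (\<mu> g0 - \<mu> g0 * cnj (\<mu> g0)) * (\<mu> g0 * cnj (b g0) + cnj (\<mu> g0) * a g0)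
       + 2 * (c g0 / (\<mu> g0 - (cnj (\<mu> g0))^2)) * cnj (\<mu> g0) * cnj (c g0)"
      unfolding c1_def p_def q_def s_def ..
    show "\<forall>\<^sub>F g in nhds g0. \<exists>\<psi> E. \<psi> 0 = 0 \<and> E 0 = 0 \<and> inj_on \<psi> (cball 0 (m0 / 2)) \<and>
       (\<forall>x\<in>cball 0 (m0 / 2). \<forall>y\<in>cball 0 (m0 / 2). cmod (\<psi> x - \<psi> y) \<le> 2 * cmod (x - y)) \<and>
       (\<forall>k x y. k \<le> m \<longrightarrow> cmod x \<le> k \<longrightarrow> cmod y \<le> k \<longrightarrow> cmod (E x - E y) \<le> 16 * KR * k^3 * cmod (x - y)) \<and>
       (\<forall>w\<in>cball 0 m. let w' = \<mu> g * w + c1 g * w^2 * cnj w + E w in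
          w' \<in> cball 0 (m0 / 2) \<and> \<psi> w' = \<mu> g * \<psi> w + (a g * (\<psi> w)^2 + b g * \<psi> w * cnj (\<psi> w) + c g * (cnj (\<psi> w))^2))"
      using Kh(2) Kf(2) KR(2)
    proof eventually_elim
      case (elim g)
      have h0: "h g 0 = 0" by (simp add: h_def h2_def h3_def)
      have half: "cmod (h g x - h g y) \<le> cmod (x - y) / 2" if "cmod x \<le> m0" "cmod y \<le> m0" for x y
      proof -
        have "m0 * cmod (h g x - h g y) \<le> Kh * m0^2 * cmod (x - y)"
          using lip_boundD(2)[OF elim(1) m0(1) _ that] m0(2) by simp
        then have "m0 * cmod (h g x - h g y) \<le> m0 * (Kh * m0 * cmod (x - y))" by (simp add: power2_eq_square mult_ac)
        then have "cmod (h g x - h g y) \<le> Kh * m0 * cmod (x - y)" using m0(1) by simp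
        also have "\<dots> \<le> 1/2 * cmod (x - y)" by (intro mult_right_mono m0) auto
        finally show ?thesis by simp
      qed
      obtain \<psi> where \<psi>: "\<And>w. cmod w \<le> m0 / 2 \<Longrightarrow> cmod (\<psi> w) \<le> m0 \<and> \<psi> w + h g (\<psi> w) = w"
        "\<And>z. cmod z \<le> m0 \<Longrightarrow> cmod (z + h g z) \<le> m0 / 2 \<Longrightarrow> \<psi> (z + h g z) = z"
        "\<And>x y. cmod x \<le> m0 / 2 \<Longrightarrow> cmod y \<le> m0 / 2 \<Longrightarrow> cmod (\<psi> x - \<psi> y) \<le> 2 * cmod (x - y)"
        using near_identity_inverse[OF m0(1) h0 half] by metis
      have \<psi>0: "\<psi> 0 = 0" using \<psi>(2)[of 0] h0 m0 by simp
      have \<psi>le: "cmod (\<psi> w) \<le> 2 * cmod w" if "cmod w \<le> m0 / 2" for w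
        using \<psi>(3)[OF that, of 0] \<psi>0 m0 by simp
      have \<phi>\<psi>: "\<phi> g (\<psi> w) = w" if "cmod w \<le> m0 / 2" for w using \<psi>(1)[OF that] by (simp add: \<phi>_def)
      define E where "E = (\<lambda>w. R g (\<psi> w))"
      have E0: "E 0 = 0" by (simp add: E_def \<psi>0 R_def \<phi>_def h0 f_def Q_def)
      have inj: "inj_on \<psi> (cball 0 (m0 / 2))"
        by (rule inj_on_inverseI[where g = "\<phi> g"]) (simp add: \<phi>\<psi>)
      \<comment> \<open>Since \<psi> at most doubles moduli and distances, the bound on R is used on
        the disc of radius 2k: KR (2k)^4 * 2 / (2k) = 16 KR k^3. It presupposes a positive radius,
        hence the separate case k = 0.\<close>
      have lipE: "cmod (E x - E y) \<le> 16 * KR * k^3 * cmod (x - y)" if k: "k \<le> m" "cmod x \<le> k" "cmod y \<le> k" for k x y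
      proof (cases "k = 0")
        case True
        then show ?thesis using k by simp
      next
        case False
        then have k0: "0 < k" using k(2) norm_ge_zero[of x] by linarith
        have xy: "cmod x \<le> m0 / 2" "cmod y \<le> m0 / 2" using k m m0 by linarith+
        have "cmod (\<psi> x) \<le> 2 * k" "cmod (\<psi> y) \<le> 2 * k" using \<psi>le[OF xy(1)] \<psi>le[OF xy(2)] k by linarith+
        then have "2 * k * cmod (E x - E y) \<le> KR * (2 * k)^4 * cmod (\<psi> x - \<psi> y)"
          unfolding E_def by (intro lip_boundD(2)[OF elim(3)]) (use k0 k m m0 in auto)
        also have "\<dots> \<le> KR * (2 * k)^4 * (2 * cmod (x - y))"
          using KR k0 by (intro mult_left_mono \<psi>(3) xy) auto
        also have "\<dots> = 2 * k * (16 * KR * k^3 * cmod (x - y))" by (simp add: eval_nat_numeral)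
        finally show ?thesis using k0 by (simp add: mult_ac)
      qed
      have conj: "w' \<in> cball 0 (m0 / 2) \<and> \<psi> w' = f g (\<psi> w)"
        if w: "cmod w \<le> m" and w': "w' = \<mu> g * w + c1 g * w^2 * cnj w + E w" for w w'
      proof -
        have w2: "cmod w \<le> m0 / 2" using w m m0 by linarith
        have eq: "w' = \<phi> g (f g (\<psi> w))" unfolding w' E_def R_def \<phi>\<psi>[OF w2] by simp
        have "cmod (f g (\<psi> w)) \<le> Kf * (2 * m)^1"
          by (rule lip_boundD(1)[OF elim(2)]) (use \<psi>le[OF w2] w m m0 in auto)
        then have fle: "3 * cmod (f g (\<psi> w)) \<le> m0" using m(3) by simp
        have "cmod (\<phi> g (f g (\<psi> w))) \<le> cmod (f g (\<psi> w)) + cmod (h g (f g (\<psi> w)))"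
          unfolding \<phi>_def by (rule norm_triangle_ineq)
        also have "cmod (h g (f g (\<psi> w))) \<le> cmod (f g (\<psi> w)) / 2"
          using half[of "f g (\<psi> w)" 0] fle m0 h0 by simp
        finally have "cmod w' \<le> m0 / 2" using fle by (simp add: eq)
        moreover have "\<psi> w' = f g (\<psi> w)"
          using \<psi>(2)[of "f g (\<psi> w)"] calculation fle m0 unfolding eq \<phi>_def by simp
        ultimately show ?thesis by simp
      qed
      show ?case
        using \<psi>0 E0 inj \<psi>(3) lipE conj unfolding Let_def f_def Q_def
        by (intro exI[of _ \<psi>] exI[of _ E]) auto
    qed
  qed
qed

section \<open>Topological non-equivalence\<close>

text \<open>Arbitrarily small invariant neighbourhoods survive conjugation, but a repelling point has none.\<close>

lemma not_locally_topologically_equivalent: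
  fixes f :: "'a::{perfect_space,t2_space} \<Rightarrow> 'a" and g :: "'b::topological_space \<Rightarrow> 'b"
  assumes f: "isCont f p" "f p = p"
    and N: "open N" "p \<in> N" "\<And>x. x \<in> N \<Longrightarrow> x \<noteq> p \<Longrightarrow> \<exists>n. (f ^^ n) x \<notin> N"
    and stable: "\<And>W. open W \<Longrightarrow> q \<in> W \<Longrightarrow> \<exists>G. open G \<and> q \<in> G \<and> G \<subseteq> W \<and> g ` G \<subseteq> G"
  shows "\<not> locally_topologically_equivalent f p g q"
proof
  assume "locally_topologically_equivalent f p g q"
  then obtain U W h k where U: "open U" "open W" "p \<in> U" "q \<in> W" "homeomorphism U W h k" "h p = q"
    and conj: "\<And>x. x \<in> U \<Longrightarrow> f x \<in> U \<Longrightarrow> h (f x) = g (h x)"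
    unfolding locally_topologically_equivalent_def by blast
  note hk = homeomorphism_image1[OF U(5)] homeomorphism_image2[OF U(5)] homeomorphism_apply1[OF U(5)] homeomorphism_apply2[OF U(5)]
  \<comment> \<open>The conjugacy equation is available only at points that \<open>f\<close> keeps
    in U; A guarantees this.\<close>
  obtain A where A: "open A" "p \<in> A" "\<And>x. x \<in> A \<Longrightarrow> f x \<in> U"
    using continuous_at_open[THEN iffD1, OF f(1), rule_format, of U] U f(2) by auto
  define U1 where "U1 = U \<inter> N \<inter> A"
  have U1: "open U1" "p \<in> U1" "U1 \<subseteq> U" using U N A by (auto simp: U1_def)
  have k_cont: "continuous_on W k" and h_cont: "continuous_on U h" using U(5) by (auto simp: homeomorphism_def)
  have "h ` U1 = W \<inter> k -` U1"
  proof (intro equalityI subsetI)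
    fix y assume "y \<in> h ` U1"
    then obtain x where x: "x \<in> U1" "y = h x" by blast
    then have "x \<in> U" using U1(3) by blast
    then show "y \<in> W \<inter> k -` U1" using hk(1,3) x by auto
  next
    fix y assume "y \<in> W \<inter> k -` U1"
    then have "y = h (k y)" "k y \<in> U1" using hk(4) by auto
    then show "y \<in> h ` U1" by blast
  qed
  then have "open (h ` U1)" using continuous_open_preimage[OF k_cont U(2) U1(1)] by simp
  moreover have "q \<in> h ` U1" using U1(2) U(6) by blast
  ultimately obtain G where G: "open G" "q \<in> G" "G \<subseteq> h ` U1" "g ` G \<subseteq> G" using stable by meson
  have GW: "G \<subseteq> W" using G(3) U1(3) hk(1) by blast
  have X_eq: "k ` G = U \<inter> h -` G"
  proof
    show "k ` G \<subseteq> U \<inter> h -` G" using GW hk by auto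
    show "U \<inter> h -` G \<subseteq> k ` G"
    proof
      fix x assume "x \<in> U \<inter> h -` G"
      then have "x = k (h x)" "h x \<in> G" using hk(3) by auto
      then show "x \<in> k ` G" by blast
    qed
  qed
  have X_open: "open (k ` G)" unfolding X_eq using continuous_open_preimage[OF h_cont U(1) G(1)] .
  have X_sub: "k ` G \<subseteq> U1"
  proof clarify
    fix y assume "y \<in> G"
    then obtain x where "x \<in> U1" "y = h x" using G(3) by blast
    moreover from this have "x \<in> U" using U1(3) by blast
    ultimately show "k y \<in> U1" using hk(3) by simp
  qed
  have X_inv: "f x \<in> k ` G" if x: "x \<in> k ` G" for x
  proof -
    have xU: "x \<in> U" "f x \<in> U" using x X_sub A(3) unfolding U1_def by blast+
    have "h (f x) \<in> G" using conj[OF xU] x X_eq G(4) by auto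
    then show ?thesis unfolding X_eq using xU(2) by simp
  qed
  have "p \<in> k ` G" unfolding X_eq using U(3,6) G(2) by simp
  have "k ` G \<noteq> {p}" using X_open not_open_singleton[of p] by metis
  with \<open>p \<in> k ` G\<close> obtain x where x: "x \<in> k ` G" "x \<noteq> p" by blast
  have "(f ^^ n) x \<in> k ` G" for n by (induction n) (simp_all add: x(1) X_inv)
  then have "(f ^^ n) x \<in> N" for n using X_sub unfolding U1_def by blast
  moreover from this[of 0] have "x \<in> N" by simp
  ultimately show False using N(3)[of x] x(2) by blast
qed

text \<open>Every small disc is mapped into itself by F, and its image under T is open by invariance
  of domain.\<close>

lemma stable_of_semiconj:
  fixes T :: "complex \<Rightarrow> real^2"
  assumes \<delta>: "0 < \<delta>" and T: "continuous_on (ball 0 \<delta>) T" "inj_on T (ball 0 \<delta>)"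
    and semiconj: "\<And>w. cmod w < \<delta> \<Longrightarrow> g (T w) = T (F w)"
    and F: "\<And>w. cmod w < \<delta> \<Longrightarrow> cmod (F w) \<le> cmod w"
    and W: "open W" "T 0 \<in> W"
  shows "\<exists>G. open G \<and> T 0 \<in> G \<and> G \<subseteq> W \<and> g ` G \<subseteq> G"
proof -
  have "open (ball 0 \<delta> \<inter> T -` W)" by (rule continuous_open_preimage[OF T(1) _ W(1)]) simp
  moreover have "0 \<in> ball 0 \<delta> \<inter> T -` W" using \<delta> W(2) by simp
  ultimately obtain e where e: "0 < e" "ball 0 e \<subseteq> ball 0 \<delta> \<inter> T -` W" by (meson open_contains_ball)
  have eb: "cmod w < \<delta>" "T w \<in> W" if "cmod w < e" for w using e(2) that by (auto simp: subset_iff)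
  have "open (T ` ball 0 e)"
    by (rule invariance_of_domain_gen) (use T e(2) in \<open>auto intro: continuous_on_subset inj_on_subset\<close>)
  moreover have "g ` T ` ball 0 e \<subseteq> T ` ball 0 e"
  proof clarify
    fix w :: complex assume "w \<in> ball 0 e"
    then have w: "cmod w < e" by simp
    have "cmod (F w) < e" using F[OF eb(1)[OF w]] w by simp
    then show "g (T w) \<in> T ` ball 0 e" unfolding semiconj[OF eb(1)[OF w]] by simp
  qed
  ultimately show ?thesis using e(1) eb(2) by (intro exI[of _ "T ` ball 0 e"]) auto
qed

text \<open>An orbit trapped in the image of the small disc lifts to an orbit of F whose modulus
  grows at least like l^n. To continue the lift, F z must be identified with the trapped preimage;
  as F z might a priori leave the small disc, injectivity is required on the larger one.\<close>

lemma repelling_of_semiconj: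
  fixes T :: "complex \<Rightarrow> real^2"
  assumes \<delta>: "0 < \<delta>" "\<delta> \<le> M" and T: "inj_on T (cball 0 M)"
    and semiconj: "\<And>w. cmod w < \<delta> \<Longrightarrow> f (T w) = T (F w)" "\<And>w. cmod w < \<delta> \<Longrightarrow> cmod (F w) \<le> M"
    and F: "\<And>w. cmod w < \<delta> \<Longrightarrow> l * cmod w \<le> cmod (F w)" and l: "1 < l"
    and x: "x \<in> T ` ball 0 \<delta>" "x \<noteq> T 0"
  shows "\<exists>n. (f ^^ n) x \<notin> T ` ball 0 \<delta>"
proof (rule ccontr)
  assume "\<nexists>n. (f ^^ n) x \<notin> T ` ball 0 \<delta>"
  then have orb: "(f ^^ n) x \<in> T ` ball 0 \<delta>" for n by blast
  obtain w where w: "x = T w" "cmod w < \<delta>" using x(1) by auto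
  then have w0: "w \<noteq> 0" using x(2) by auto
  have "\<exists>z. (f ^^ n) x = T z \<and> cmod z < \<delta> \<and> l ^ n * cmod w \<le> cmod z" for n
  proof (induction n)
    case 0 show ?case using w by auto
  next
    case (Suc n)
    then obtain z where z: "(f ^^ n) x = T z" "cmod z < \<delta>" "l ^ n * cmod w \<le> cmod z" by blast
    have 1: "(f ^^ Suc n) x = T (F z)" using z(1) semiconj(1)[OF z(2)] by simp
    obtain y where y: "(f ^^ Suc n) x = T y" "cmod y < \<delta>" using orb[of "Suc n"] by auto
    have "F z = y" by (rule inj_onD[OF T]) (use 1 y \<delta> semiconj(2)[OF z(2)] in auto)
    moreover have "l * (l ^ n * cmod w) \<le> l * cmod z" using z(3) l by (intro mult_left_mono) auto
    ultimately show ?case using 1 y(2) F[OF z(2)] by (intro exI[of _ "F z"]) (auto simp: mult.assoc)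
  qed
  then have bd: "l ^ n * cmod w < \<delta>" for n by (meson order_le_less_trans)
  obtain n where "\<delta> / cmod w < l ^ n" using real_arch_pow[OF l] by blast
  then show False using bd[of n] w0 by (simp add: field_simps)
qed

section \<open>First Lyapunov coefficient\<close>

text \<open>The Moebius map w \<mapsto> 1 / (w - 1) sends the unit circle to the vertical line Re =
  -1/2.\<close>

lemma Re_inverse_minus_1:
  assumes "cmod w = 1" "w \<noteq> 1"
  shows "Re (1 / (w - 1)) = - 1/2"
proof -
  have sq: "(Re w)^2 + (Im w)^2 = 1" using assms(1) by (simp add: cmod_def)
  have "Re w \<noteq> 1"
  proof
    assume "Re w = 1"
    then show False using sq assms(2) by (simp add: complex_eq_iff)
  qed
  moreover have "(Re w - 1)^2 + (Im w)^2 = 2 - 2 * Re w" using sq by (simp add: power2_eq_square algebra_simps)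
  ultimately show ?thesis by (simp add: Re_divide divide_simps)
qed

text \<open>The classical first Lyapunov coefficient of a planar map with purely quadratic
  nonlinearity. On the unit circle 1 / \<mu> = cnj \<mu>; the terms b cnj b / (\<mu> - 1) and 2 c
  cnj c / (\<mu>^3 - 1) then have known real parts by \<open>Re_inverse_minus_1\<close>, and the two
  terms with a b combine over the denominator 1 - \<mu>.\<close>

lemma cubic_coefficient_unit:
  fixes \<mu> a b c :: complex
  assumes \<mu>: "cmod \<mu> = 1" "\<mu> \<noteq> 1" "\<mu>^3 \<noteq> 1"
  shows "Re ((2 * (a / (\<mu> - \<mu>^2)) * \<mu> * b + b / (\<mu> - \<mu> * cnj \<mu>) * (\<mu> * cnj b + cnj \<mu> * a)
      + 2 * (c / (\<mu> - (cnj \<mu>)^2)) * cnj \<mu> * cnj c) / \<mu>)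
    = Re (a * b * (1 - cnj \<mu>) * (2 - cnj \<mu>) * cnj \<mu>) / (cmod (1 - \<mu>))^2 - (cmod b)^2 / 2 - (cmod c)^2"
proof -
  let ?m = "cnj \<mu>"
  have mm: "\<mu> * ?m = 1" using \<mu>(1) complex_norm_square[of \<mu>] by simp
  have \<mu>0: "\<mu> \<noteq> 0" and m0: "?m \<noteq> 0" using \<mu>(1) by auto
  have n1: "1 - \<mu> \<noteq> 0" "\<mu> - 1 \<noteq> 0" "\<mu>^3 - 1 \<noteq> 0" using \<mu> by auto
  have inv: "x / \<mu> = x * ?m" for x
  proof -
    have "x = x * (?m * \<mu>)" using mm by (simp add: mult.commute)
    then show ?thesis using \<mu>0 by (simp add: divide_eq_eq mult.assoc)
  qed
  have inv1: "x / (\<mu> - 1) = - (x / (1 - \<mu>))" for x by (metis minus_diff_eq minus_divide_right)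
  have t1: "2 * (a / (\<mu> - \<mu>^2)) * \<mu> * b / \<mu> = 2 * a * b * ?m / (1 - \<mu>)"
  proof -
    have "\<mu> - \<mu>^2 = (1 - \<mu>) * \<mu>" by (simp add: power2_eq_square algebra_simps)
    then have "a / (\<mu> - \<mu>^2) = a / (1 - \<mu>) * ?m" by (simp flip: inv)
    then show ?thesis using \<mu>0 by simp
  qed
  have t2: "b / (\<mu> - \<mu> * ?m) * (\<mu> * cnj b + ?m * a) / \<mu> = b * cnj b * (1 / (\<mu> - 1)) - a * b * ?m^2 / (1 - \<mu>)"
  proof -
    define B where "B = b / (\<mu> - 1)"
    have "B * (\<mu> * cnj b + ?m * a) / \<mu> = B * cnj b * (\<mu> * ?m) + B * (a * ?m^2)"
      unfolding inv by (simp add: algebra_simps power2_eq_square)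
    also have "B * (a * ?m^2) = - (a * b * ?m^2 / (1 - \<mu>))" unfolding B_def inv1 by (simp add: mult_ac)
    finally show ?thesis unfolding mm B_def by (simp add: mult_ac)
  qed
  have t3: "2 * (c / (\<mu> - ?m^2)) * ?m * cnj c / \<mu> = 2 * (c * cnj c) * (1 / (\<mu>^3 - 1))"
  proof -
    define C where "C = 1 / (\<mu> - ?m^2)"
    have "?m^2 * \<mu>^2 = 1" using mm by (metis mult.commute power_mult_distrib power_one)
    then have "\<mu>^3 - 1 = (\<mu> - ?m^2) * \<mu> * \<mu>" by (simp add: algebra_simps power2_eq_square power3_eq_cube)
    then have "1 / (\<mu>^3 - 1) = C / \<mu> / \<mu>" by (simp add: C_def)
    also have "\<dots> = C * ?m * ?m" unfolding inv ..
    finally have 1: "1 / (\<mu>^3 - 1) = C * ?m * ?m" .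
    have "c / (\<mu> - ?m^2) = c * C" by (simp add: C_def)
    then show ?thesis unfolding inv 1 by (simp add: mult_ac)
  qed
  have i1: "1 / (1 - \<mu>) = (1 - ?m) / of_real ((cmod (1 - \<mu>))^2)"
    using n1 unfolding complex_norm_square by (simp add: divide_simps)
  have Re1: "Re (1 / (\<mu> - 1)) = - 1/2" by (rule Re_inverse_minus_1[OF \<mu>(1,2)])
  have Re3: "Re (1 / (\<mu>^3 - 1)) = - 1/2" by (rule Re_inverse_minus_1) (use \<mu> in \<open>auto simp: norm_power\<close>)
  have Rsc: "Re (of_real x * z) = x * Re z" for x z by simp
  have "2 * a * b * ?m / (1 - \<mu>) - a * b * ?m^2 / (1 - \<mu>) = (a * b * (2 - ?m) * ?m) * (1 / (1 - \<mu>))"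
    by (simp add: power2_eq_square algebra_simps diff_divide_distrib)
  also have "\<dots> = a * b * (1 - ?m) * (2 - ?m) * ?m / of_real ((cmod (1 - \<mu>))^2)"
    unfolding i1 by (simp add: mult_ac)
  finally have ab: "Re (2 * a * b * ?m / (1 - \<mu>) - a * b * ?m^2 / (1 - \<mu>)) = Re (a * b * (1 - ?m) * (2 - ?m) * ?m) / (cmod (1 - \<mu>))^2"
    by (simp only: Re_divide_of_real)
  have eq: "(2 * (a / (\<mu> - \<mu>^2)) * \<mu> * b + b / (\<mu> - \<mu> * ?m) * (\<mu> * cnj b + ?m * a) + 2 * (c / (\<mu> - ?m^2)) * ?m * cnj c) / \<mu>
    = (2 * a * b * ?m / (1 - \<mu>) - a * b * ?m^2 / (1 - \<mu>)) + of_real ((cmod b)^2) * (1 / (\<mu> - 1)) + of_real (2 * (cmod c)^2) * (1 / (\<mu>^3 - 1))"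
    unfolding add_divide_distrib t1 t2 t3 of_real_mult of_real_numeral complex_norm_square by (simp add: algebra_simps)
  show ?thesis unfolding eq plus_complex.sel ab Rsc Re1 Re3 by linarith
qed


text \<open>Half the trace, the imaginary part of the multiplier (the radicand is \<open>det - tau\<^sup>2\<close>), and the entry of the
  eigenbasis that makes the linear part conformal.\<close>

definition tau :: "real \<Rightarrow> real \<Rightarrow> real" where "tau r g = 1 - r / (2 * g)"
definition omega :: "real \<Rightarrow> real \<Rightarrow> real" where "omega r g = sqrt (1 + r - r * (1 + r) / g - (tau r g)^2)"
definition slope :: "real \<Rightarrow> real \<Rightarrow> real" where "slope r g = 2 * g * omega r g / r"

section \<open>The quadratic map in coordinates of a complex eigenvector\<close>

definition multiplier :: "real \<Rightarrow> real \<Rightarrow> complex" where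
  "multiplier r g = Complex (tau r g) (omega r g)"
text \<open>\<open>V\<close> is quadratic, so in the coordinate \<open>chart\<close> there are three
  nonlinear coefficients and no remainder.\<close>

definition coeff_zz :: "real \<Rightarrow> real \<Rightarrow> complex" where
  "coeff_zz r g = Complex ((g - 1) / 2) (slope r g / 4 - (2 * g + 1) / (4 * slope r g))"
definition coeff_zc :: "real \<Rightarrow> real \<Rightarrow> complex" where
  "coeff_zc r g = Complex (- 1/2) (- ((2 * g + 1) / (2 * slope r g)))"
definition coeff_cc :: "real \<Rightarrow> real \<Rightarrow> complex" where
  "coeff_cc r g = Complex (- g / 2) (- (slope r g / 4 + (2 * g + 1) / (4 * slope r g)))"

text \<open>This is E2 + 2 Re (z v), where v = (1, - (1 + i slope) / 2) is an eigenvector of the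
  Jacobian at E2 for \<open>multiplier\<close>.\<close>

definition chart :: "real \<Rightarrow> real \<Rightarrow> complex \<Rightarrow> real^2" where
  "chart r g z = vector [r / g + 2 * Re z, 1 - r / g - Re z + slope r g * Im z]"

text \<open>An exact polynomial identity. With e = r / g, m the slope and w the imaginary part of
  the multiplier, the linear terms match by m e = 2 w and m w = 2 g - 2 r - e / 2, the quadratic
  ones by m n = 2 g + 1.\<close>

lemma chart_semiconj:
  assumes r: "0 < r" and g: "0 < g" and pos: "0 < 1 + r - r * (1 + r) / g - (tau r g)^2"
  shows "V r g (chart r g z) =
     chart r g (multiplier r g * z + (coeff_zz r g * z^2 + coeff_zc r g * z * cnj z + coeff_cc r g * (cnj z)^2))"
proof -
  define m where "m = slope r g"
  define n where "n = (2 * g + 1) / m"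
  define w where "w = omega r g"
  define e where "e = r / g"
  have re: "r = e * g" using g by (simp add: e_def)
  have w: "w > 0" "w^2 = 1 + r - r * (1 + r) / g - (tau r g)^2" using pos by (simp_all add: w_def omega_def)
  have m: "m = 2 * g * w / r" by (simp add: m_def slope_def w_def)
  then have m0: "m > 0" using r g w by simp
  have mn: "m * n = 2 * g + 1" using m0 by (simp add: n_def)
  have tau: "tau r g = 1 - e / 2" using g by (simp add: tau_def e_def)
  have me: "m * e = 2 * w" using r g by (simp add: m e_def)
  then have w': "w = m * e / 2" by simp
  have mw: "m * w = 2 * g - 2 * r - e / 2"
  proof -
    have "m * w = 2 / e * w^2" using r g by (simp add: m e_def power2_eq_square)
    also have "w^2 = 1 + r - e * (1 + r) - (1 - e / 2)^2" unfolding w(2) tau by (simp add: e_def)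
    also have "\<dots> = e * (g - r - e / 4)" by (simp add: re power2_eq_square algebra_simps)
    finally show ?thesis using r g by (simp add: e_def algebra_simps)
  qed
  obtain X Y where z: "z = Complex X Y" by (cases z)
  have a: "coeff_zz r g = Complex ((g - 1) / 2) (m / 4 - n / 4)" using m0 by (simp add: coeff_zz_def n_def flip: m_def)
  have b: "coeff_zc r g = Complex (- 1/2) (- n / 2)" using m0 by (simp add: coeff_zc_def n_def flip: m_def)
  have c: "coeff_cc r g = Complex (- g / 2) (- (m / 4 + n / 4))" using m0 by (simp add: coeff_cc_def n_def flip: m_def)
  define q where "q = coeff_zz r g * z^2 + coeff_zc r g * z * cnj z + coeff_cc r g * (cnj z)^2"
  have Re_q: "Re q = - (X^2) - m * X * Y"
    unfolding q_def a b c z by (simp add: power2_eq_square field_simps)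
  have Im_q: "Im q = - (n * X^2) + (2 * g - 1) * X * Y"
    unfolding q_def a b c z by (simp add: power2_eq_square field_simps)
  have R: "Re (multiplier r g * z + q) = (1 - e / 2) * X - w * Y - X^2 - m * X * Y"
    by (simp add: multiplier_def tau z Re_q flip: w_def)
  have Im_eq: "Im (multiplier r g * z + q) = (1 - e / 2) * Y + w * X - n * X^2 + (2 * g - 1) * X * Y"
    by (simp add: multiplier_def tau z Im_q flip: w_def)
  have "m * Im (multiplier r g * z + q) = (1 - e / 2) * (m * Y) + (m * w) * X - (m * n) * X^2 + m * (2 * g - 1) * X * Y"
    unfolding Im_eq by (simp add: algebra_simps)
  also have "\<dots> = (m - w) * Y + (2 * g - 2 * r - e / 2) * X - (2 * g + 1) * X^2 + m * (2 * g - 1) * X * Y"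
    unfolding mw mn by (simp add: w' algebra_simps)
  finally have I: "m * Im (multiplier r g * z + q) = (m - w) * Y + (2 * g - 2 * r - e / 2) * X - (2 * g + 1) * X^2 + m * (2 * g - 1) * X * Y" .
  have 1: "(e + 2 * X) * (2 - (e + 2 * X)) - (e + 2 * X) * (1 - e - X + m * Y) = e + 2 * ((1 - e / 2) * X - w * Y - X^2 - m * X * Y)"
    unfolding w' by (simp add: algebra_simps power2_eq_square)
  have 2: "g * (e + 2 * X) * (1 - e - X + m * Y) + (1 - r) * (1 - e - X + m * Y)
     = 1 - e - ((1 - e / 2) * X - w * Y - X^2 - m * X * Y) + ((m - w) * Y + (2 * g - 2 * r - e / 2) * X - (2 * g + 1) * X^2 + m * (2 * g - 1) * X * Y)"
    unfolding re w' by (simp add: algebra_simps power2_eq_square)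
  show ?thesis
    unfolding q_def[symmetric] chart_def V_def vec_eq_iff forall_2 vector_2 m_def[symmetric] e_def[symmetric] R I
    using 1 2 by (simp add: z)
qed

text \<open>At g = 1 + r the determinant is 1, so omega^2 = 1 - tau^2. There tau = (2 + r) / (2 (1 +
  r)), and its lower bound 3/4 is equivalent to r \<le> 1.\<close>

lemma critical_values:
  fixes r :: real
  assumes r: "0 < r" "r \<le> 1"
  defines "g \<equiv> 1 + r"
  shows "tau r g \<ge> 3/4" "0 < omega r g" "(tau r g)^2 + (omega r g)^2 = 1"
    "0 < 1 + r - r * (1 + r) / g - (tau r g)^2"
    "slope r g > 0" "(slope r g)^2 = (4 + 3 * r) / r"
proof -
  have g: "0 < g" "1 + r - r * (1 + r) / g = 1" using r by (simp_all add: g_def)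
  have tau: "tau r g = (2 + r) / (2 * g)" using r by (simp add: tau_def g_def field_simps)
  show t: "tau r g \<ge> 3/4" unfolding tau using r by (simp add: g_def field_simps)
  have sq: "1 - (tau r g)^2 = r * (4 + 3 * r) / (4 * g^2)"
  proof -
    have "r * (4 + 3 * r) = 4 * g^2 - (2 + r)^2" by (simp add: g_def power2_eq_square algebra_simps)
    then show ?thesis unfolding tau using g(1) by (simp add: diff_divide_distrib power_mult_distrib power_divide)
  qed
  have "0 < r * (4 + 3 * r) / (4 * g^2)" using r g by simp
  then show pos: "0 < 1 + r - r * (1 + r) / g - (tau r g)^2" unfolding g(2) sq .
  then show w: "0 < omega r g" by (simp add: omega_def)
  have w2: "(omega r g)^2 = r * (4 + 3 * r) / (4 * g^2)"
    using pos unfolding omega_def g(2) sq[symmetric] by simp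
  then show "(tau r g)^2 + (omega r g)^2 = 1" using sq by simp
  show "slope r g > 0" using w r g by (simp add: slope_def)
  show "(slope r g)^2 = (4 + 3 * r) / r"
    unfolding slope_def power_divide power_mult_distrib w2 using r g by (simp add: power2_eq_square)
qed

text \<open>On the unit circle the six inequalities say that \<mu>, \<mu>^2, \<mu>^3 and \<mu>^4
  differ from 1. With Re \<mu> \<ge> 3/4 and Im \<mu> > 0 the powers \<mu>, \<mu>^2, \<mu>^3 all lie
  in the upper half plane, and conjugates of them in the lower one.\<close>

lemma critical_nonresonance:
  fixes r :: real
  assumes r: "0 < r" "r \<le> 1"
  defines "\<mu> \<equiv> multiplier r (1 + r)"
  shows "cmod \<mu> = 1" "\<mu> \<noteq> 1" "\<mu>^3 \<noteq> 1" "\<mu> \<noteq> \<mu>^2" "\<mu> \<noteq> \<mu> * cnj \<mu>" "\<mu> \<noteq> (cnj \<mu>)^2"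
    "\<mu> \<noteq> \<mu>^3" "\<mu> \<noteq> \<mu> * (cnj \<mu>)^2" "\<mu> \<noteq> (cnj \<mu>)^3"
proof -
  define t where "t = tau r (1 + r)"
  define w where "w = omega r (1 + r)"
  have t: "t \<ge> 3/4" and w: "w > 0" and tw: "t^2 + w^2 = 1"
    using critical_values[OF r] by (simp_all add: t_def w_def)
  have \<mu>: "\<mu> = Complex t w" by (simp add: \<mu>_def multiplier_def t_def w_def)
  have w2: "w * w = 1 - t * t" using tw by (simp add: power2_eq_square)
  have t2: "t * t \<ge> 9/16" using mult_mono[OF t t] t by simp
  show 1: "cmod \<mu> = 1" unfolding \<mu> cmod_def using tw by simp
  have mm: "\<mu> * cnj \<mu> = 1" using 1 complex_norm_square[of \<mu>] by simp
  show ne1: "\<mu> \<noteq> 1" unfolding \<mu> using w by (simp add: complex_eq_iff)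
  have \<mu>0: "\<mu> \<noteq> 0" using 1 by auto
  have "Im (\<mu>^2) = 2 * t * w" by (simp add: \<mu> power2_eq_square)
  then have sq: "\<mu>^2 \<noteq> 1" using t w by (auto simp: complex_eq_iff)
  have "Im (\<mu>^3) = w * (3 * (t * t) - w * w)" by (simp add: \<mu> power3_eq_cube algebra_simps)
  also have "\<dots> = w * (4 * (t * t) - 1)" unfolding w2 by simp
  finally have Im3: "Im (\<mu>^3) = w * (4 * (t * t) - 1)" .
  moreover have pos: "0 < 4 * (t * t) - 1" using t2 by simp
  ultimately have Im3_pos: "0 < Im (\<mu>^3)" using w by simp
  then show "\<mu>^3 \<noteq> 1" by auto
  show "\<mu> \<noteq> \<mu>^2" using ne1 \<mu>0 by (simp add: power2_eq_square)
  show "\<mu> \<noteq> \<mu> * cnj \<mu>" unfolding mm by (rule ne1)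
  have "Im ((cnj \<mu>)^2) = - 2 * t * w" by (simp add: \<mu> power2_eq_square)
  moreover have "0 < t * w" using t w by simp
  ultimately have "Im ((cnj \<mu>)^2) < 0" by simp
  moreover have Im_pos: "0 < Im \<mu>" using w by (simp add: \<mu>)
  ultimately show "\<mu> \<noteq> (cnj \<mu>)^2" by auto
  show "\<mu> \<noteq> \<mu>^3"
  proof
    assume "\<mu> = \<mu>^3"
    then have "\<mu> * 1 = \<mu> * \<mu>^2" by (simp add: power3_eq_cube power2_eq_square)
    then show False using sq \<mu>0 by (metis mult_left_cancel)
  qed
  show "\<mu> \<noteq> \<mu> * (cnj \<mu>)^2"
  proof
    assume "\<mu> = \<mu> * (cnj \<mu>)^2"
    then have "\<mu> * 1 = \<mu> * (cnj \<mu>)^2" by simp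
    then have "(cnj \<mu>)^2 = 1" using \<mu>0 by (metis mult_left_cancel)
    then have "cnj (\<mu>^2) = 1" by simp
    then show False using sq by (metis complex_cnj_cnj complex_cnj_one)
  qed
  have "Im ((cnj \<mu>)^3) = - Im (\<mu>^3)" by (metis complex_cnj_power cnj.sel(2))
  then show "\<mu> \<noteq> (cnj \<mu>)^3" using Im_pos Im3_pos by (metis neg_less_0_iff_less order_less_asym)
qed

text \<open>The slope m and the quotient n involve a square root, but they enter the final
  expression only through m^2, m n and n^2, which are rational in r. This is why S occurs only
  multiplied by m, and why the last step is an identity between rational functions.\<close>

lemma critical_lyapunov_coefficient:
  fixes r :: real
  assumes r: "0 < r" "r \<le> 1"
  defines "g \<equiv> 1 + r"
  defines "\<mu> \<equiv> multiplier r g" and "a \<equiv> coeff_zz r g" and "b \<equiv> coeff_zc r g" and "c \<equiv> coeff_cc r g"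
  shows "Re ((2 * (a / (\<mu> - \<mu>^2)) * \<mu> * b + b / (\<mu> - \<mu> * cnj \<mu>) * (\<mu> * cnj b + cnj \<mu> * a)
      + 2 * (c / (\<mu> - (cnj \<mu>)^2)) * cnj \<mu> * cnj c) / \<mu>) = - (g^2 / 2)"
proof -
  define m where "m = slope r g"
  define n where "n = (2 * g + 1) / m"
  define e where "e = r / g"
  define N where "N = (3 + 2 * r)^2 * r / (4 + 3 * r)"
  have g: "g > 0" using r by (simp add: g_def)
  have m: "m > 0" "m^2 = (4 + 3 * r) / r" using critical_values[OF r] by (simp_all add: m_def g_def)
  have mn: "m * n = 3 + 2 * r" using m by (simp add: n_def g_def)
  have nn: "n^2 = N"
  proof -
    have "(m * n)^2 = (4 + 3 * r) / r * n^2" by (simp only: power_mult_distrib m(2))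
    then have "(3 + 2 * r)^2 = (4 + 3 * r) / r * n^2" unfolding mn .
    then show ?thesis using r by (simp add: N_def field_simps)
  qed
  have a: "a = Complex (r / 2) ((m - n) / 4)"
  proof -
    have "g - 1 = r" by (simp add: g_def)
    then show ?thesis using m by (simp add: a_def coeff_zz_def n_def diff_divide_distrib flip: m_def)
  qed
  have b: "b = Complex (- 1/2) (- n / 2)" using m by (simp add: b_def coeff_zc_def n_def flip: m_def)
  have c: "c = Complex (- g / 2) (- ((m + n) / 4))" using m by (simp add: c_def coeff_cc_def n_def add_divide_distrib flip: m_def)
  have \<mu>: "\<mu> = Complex (1 - e / 2) (m * e / 2)" using r g by (simp add: \<mu>_def multiplier_def tau_def m_def slope_def e_def)
  define S where "S = - (m - n) / 8 - r * n / 4"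
  define P where "P = - (r / 4) + n * (m - n) / 8"
  have ab: "a * b = Complex P S" by (simp add: a b P_def S_def complex_eq_iff field_simps)
  have ms: "m * m = (4 + 3 * r) / r" "n * n = N" using m(2) nn by (simp_all add: power2_eq_square)
  have nm: "n * m = 3 + 2 * r" using mn by (simp add: mult.commute)
  have P: "P = - (r / 4) + (3 + 2 * r - N) / 8" by (simp add: P_def right_diff_distrib nm ms)
  have mS: "m * S = - ((4 + 3 * r) / r - (3 + 2 * r)) / 8 - r * (3 + 2 * r) / 4"
  proof -
    have "m * S = - (m * m - m * n) / 8 - r * (m * n) / 4" by (simp add: S_def field_simps)
    then show ?thesis unfolding ms mn .
  qed
  \<comment> \<open>With x = 1 - cnj \<mu> = e / 2 * (1 + i m) one has (2 - cnj \<mu>) * cnj \<mu> =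
    (1 + x) * (1 - x) = 1 - x^2; A is its real part and - (e^2 / 2 * m) its imaginary part.\<close>
  define A where "A = 1 - e^2 / 4 * (1 - m^2)"
  have "(1 - cnj \<mu>) * (2 - cnj \<mu>) * cnj \<mu> = Complex (e / 2) (m * e / 2) * Complex A (- (e^2 / 2 * m))"
    by (simp add: \<mu> A_def complex_eq_iff power2_eq_square field_simps)
  then have "a * b * (1 - cnj \<mu>) * (2 - cnj \<mu>) * cnj \<mu> = Complex P S * (Complex (e / 2) (m * e / 2) * Complex A (- (e^2 / 2 * m)))"
    unfolding ab by (simp add: mult.assoc)
  then have "Re (a * b * (1 - cnj \<mu>) * (2 - cnj \<mu>) * cnj \<mu>) = e / 2 * ((A + e^2 / 2 * m^2) * P - (A - e^2 / 2) * (m * S))"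
    by (simp add: power2_eq_square field_simps)
  moreover have "(cmod (1 - \<mu>))^2 = e"
  proof -
    have "(cmod (1 - \<mu>))^2 = e^2 / 4 * (1 + m^2)" unfolding cmod_power2 by (simp add: \<mu> power2_eq_square field_simps)
    also have "\<dots> = e"
    proof -
      have "1 + m^2 = 4 * g / r" unfolding m(2) using r by (simp add: g_def field_simps)
      then show ?thesis using r g by (simp add: e_def power2_eq_square)
    qed
    finally show ?thesis .
  qed
  moreover have "e > 0" using r g by (simp add: e_def)
  ultimately have 1: "Re (a * b * (1 - cnj \<mu>) * (2 - cnj \<mu>) * cnj \<mu>) / (cmod (1 - \<mu>))^2
    = ((A + e^2 / 2 * m^2) * P - (A - e^2 / 2) * (m * S)) / 2" by simp
  have 2: "(cmod b)^2 = 1/4 + N / 4" by (simp add: cmod_power2 b nn power_divide)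
  have "(m + n)^2 = (4 + 3 * r) / r + N + 2 * (3 + 2 * r)" unfolding power2_sum m(2) nn using mn by simp
  then have 3: "(cmod c)^2 = g^2 / 4 + ((4 + 3 * r) / r + N + 2 * (3 + 2 * r)) / 16" by (simp add: cmod_power2 c power_divide)
  have "((A + e^2 / 2 * m^2) * P - (A - e^2 / 2) * (m * S)) / 2 - (1/4 + N / 4) / 2 - (g^2 / 4 + ((4 + 3 * r) / r + N + 2 * (3 + 2 * r)) / 16) = - (g^2 / 2)"
  proof -
    have e: "e = r / (1 + r)" by (simp add: e_def g_def)
    have nz: "1 + r \<noteq> 0" "r \<noteq> 0" "4 + 3 * r \<noteq> 0" using r by auto
    show ?thesis unfolding A_def mS P m(2) e N_def g_def using nz
      by (simp add: divide_simps) (simp add: algebra_simps power2_eq_square power_numeral_reduce)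
  qed
  then show ?thesis
    unfolding cubic_coefficient_unit[OF critical_nonresonance(1-3)[OF r, folded g_def, folded \<mu>_def]] 1 2 3 .
qed

section \<open>Jacobian matrix at the fixed point\<close>

text \<open>A nonzero upper right entry b forces every eigenvector to have nonzero first component,
  and supplies the explicit eigenvector (b, l - a) for a root l of the characteristic
  polynomial.\<close>

lemma complex_eigenvalues_2x2:
  fixes A :: "real^2^2"
  assumes "A$1$2 \<noteq> 0"
  shows "complex_eigenvalues A = {l. l^2 - of_real (A$1$1 + A$2$2) * l + of_real (A$1$1 * A$2$2 - A$1$2 * A$2$1) = 0}"
proof -
  define a b c d where "a = complex_of_real (A$1$1)" and "b = complex_of_real (A$1$2)"
    and "c = complex_of_real (A$2$1)" and "d = complex_of_real (A$2$2)"
  have b: "b \<noteq> 0" using assms by (simp add: b_def)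
  have char: "l^2 - of_real (A$1$1 + A$2$2) * l + of_real (A$1$1 * A$2$2 - A$1$2 * A$2$1) = (a - l) * (d - l) - b * c" for l
    by (simp add: a_def b_def c_def d_def power2_eq_square algebra_simps)
  have eig: "(\<chi> i j. complex_of_real (A$i$j)) *v v = l *s v \<longleftrightarrow> a * v$1 + b * v$2 = l * v$1 \<and> c * v$1 + d * v$2 = l * v$2"
    for v :: "complex^2" and l
    by (simp add: vec_eq_iff forall_2 matrix_vector_mult_def sum_2 a_def b_def c_def d_def)
  show ?thesis
    unfolding complex_eigenvalues_def eig char
  proof (intro equalityI subsetI CollectI; elim CollectE exE conjE)
    fix l and v :: "complex^2" assume v: "v \<noteq> 0" and e: "a * v$1 + b * v$2 = l * v$1" "c * v$1 + d * v$2 = l * v$2"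
    have e1: "(a - l) * v$1 = - (b * v$2)" using e(1) by (simp add: algebra_simps eq_neg_iff_add_eq_0)
    have e2: "c * v$1 = - ((d - l) * v$2)" using e(2) by (simp add: algebra_simps eq_neg_iff_add_eq_0)
    have "((a - l) * (d - l) - b * c) * v$1 = (d - l) * ((a - l) * v$1) - b * (c * v$1)" by (simp add: algebra_simps)
    also have "\<dots> = 0" unfolding e1 e2 by simp
    finally have 1: "((a - l) * (d - l) - b * c) * v$1 = 0" .
    have "v$1 \<noteq> 0"
    proof
      assume "v$1 = 0"
      then have "v$2 = 0" using e1 b by simp
      with \<open>v$1 = 0\<close> show False using v by (simp add: vec_eq_iff forall_2)
    qed
    then show "(a - l) * (d - l) - b * c = 0" using 1 by simp
  next
    fix l assume l: "(a - l) * (d - l) - b * c = 0"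
    define v :: "complex^2" where "v = vector [b, l - a]"
    have "v \<noteq> 0" using b by (auto simp: v_def vec_eq_iff forall_2)
    moreover have "a * v$1 + b * v$2 = l * v$1" "c * v$1 + d * v$2 = l * v$2"
      using l by (simp_all add: v_def algebra_simps)
    ultimately show "\<exists>v::complex^2. v \<noteq> 0 \<and> a * v$1 + b * v$2 = l * v$1 \<and> c * v$1 + d * v$2 = l * v$2" by (intro exI[of _ v] conjI)
  qed
qed

lemma V_has_derivative:
  "(V r g has_derivative (\<lambda>h. (vector [vector [2 - 2 * p$1 - p$2, - p$1], vector [g * p$2, g * p$1 + 1 - r]] :: real^2^2) *v h)) (at p)"
proof (subst has_derivative_componentwise_within, intro ballI)
  fix i :: "real^2" assume "i \<in> Basis"
  then consider "i = axis 1 1" | "i = axis 2 1" by (auto simp: Basis_vec_def exhaust_2) (metis exhaust_2)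
  moreover have n: "((\<lambda>z::real^2. z$j) has_derivative (\<lambda>h. h$j)) (at p)" for j
    by (rule bounded_linear.has_derivative[OF bounded_linear_vec_nth has_derivative_ident])
  ultimately show "((\<lambda>x. V r g x \<bullet> i) has_derivative (\<lambda>h. ((vector [vector [2 - 2 * p$1 - p$2, - p$1], vector [g * p$2, g * p$1 + 1 - r]] :: real^2^2) *v h) \<bullet> i)) (at p)"
  proof cases
    case 1
    have "((\<lambda>z::real^2. z$1 * (2 - z$1) - z$1 * z$2) has_derivative (\<lambda>h. (2 - 2 * p$1 - p$2) * h$1 + - p$1 * h$2)) (at p)"
      by (rule derivative_eq_intros n refl)+ (simp add: algebra_simps)
    then show ?thesis unfolding 1 by (simp add: inner_axis V_def matrix_vector_mult_def sum_2)
  next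
    case 2
    have "((\<lambda>z::real^2. g * z$1 * z$2 + (1 - r) * z$2) has_derivative (\<lambda>h. g * p$2 * h$1 + (g * p$1 + 1 - r) * h$2)) (at p)"
      by (rule derivative_eq_intros n refl)+ (simp add: algebra_simps)
    then show ?thesis unfolding 2 by (simp add: inner_axis V_def matrix_vector_mult_def sum_2)
  qed
qed

lemma jacobian_V:
  "jacobian (V r g) (at p) = vector [vector [2 - 2 * p$1 - p$2, - p$1], vector [g * p$2, g * p$1 + 1 - r]]"
  unfolding jacobian_def frechet_derivative_at[OF V_has_derivative, symmetric] by (rule matrix_of_matrix_vector_mul)

section \<open>The bifurcation\<close>

lemma isCont_coefficients:
  fixes r :: real
  assumes r: "0 < r" "r \<le> 1"
  shows "isCont (multiplier r) (1 + r)" "isCont (slope r) (1 + r)" "isCont (coeff_zz r) (1 + r)"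
    "isCont (coeff_zc r) (1 + r)" "isCont (coeff_cc r) (1 + r)"
proof -
  have nz: "1 + r \<noteq> 0" "r \<noteq> 0" using r by auto
  have tau: "isCont (tau r) (1 + r)" unfolding tau_def using nz by (intro continuous_intros) auto
  have omega: "isCont (omega r) (1 + r)" unfolding omega_def using nz tau by (intro continuous_intros) auto
  show slope: "isCont (slope r) (1 + r)" unfolding slope_def using nz omega by (intro continuous_intros) auto
  have s: "slope r (1 + r) \<noteq> 0" using critical_values[OF r] by simp
  show "isCont (multiplier r) (1 + r)" unfolding multiplier_def Complex_eq using tau omega by (intro continuous_intros)
  show "isCont (coeff_zz r) (1 + r)" unfolding coeff_zz_def Complex_eq using slope s by (intro continuous_intros) auto
  show "isCont (coeff_zc r) (1 + r)" unfolding coeff_zc_def Complex_eq using slope s by (intro continuous_intros) auto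
  show "isCont (coeff_cc r) (1 + r)" unfolding coeff_cc_def Complex_eq using slope s by (intro continuous_intros) auto
qed

lemma eventually_less_nhds:
  fixes f :: "real \<Rightarrow> real"
  assumes "isCont f x" "f x < c"
  shows "\<forall>\<^sub>F y in nhds x. f y < c"
proof -
  have "(f \<longlongrightarrow> f x) (nhds x)" using assms(1) by (simp add: continuous_at tendsto_at_iff_tendsto_nhds)
  then show ?thesis using assms(2) by (rule order_tendstoD)
qed

lemma norm_vector2_le:
  fixes x :: "real^2"
  shows "norm x \<le> \<bar>x$1\<bar> + \<bar>x$2\<bar>"
  using norm_le_l1_cart[of x] by (simp add: sum_2)

lemma chart_lipschitz: "dist (chart r g x) (chart r g y) \<le> (3 + \<bar>slope r g\<bar>) * dist x y"
proof -
  let ?d = "x - y"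
  have "dist (chart r g x) (chart r g y) \<le> \<bar>2 * Re ?d\<bar> + \<bar>- Re ?d + slope r g * Im ?d\<bar>"
    unfolding dist_norm by (rule order_trans[OF norm_vector2_le]) (simp add: chart_def algebra_simps)
  also have "\<dots> \<le> 2 * \<bar>Re ?d\<bar> + (\<bar>Re ?d\<bar> + \<bar>slope r g\<bar> * \<bar>Im ?d\<bar>)"
    using abs_triangle_ineq[of "- Re ?d" "slope r g * Im ?d"] by (simp only: abs_mult abs_minus_cancel) simp
  also have "\<dots> \<le> 2 * cmod ?d + (cmod ?d + \<bar>slope r g\<bar> * cmod ?d)"
    by (intro add_mono mult_left_mono abs_Re_le_cmod abs_Im_le_cmod) auto
  finally show ?thesis by (simp add: dist_norm distrib_right)
qed

lemma chart_inj: "slope r g \<noteq> 0 \<Longrightarrow> inj (chart r g)"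
  by (rule injI) (auto simp: chart_def vec_eq_iff forall_2 complex_eq_iff)

text \<open>T composes the affine eigenvector chart with the inverse of the polynomial change of
  variables. The radii and the Lipschitz constant are chosen before g, as the later limit g
  \<rightarrow> 1 + r demands.\<close>

lemma V_normal_form:
  fixes r :: real
  assumes r: "0 < r" "r \<le> 1"
  obtains K m M c1 where "0 < K" "0 < m" "m \<le> M" "isCont c1 (1 + r)"
    "Re (c1 (1 + r) / multiplier r (1 + r)) = - ((1 + r)^2 / 2)"
    "\<forall>\<^sub>F g in nhds (1 + r). \<exists>T E. T 0 = E2 r g \<and> E 0 = 0 \<and> inj_on T (cball 0 M) \<and>
       (\<forall>x\<in>cball 0 M. \<forall>y\<in>cball 0 M. dist (T x) (T y) \<le> K * dist x y) \<and>
       (\<forall>k x y. k \<le> m \<longrightarrow> cmod x \<le> k \<longrightarrow> cmod y \<le> k \<longrightarrow> cmod (E x - E y) \<le> K * k^3 * cmod (x - y)) \<and>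
       (\<forall>w\<in>cball 0 m. let w' = multiplier r g * w + c1 g * w^2 * cnj w + E w in
          w' \<in> cball 0 M \<and> V r g (T w) = T w')"
    "\<forall>\<^sub>F g in nhds (1 + r). (cmod (multiplier r g))^2 = 1 + r - r * (1 + r) / g"
proof -
  let ?g = "1 + r"
  note cont = isCont_coefficients[OF r]
  have "isCont (\<lambda>g. - (1 + r - r * (1 + r) / g - (tau r g)^2)) ?g"
    unfolding tau_def using r by (intro continuous_intros) auto
  then have ev_pos: "\<forall>\<^sub>F g in nhds ?g. - (1 + r - r * (1 + r) / g - (tau r g)^2) < 0"
    by (rule eventually_less_nhds) (use critical_values(4)[OF r] in simp)
  have ev_g: "\<forall>\<^sub>F g in nhds ?g. - g < 0"
    by (rule eventually_less_nhds) (use r in \<open>auto intro: continuous_intros\<close>)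
  have ev_s: "\<forall>\<^sub>F g in nhds ?g. \<bar>slope r g\<bar> < \<bar>slope r ?g\<bar> + 1"
    by (rule eventually_less_nhds) (use cont in \<open>auto intro: continuous_intros\<close>)
  \<comment> \<open>The chart has Lipschitz constant 3 + \<bar>slope r g\<bar>, the slope varies by
    less than 1 near the critical parameter, and the factor 2 comes from \<psi>.\<close>
  define L where "L = 2 * (4 + \<bar>slope r ?g\<bar>)"
  obtain K m M c1 where K: "0 < K" "0 < m" "m \<le> M" "isCont c1 ?g"
    and c1: "c1 ?g = 2 * (coeff_zz r ?g / (multiplier r ?g - (multiplier r ?g)^2)) * multiplier r ?g * coeff_zc r ?g
       + coeff_zc r ?g / (multiplier r ?g - multiplier r ?g * cnj (multiplier r ?g)) * (multiplier r ?g * cnj (coeff_zc r ?g) + cnj (multiplier r ?g) * coeff_zz r ?g)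
       + 2 * (coeff_cc r ?g / (multiplier r ?g - (cnj (multiplier r ?g))^2)) * cnj (multiplier r ?g) * cnj (coeff_cc r ?g)"
    and nf: "\<forall>\<^sub>F g in nhds ?g. \<exists>\<psi> E. \<psi> 0 = 0 \<and> E 0 = 0 \<and> inj_on \<psi> (cball 0 M) \<and>
       (\<forall>x\<in>cball 0 M. \<forall>y\<in>cball 0 M. cmod (\<psi> x - \<psi> y) \<le> 2 * cmod (x - y)) \<and>
       (\<forall>k x y. k \<le> m \<longrightarrow> cmod x \<le> k \<longrightarrow> cmod y \<le> k \<longrightarrow> cmod (E x - E y) \<le> K * k^3 * cmod (x - y)) \<and>
       (\<forall>w\<in>cball 0 m. let w' = multiplier r g * w + c1 g * w^2 * cnj w + E w in
          w' \<in> cball 0 M \<and> \<psi> w' = multiplier r g * \<psi> w + (coeff_zz r g * (\<psi> w)^2 + coeff_zc r g * \<psi> w * cnj (\<psi> w) + coeff_cc r g * (cnj (\<psi> w))^2))"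
    using normal_form[OF cont(1,3,4,5) critical_nonresonance(4-9)[OF r]] by blast
  show thesis
  proof (rule that[of "max K L" m M c1])
    show "0 < max K L" "0 < m" "m \<le> M" "isCont c1 ?g" using K by auto
    show "Re (c1 ?g / multiplier r ?g) = - (?g^2 / 2)"
      unfolding c1 by (rule critical_lyapunov_coefficient[OF r])
    show "\<forall>\<^sub>F g in nhds ?g. (cmod (multiplier r g))^2 = 1 + r - r * (1 + r) / g"
      using ev_pos by eventually_elim (simp add: multiplier_def cmod_power2 omega_def)
    show "\<forall>\<^sub>F g in nhds ?g. \<exists>T E. T 0 = E2 r g \<and> E 0 = 0 \<and> inj_on T (cball 0 M) \<and>
       (\<forall>x\<in>cball 0 M. \<forall>y\<in>cball 0 M. dist (T x) (T y) \<le> max K L * dist x y) \<and>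
       (\<forall>k x y. k \<le> m \<longrightarrow> cmod x \<le> k \<longrightarrow> cmod y \<le> k \<longrightarrow> cmod (E x - E y) \<le> max K L * k^3 * cmod (x - y)) \<and>
       (\<forall>w\<in>cball 0 m. let w' = multiplier r g * w + c1 g * w^2 * cnj w + E w in
          w' \<in> cball 0 M \<and> V r g (T w) = T w')"
      using nf ev_pos ev_g ev_s
    proof eventually_elim
      case (elim g)
      have pos: "0 < 1 + r - r * (1 + r) / g - (tau r g)^2" and g: "0 < g" using elim by auto
      have "omega r g > 0" using pos by (simp add: omega_def)
      then have s: "slope r g \<noteq> 0" using r g by (simp add: slope_def)
      obtain \<psi> E where \<psi>: "\<psi> 0 = 0" "E 0 = 0" "inj_on \<psi> (cball 0 M)"
        and lip: "\<And>x y. x \<in> cball 0 M \<Longrightarrow> y \<in> cball 0 M \<Longrightarrow> cmod (\<psi> x - \<psi> y) \<le> 2 * cmod (x - y)"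
        and E: "\<And>k x y. k \<le> m \<Longrightarrow> cmod x \<le> k \<Longrightarrow> cmod y \<le> k \<Longrightarrow> cmod (E x - E y) \<le> K * k^3 * cmod (x - y)"
        and conj: "\<And>w. w \<in> cball 0 m \<Longrightarrow> let w' = multiplier r g * w + c1 g * w^2 * cnj w + E w in
          w' \<in> cball 0 M \<and> \<psi> w' = multiplier r g * \<psi> w + (coeff_zz r g * (\<psi> w)^2 + coeff_zc r g * \<psi> w * cnj (\<psi> w) + coeff_cc r g * (cnj (\<psi> w))^2)"
        using elim(1) by blast
      define T where "T = chart r g \<circ> \<psi>"
      have "T 0 = E2 r g" using g by (simp add: T_def \<psi> chart_def E2_def diff_divide_distrib)
      moreover have "inj_on T (cball 0 M)" unfolding T_def
        by (intro comp_inj_on \<psi> inj_on_subset[OF chart_inj[OF s]]) simp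
      moreover have "dist (T x) (T y) \<le> max K L * dist x y" if "x \<in> cball 0 M" "y \<in> cball 0 M" for x y
      proof -
        have "dist (T x) (T y) \<le> (3 + \<bar>slope r g\<bar>) * cmod (\<psi> x - \<psi> y)"
          using chart_lipschitz[of r g "\<psi> x" "\<psi> y"] by (simp add: T_def dist_norm)
        also have "\<dots> \<le> (3 + \<bar>slope r g\<bar>) * (2 * cmod (x - y))" by (intro mult_left_mono lip that) simp
        also have "\<dots> \<le> (4 + \<bar>slope r ?g\<bar>) * (2 * cmod (x - y))" using elim(4) by (intro mult_right_mono) auto
        also have "\<dots> = L * dist x y" by (simp add: L_def dist_norm)
        also have "\<dots> \<le> max K L * dist x y" by (intro mult_right_mono) auto
        finally show ?thesis .
      qed
      moreover have "cmod (E x - E y) \<le> max K L * k^3 * cmod (x - y)" if k: "k \<le> m" "cmod x \<le> k" "cmod y \<le> k" for k x y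
      proof -
        have "0 \<le> k" using k(2) norm_ge_zero[of x] by linarith
        then have "K * k^3 * cmod (x - y) \<le> max K L * k^3 * cmod (x - y)" by (intro mult_right_mono) auto
        then show ?thesis using E[OF k] by linarith
      qed
      moreover have "let w' = multiplier r g * w + c1 g * w^2 * cnj w + E w in w' \<in> cball 0 M \<and> V r g (T w) = T w'"
        if "w \<in> cball 0 m" for w
        using conj[OF that] chart_semiconj[OF r(1) g pos, of "\<psi> w"] by (simp add: Let_def T_def)
      ultimately show ?case using \<psi>(2) by (intro exI[of _ T] exI[of _ E]) blast
    qed
  qed
qed

text \<open>With t = \<bar>w\<bar>^2, d = - Re (c / \<mu>) and Q = \<bar>c / \<mu>\<bar>, the
  squared factor is 1 - 2 d t + Q^2 t^2 \<le> 1 - d t once Q^2 t \<le> d. So the factor is at most 1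
  - d t / 2, a gain of d / 2 * \<bar>w\<bar>^3, which beats the error K \<bar>w\<bar>^4 once K
  \<bar>w\<bar> \<le> d / 2.\<close>

lemma truncated_contracting:
  fixes \<mu> c :: complex
  assumes \<mu>: "cmod \<mu> = 1" and q: "Re (c / \<mu>) < 0" and m: "0 < m" and K: "0 < K"
    and E: "\<And>w. cmod w \<le> m \<Longrightarrow> cmod (E w) \<le> K * cmod w^4"
  obtains \<delta> where "0 < \<delta>" "\<delta> \<le> m" "\<And>w. cmod w < \<delta> \<Longrightarrow> cmod (\<mu> * w + c * w^2 * cnj w + E w) \<le> cmod w"
proof -
  define d where "d = - Re (c / \<mu>)"
  define Q where "Q = cmod (c / \<mu>)"
  have d: "0 < d" using q by (simp add: d_def)
  have "c / \<mu> \<noteq> 0" using q by auto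
  then have Q: "0 < Q" unfolding Q_def by (simp only: zero_less_norm_iff) simp
  have \<mu>0: "\<mu> \<noteq> 0" using \<mu> by auto
  define \<delta> where "\<delta> = Min {m, 1, d / (2 * K), d / Q^2}"
  have "0 < \<delta>" unfolding \<delta>_def using d Q m K by (subst Min_gr_iff) auto
  moreover have "\<delta> \<le> m" unfolding \<delta>_def by simp
  moreover have "cmod (\<mu> * w + c * w^2 * cnj w + E w) \<le> cmod w" if w: "cmod w < \<delta>" for w
  proof -
    define s where "s = cmod w"
    define t where "t = s^2"
    have s: "s < m" "s < 1" "s < d / (2 * K)" "s < d / Q^2" "0 \<le> s" using w by (auto simp: \<delta>_def s_def)
    have t: "0 \<le> t" "t \<le> s" using s by (auto simp: t_def power2_eq_square mult_left_le)
    have tQ: "Q^2 * t \<le> d"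
    proof -
      have "Q^2 * s \<le> d" using s(4) Q by (simp add: field_simps)
      then show ?thesis using mult_left_mono[OF t(2), of "Q^2"] by simp
    qed
    have tw: "w * cnj w = of_real t" by (simp add: t_def s_def flip: complex_norm_square)
    have "c * w^2 * cnj w = c * w * (w * cnj w)" by (simp add: power2_eq_square)
    then have eq: "\<mu> * w + c * w^2 * cnj w = \<mu> * w * (1 + c / \<mu> * of_real t)"
      using \<mu>0 unfolding tw by (simp add: algebra_simps)
    have "(cmod (1 + c / \<mu> * of_real t))^2 = (1 - d * t)^2 + (Im (c / \<mu>) * t)^2"
    proof -
      have R: "Re (x * of_real t) = Re x * t" "Im (x * of_real t) = Im x * t" for x by simp_all
      have q: "Re (c / \<mu>) = - d" by (simp only: d_def minus_minus)
      show ?thesis unfolding cmod_power2 plus_complex.sel one_complex.sel R q by simp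
    qed
    also have "\<dots> = 1 - 2 * (d * t) + ((Re (c / \<mu>))^2 + (Im (c / \<mu>))^2) * t^2"
      by (simp add: d_def power2_eq_square algebra_simps)
    also have "(Re (c / \<mu>))^2 + (Im (c / \<mu>))^2 = Q^2" by (simp only: Q_def cmod_power2)
    also have "1 - 2 * (d * t) + Q^2 * t^2 \<le> 1 - d * t"
      using mult_right_mono[OF tQ t(1)] by (simp add: power2_eq_square)
    finally have sq: "(cmod (1 + c / \<mu> * of_real t))^2 \<le> 1 - d * t" .
    then have dt: "d * t \<le> 1" by (smt (verit) zero_le_power2)
    have "1 - d * t \<le> (1 - d * t / 2)^2"
      using zero_le_power2[of "d * t"] by (simp add: power2_eq_square algebra_simps)
    then have sq2: "(cmod (1 + c / \<mu> * of_real t))^2 \<le> (1 - d * t / 2)^2" using sq by linarith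
    have 1: "cmod (1 + c / \<mu> * of_real t) \<le> 1 - d * t / 2" by (rule power2_le_imp_le[OF sq2]) (use dt in linarith)
    have "K * s \<le> d / 2" using s(3) K by (simp add: field_simps)
    then have Ks: "K * s * (t * s) \<le> d / 2 * (t * s)" using t s by (intro mult_right_mono) auto
    have "cmod (\<mu> * w + c * w^2 * cnj w + E w) \<le> cmod (\<mu> * w + c * w^2 * cnj w) + cmod (E w)" by (rule norm_triangle_ineq)
    also have "\<dots> \<le> s * (1 - d * t / 2) + K * s^4"
    proof (rule add_mono)
      show "cmod (\<mu> * w + c * w^2 * cnj w) \<le> s * (1 - d * t / 2)"
        unfolding eq norm_mult \<mu> s_def[symmetric] using 1 s(5) by (simp add: mult_left_mono)
      show "cmod (E w) \<le> K * s^4" unfolding s_def by (rule E) (use s in \<open>simp add: s_def\<close>)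
    qed
    also have "\<dots> = s - d / 2 * (t * s) + K * s * (t * s)" by (simp add: t_def eval_nat_numeral algebra_simps)
    also have "\<dots> \<le> s" using Ks by simp
    finally show ?thesis by (simp add: s_def)
  qed
  ultimately show thesis by (rule that)
qed

text \<open>Half of the excess \<bar>\<mu>\<bar> - 1 pays for the nonlinear terms. The radius
  shrinks as \<bar>\<mu>\<bar> tends to 1, which is harmless because inequivalence is proved for one
  parameter at a time.\<close>

lemma truncated_expanding:
  fixes \<mu> c :: complex
  assumes \<mu>: "1 < cmod \<mu>" and m: "0 < m" and K: "0 < K"
    and E: "\<And>w. cmod w \<le> m \<Longrightarrow> cmod (E w) \<le> K * cmod w^4"
  obtains \<delta> l where "0 < \<delta>" "\<delta> \<le> m" "1 < l" "\<And>w. cmod w < \<delta> \<Longrightarrow> l * cmod w \<le> cmod (\<mu> * w + c * w^2 * cnj w + E w)"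
proof -
  define B where "B = cmod c + K"
  have B: "0 < B" using K by (simp add: B_def add_nonneg_pos)
  define \<delta> where "\<delta> = Min {m, 1, (cmod \<mu> - 1) / (2 * B)}"
  have "0 < \<delta>" unfolding \<delta>_def using m B \<mu> by (subst Min_gr_iff) auto
  moreover have "\<delta> \<le> m" unfolding \<delta>_def by simp
  moreover have "1 < (1 + cmod \<mu>) / 2" using \<mu> by simp
  moreover have "(1 + cmod \<mu>) / 2 * cmod w \<le> cmod (\<mu> * w + c * w^2 * cnj w + E w)" if w: "cmod w < \<delta>" for w
  proof -
    define s where "s = cmod w"
    have s: "s < m" "s < 1" "s < (cmod \<mu> - 1) / (2 * B)" "0 \<le> s" using w by (auto simp: \<delta>_def s_def)
    have "s^3 \<le> s^2" "s^4 \<le> s^2" using s by (auto intro!: power_decreasing)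
    then have "cmod c * s^3 \<le> cmod c * s^2" "K * s^4 \<le> K * s^2" using K by (auto intro!: mult_left_mono)
    then have 1: "cmod c * s^3 + K * s^4 \<le> B * s * s" by (simp add: B_def power2_eq_square algebra_simps)
    have "B * s \<le> (cmod \<mu> - 1) / 2" using s(3) B by (simp add: field_simps)
    from mult_right_mono[OF this s(4)] have 2: "B * s * s \<le> (cmod \<mu> - 1) / 2 * s" .
    have "cmod (c * w^2 * cnj w + E w) \<le> cmod (c * w^2 * cnj w) + cmod (E w)" by (rule norm_triangle_ineq)
    also have "\<dots> \<le> cmod c * s^3 + K * s^4"
      using E[of w] s(1) by (simp add: s_def norm_mult norm_power power2_eq_square power3_eq_cube)
    finally have 3: "cmod (c * w^2 * cnj w + E w) \<le> (cmod \<mu> - 1) / 2 * s" using 1 2 by linarith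
    have "cmod (\<mu> * w) - cmod (c * w^2 * cnj w + E w) \<le> cmod (\<mu> * w + (c * w^2 * cnj w + E w))" by (rule norm_diff_ineq)
    then have "cmod \<mu> * s - (cmod \<mu> - 1) / 2 * s \<le> cmod (\<mu> * w + c * w^2 * cnj w + E w)"
      using 3 by (simp add: norm_mult s_def add.assoc)
    then show ?thesis unfolding s_def by (simp add: field_simps)
  qed
  ultimately show thesis by (rule that)
qed

lemma isCont_E2: "g \<noteq> 0 \<Longrightarrow> isCont (E2 r) g"
  unfolding isCont_def
proof (rule vec_tendstoI)
  fix i :: 2 assume g: "g \<noteq> 0"
  have "(\<lambda>x. r / x) \<midarrow>g\<rightarrow> r / g" "(\<lambda>x. (x - r) / x) \<midarrow>g\<rightarrow> (g - r) / g"
    using g by (auto intro!: tendsto_intros)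
  then show "(\<lambda>x. E2 r x $ i) \<midarrow>g\<rightarrow> E2 r g $ i"
    using exhaust_2[of i] by (auto simp: E2_def)
qed

lemma critical_eigenvalues:
  fixes r :: real
  assumes r: "0 < r" "r \<le> 1"
  defines "\<mu> \<equiv> multiplier r (1 + r)"
  shows "complex_eigenvalues (jacobian (V r (1 + r)) (at (E2 r (1 + r)))) = {\<mu>, cnj \<mu>}"
proof -
  let ?g = "1 + r"
  define e where "e = r / ?g"
  have ge: "?g * e = r" "(?g - r) / ?g = 1 - e" "e \<noteq> 0" using r by (simp_all add: e_def field_simps)
  have p: "E2 r ?g $ 1 = e" "E2 r ?g $ 2 = 1 - e" using ge by (simp_all add: E2_def e_def)
  define A :: "real^2^2" where "A = jacobian (V r ?g) (at (E2 r ?g))"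
  have "?g * (1 - e) = 1" using ge(1) by (simp add: right_diff_distrib)
  then have A: "A$1$1 = 1 - e" "A$1$2 = - e" "A$2$1 = 1" "A$2$2 = 1"
    unfolding A_def jacobian_V p ge(1) by simp_all
  have mm: "\<mu> * cnj \<mu> = 1" using critical_nonresonance(1)[OF r] complex_norm_square[of \<mu>] by (simp add: \<mu>_def)
  have tr: "\<mu> + cnj \<mu> = of_real (2 - e)"
  proof -
    have "2 * tau r ?g = 2 - e" unfolding tau_def e_def using r by (simp add: field_simps)
    then show ?thesis by (simp add: \<mu>_def multiplier_def complex_eq_iff)
  qed
  have "l^2 - of_real (A$1$1 + A$2$2) * l + of_real (A$1$1 * A$2$2 - A$1$2 * A$2$1) = (l - \<mu>) * (l - cnj \<mu>)" for l
  proof -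
    have "(l - \<mu>) * (l - cnj \<mu>) = l^2 - (\<mu> + cnj \<mu>) * l + \<mu> * cnj \<mu>" by (simp add: power2_eq_square algebra_simps)
    then show ?thesis unfolding mm tr A by simp
  qed
  then have "complex_eigenvalues A = {l. (l - \<mu>) * (l - cnj \<mu>) = 0}"
    using complex_eigenvalues_2x2[of A] A ge(3) by simp
  also have "\<dots> = {\<mu>, cnj \<mu>}" by auto
  finally show ?thesis by (simp add: A_def)
qed

theorem theorem4:
  fixes r \<gamma>0 :: real
  assumes "0 < r" and "r \<le> 1" and "\<gamma>0 = 1 + r"
  shows "neimark_sacker_bifurcation (V r) (E2 r) \<gamma>0 \<and>
         attracting_invariant_closed_curve_bifurcates_right (V r) (E2 r) \<gamma>0"
proof -
  note r = assms(1,2)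
  have g0: "\<gamma>0 > 0" "\<gamma>0 > r" using assms by simp_all
  define \<mu> where "\<mu> = multiplier r"
  obtain K m M c1 where K: "0 < K" and m: "0 < m" "m \<le> M" and c1: "isCont c1 \<gamma>0"
    and lyap: "Re (c1 \<gamma>0 / \<mu> \<gamma>0) = - (\<gamma>0^2 / 2)"
    and nf: "\<forall>\<^sub>F g in nhds \<gamma>0. \<exists>T E. T 0 = E2 r g \<and> E 0 = 0 \<and> inj_on T (cball 0 M) \<and>
       (\<forall>x\<in>cball 0 M. \<forall>y\<in>cball 0 M. dist (T x) (T y) \<le> K * dist x y) \<and>
       (\<forall>k x y. k \<le> m \<longrightarrow> cmod x \<le> k \<longrightarrow> cmod y \<le> k \<longrightarrow> cmod (E x - E y) \<le> K * k^3 * cmod (x - y)) \<and>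
       (\<forall>w\<in>cball 0 m. let w' = \<mu> g * w + c1 g * w^2 * cnj w + E w in
          w' \<in> cball 0 M \<and> V r g (T w) = T w')"
    and norm_\<mu>: "\<forall>\<^sub>F g in nhds \<gamma>0. (cmod (\<mu> g))^2 = \<gamma>0 - r * \<gamma>0 / g"
    using V_normal_form[OF r, folded assms(3) \<mu>_def] by blast
  have \<mu>0: "cmod (\<mu> \<gamma>0) = 1" "\<mu> \<gamma>0 \<noteq> 0"
    using critical_nonresonance(1)[OF r] by (auto simp: \<mu>_def assms(3))
  have \<mu>_cont: "isCont \<mu> \<gamma>0" using isCont_coefficients(1)[OF r] by (simp add: \<mu>_def assms(3))

  \<comment> \<open>The Lipschitz bound on the disc of radius \<bar>w\<bar>, taken between w and
    0.\<close>
  have E_le: "cmod (E w) \<le> K * cmod w^4"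
    if "E 0 = 0" "\<forall>k x y. k \<le> m \<longrightarrow> cmod x \<le> k \<longrightarrow> cmod y \<le> k \<longrightarrow> cmod (E x - E y) \<le> K * k^3 * cmod (x - y)" "cmod w \<le> m"
    for E :: "complex \<Rightarrow> complex" and w
    using that(2)[rule_format, of "cmod w" w 0] that(1,3) by (simp add: eval_nat_numeral mult_ac)

  have T_cont: "continuous_on (cball 0 M) T"
    if "\<forall>x\<in>cball 0 M. \<forall>y\<in>cball 0 M. dist (T x) (T y) \<le> K * dist x y" for T :: "complex \<Rightarrow> real^2"
    by (rule lipschitz_on_continuous_on[where L = K], rule lipschitz_onI) (use that K in auto)

  \<comment> \<open>Stability of the fixed point at the critical parameter\<close>
  have stable: "\<exists>G. open G \<and> E2 r \<gamma>0 \<in> G \<and> G \<subseteq> W \<and> V r \<gamma>0 ` G \<subseteq> G" if W: "open W" "E2 r \<gamma>0 \<in> W" for W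
  proof -
    obtain T E where T: "T 0 = E2 r \<gamma>0" "inj_on T (cball 0 M)"
        "\<forall>x\<in>cball 0 M. \<forall>y\<in>cball 0 M. dist (T x) (T y) \<le> K * dist x y"
      and E: "E 0 = 0" "\<forall>k x y. k \<le> m \<longrightarrow> cmod x \<le> k \<longrightarrow> cmod y \<le> k \<longrightarrow> cmod (E x - E y) \<le> K * k^3 * cmod (x - y)"
      and conj: "\<forall>w\<in>cball 0 m. let w' = \<mu> \<gamma>0 * w + c1 \<gamma>0 * w^2 * cnj w + E w in w' \<in> cball 0 M \<and> V r \<gamma>0 (T w) = T w'"
      using eventually_nhds_x_imp_x[OF nf] by blast
    have "Re (c1 \<gamma>0 / \<mu> \<gamma>0) < 0" unfolding lyap using g0 by simp
    then obtain \<delta> where \<delta>: "0 < \<delta>" "\<delta> \<le> m" "\<And>w. cmod w < \<delta> \<Longrightarrow> cmod (\<mu> \<gamma>0 * w + c1 \<gamma>0 * w^2 * cnj w + E w) \<le> cmod w"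
      using truncated_contracting[OF \<mu>0(1) _ m(1) K E_le[OF E]] by blast
    have sub: "ball 0 \<delta> \<subseteq> cball 0 M" using \<delta> m by auto
    have "\<exists>G. open G \<and> T 0 \<in> G \<and> G \<subseteq> W \<and> V r \<gamma>0 ` G \<subseteq> G"
    proof (rule stable_of_semiconj[where F = "\<lambda>w. \<mu> \<gamma>0 * w + c1 \<gamma>0 * w^2 * cnj w + E w", OF \<delta>(1)])
      show "continuous_on (ball 0 \<delta>) T" by (rule continuous_on_subset[OF T_cont[OF T(3)] sub])
      show "inj_on T (ball 0 \<delta>)" by (rule inj_on_subset[OF T(2) sub])
      show "V r \<gamma>0 (T w) = T (\<mu> \<gamma>0 * w + c1 \<gamma>0 * w^2 * cnj w + E w)" if "cmod w < \<delta>" for w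
        using conj[rule_format, of w] that \<delta>(2) by (simp add: Let_def)
    qed (use \<delta>(3) W T(1) in auto)
    then show ?thesis by (simp add: T(1))
  qed

  \<comment> \<open>Repulsion and inequivalence beyond the critical parameter\<close>
  have ev_right: "\<forall>\<^sub>F g in at_right \<gamma>0. P g" if "\<forall>\<^sub>F g in nhds \<gamma>0. P g" for P
    using that by (rule filter_leD[OF at_within_le_nhds])
  \<comment> \<open>The squared modulus is the determinant \<gamma>0 - r \<gamma>0 / g, which
    exceeds \<gamma>0 - r = 1 as soon as g > \<gamma>0.\<close>
  have \<mu>_gt: "\<forall>\<^sub>F g in at_right \<gamma>0. 1 < cmod (\<mu> g)"
    using ev_right[OF norm_\<mu>] eventually_at_right_less[of \<gamma>0]
  proof eventually_elim
    case (elim g)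
    have "r * \<gamma>0 / g < r" using elim(2) g0 assms(1) by (simp add: divide_less_eq)
    then have "1^2 < (cmod (\<mu> g))^2" using elim(1) assms(3) by simp
    then show ?case by (rule power2_less_imp_less) simp
  qed

  have V_fix: "\<forall>\<^sub>F g in nhds \<gamma>0. V r g (E2 r g) = E2 r g"
  proof -
    have "\<forall>\<^sub>F g in nhds \<gamma>0. - g < - r" by (rule eventually_less_nhds) (use g0 in \<open>auto intro: continuous_intros\<close>)
    then show ?thesis by eventually_elim (use assms(1) V_E2 in auto)
  qed

  have ineq: "\<forall>\<^sub>F g in at_right \<gamma>0. \<not> locally_topologically_equivalent (V r g) (E2 r g) (V r \<gamma>0) (E2 r \<gamma>0)"
    using ev_right[OF nf] \<mu>_gt ev_right[OF V_fix]
  proof eventually_elim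
    case (elim g)
    obtain T E where T: "T 0 = E2 r g" "inj_on T (cball 0 M)"
        "\<forall>x\<in>cball 0 M. \<forall>y\<in>cball 0 M. dist (T x) (T y) \<le> K * dist x y"
      and E: "E 0 = 0" "\<forall>k x y. k \<le> m \<longrightarrow> cmod x \<le> k \<longrightarrow> cmod y \<le> k \<longrightarrow> cmod (E x - E y) \<le> K * k^3 * cmod (x - y)"
      and conj: "\<forall>w\<in>cball 0 m. let w' = \<mu> g * w + c1 g * w^2 * cnj w + E w in w' \<in> cball 0 M \<and> V r g (T w) = T w'"
      using elim(1) by blast
    obtain \<delta> l where \<delta>: "0 < \<delta>" "\<delta> \<le> m" "1 < l" "\<And>w. cmod w < \<delta> \<Longrightarrow> l * cmod w \<le> cmod (\<mu> g * w + c1 g * w^2 * cnj w + E w)"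
      using truncated_expanding[OF elim(2) m(1) K E_le[OF E]] by blast
    have sub: "ball 0 \<delta> \<subseteq> cball 0 M" using \<delta> m by auto
    show ?case
    proof (rule not_locally_topologically_equivalent[where N = "T ` ball 0 \<delta>"])
      show "isCont (V r g) (E2 r g)" by (rule has_derivative_continuous[OF V_has_derivative])
      show "open (T ` ball 0 \<delta>)"
        by (rule invariance_of_domain_gen) (use continuous_on_subset[OF T_cont[OF T(3)] sub] inj_on_subset[OF T(2) sub] in auto)
      show "E2 r g \<in> T ` ball 0 \<delta>" unfolding T(1)[symmetric] using \<delta>(1) by simp
      show "\<exists>n. (V r g ^^ n) x \<notin> T ` ball 0 \<delta>" if x: "x \<in> T ` ball 0 \<delta>" "x \<noteq> E2 r g" for x
      proof (rule repelling_of_semiconj[where F = "\<lambda>w. \<mu> g * w + c1 g * w^2 * cnj w + E w" and M = M and l = l])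
        show "V r g (T w) = T (\<mu> g * w + c1 g * w^2 * cnj w + E w)" "cmod (\<mu> g * w + c1 g * w^2 * cnj w + E w) \<le> M" if "cmod w < \<delta>" for w
          using conj[rule_format, of w] that \<delta>(2) by (simp_all add: Let_def)
      qed (use \<delta> m T x in auto)
    qed (use elim(3) stable in auto)
  qed
  \<comment> \<open>An equivalence valid for all parameters near \<gamma>0 would hold to the right
    of it, where \<open>ineq\<close> refutes it; one side is enough.\<close>
  have bif: "bifurcation_at (V r) (E2 r) \<gamma>0"
    unfolding bifurcation_at_def frequently_def not_not
  proof
    assume "\<forall>\<^sub>F g in nhds \<gamma>0. locally_topologically_equivalent (V r g) (E2 r g) (V r \<gamma>0) (E2 r \<gamma>0)"
    from ev_right[OF this] ineq have "\<forall>\<^sub>F g in at_right \<gamma>0. False" by eventually_elim simp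
    then show False by simp
  qed

  have E2_cont: "isCont (E2 r) \<gamma>0" using isCont_E2 g0 by simp
  have "neimark_sacker_bifurcation (V r) (E2 r) \<gamma>0"
    unfolding neimark_sacker_bifurcation_def
  proof (intro conjI V_fix E2_cont bif exI[of _ "\<mu> \<gamma>0"])
    show "V r \<gamma>0 differentiable at (E2 r \<gamma>0)" using V_has_derivative unfolding differentiable_def by blast
    show "Im (\<mu> \<gamma>0) \<noteq> 0" using critical_values(2)[OF r] by (simp add: \<mu>_def multiplier_def assms(3))
    show "complex_eigenvalues (jacobian (V r \<gamma>0) (at (E2 r \<gamma>0))) = {\<mu> \<gamma>0, cnj (\<mu> \<gamma>0)}"
      unfolding \<mu>_def assms(3) by (rule critical_eigenvalues[OF r])
  qed (rule \<mu>0)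

  \<comment> \<open>The family of attracting invariant curves\<close>
  define q where "q = (\<lambda>g. c1 g / \<mu> g)"
  \<comment> \<open>Half of - Re (q \<gamma>0) = \<gamma>0^2 / 2, which leaves room for q to vary
    with the parameter.\<close>
  define d where "d = \<gamma>0^2 / 4"
  define Kq where "Kq = max K (cmod (q \<gamma>0) + 1)"
  have q_cont: "isCont q \<gamma>0" unfolding q_def using c1 \<mu>_cont \<mu>0 by (intro continuous_intros)
  have d: "0 < d" using g0 by (simp add: d_def)
  have Kq: "0 < Kq" using K by (simp add: Kq_def)
  have ev_d: "\<forall>\<^sub>F g in nhds \<gamma>0. Re (q g) < - d"
    by (rule eventually_less_nhds) (use q_cont g0 lyap in \<open>auto intro: continuous_intros simp: q_def d_def\<close>)
  have ev_Kq: "\<forall>\<^sub>F g in nhds \<gamma>0. cmod (q g) < cmod (q \<gamma>0) + 1"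
    by (rule eventually_less_nhds) (use q_cont in \<open>auto intro: continuous_intros\<close>)
  \<comment> \<open>The radius solves the balance required by \<open>invariant_curve\<close>. At
    \<gamma>0 the logarithm vanishes, so \<rho> is continuous there with value 0, and this is what
    shrinks the curves to the fixed point.\<close>
  define \<rho> where "\<rho> = (\<lambda>g. sqrt (ln (cmod (\<mu> g)) / - Re (q g)))"
  have \<rho>0: "\<rho> \<gamma>0 = 0" using \<mu>0 by (simp add: \<rho>_def)
  have "Re (q \<gamma>0) \<noteq> 0" using lyap g0 by (simp add: q_def)
  then have \<rho>_cont: "isCont \<rho> \<gamma>0" unfolding \<rho>_def using q_cont \<mu>_cont \<mu>0 by (intro continuous_intros) auto
  obtain \<epsilon> where \<epsilon>: "0 < \<epsilon>"
    "\<forall>\<rho> \<mu> c E. 0 < \<rho> \<longrightarrow> \<rho> < \<epsilon> \<longrightarrow> 1 \<le> cmod \<mu> \<longrightarrow> cmod (c / \<mu>) \<le> Kq \<longrightarrow> d \<le> - Re (c / \<mu>) \<longrightarrow>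
       ln (cmod \<mu>) = - Re (c / \<mu>) * \<rho>^2 \<longrightarrow> E 0 = 0 \<longrightarrow>
       (\<forall>k x y. k \<le> m \<longrightarrow> cmod x \<le> k \<longrightarrow> cmod y \<le> k \<longrightarrow> cmod (E x - E y) \<le> Kq * k^3 * cmod (x - y)) \<longrightarrow>
       (\<exists>u. attracting_polar_curve (\<lambda>w. \<mu> * w + c * w^2 * cnj w + E w) \<rho> u)"
    using invariant_curve[OF Kq d m(1)] by blast
  have ev_\<rho>: "\<forall>\<^sub>F g in nhds \<gamma>0. \<rho> g < min \<epsilon> (m / 2)"
    by (rule eventually_less_nhds[OF \<rho>_cont]) (use \<rho>0 \<epsilon>(1) m in simp)
  \<comment> \<open>The inclusion in a ball belongs to the predicate so that a single choice of the
    curve by \<open>SOME\<close> yields both invariance and shrinking. Its radius comes from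
    \<bar>w\<bar> < 2 \<rho> on the polar curve and the Lipschitz constant K of T.\<close>
  define good where "good = (\<lambda>g C. closed_curve_around C (E2 r g) \<and> V r g ` C = C \<and> attracting_set (V r g) C \<and>
     C \<subseteq> cball (E2 r g) (K * (2 * \<rho> g)))"
  have "\<forall>\<^sub>F g in at_right \<gamma>0. \<exists>C. good g C"
    using ev_right[OF nf] \<mu>_gt ev_right[OF ev_d] ev_right[OF ev_Kq] ev_right[OF ev_\<rho>]
  proof eventually_elim
    case (elim g)
    obtain T E where T: "T 0 = E2 r g" "inj_on T (cball 0 M)"
        "\<forall>x\<in>cball 0 M. \<forall>y\<in>cball 0 M. dist (T x) (T y) \<le> K * dist x y"
      and E: "E 0 = 0" "\<forall>k x y. k \<le> m \<longrightarrow> cmod x \<le> k \<longrightarrow> cmod y \<le> k \<longrightarrow> cmod (E x - E y) \<le> K * k^3 * cmod (x - y)"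
      and conj: "\<forall>w\<in>cball 0 m. let w' = \<mu> g * w + c1 g * w^2 * cnj w + E w in w' \<in> cball 0 M \<and> V r g (T w) = T w'"
      using elim(1) by blast
    have ln: "0 < ln (cmod (\<mu> g))" by (rule ln_gt_zero[OF elim(2)])
    have q: "0 < - Re (q g)" using elim(3) d by simp
    note pos = divide_pos_pos[OF ln q]
    have \<rho>: "0 < \<rho> g" unfolding \<rho>_def by (rule real_sqrt_gt_zero[OF pos])
    have \<rho>2: "(\<rho> g)^2 = ln (cmod (\<mu> g)) / - Re (q g)"
      unfolding \<rho>_def by (rule real_sqrt_pow2[OF less_imp_le[OF pos]])
    have \<rho>m: "\<rho> g < \<epsilon>" "2 * \<rho> g \<le> m" using elim(5) by auto
    have E': "cmod (E x - E y) \<le> Kq * k^3 * cmod (x - y)" if k: "k \<le> m" "cmod x \<le> k" "cmod y \<le> k" for k x y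
    proof -
      have "0 \<le> k" using k(2) norm_ge_zero[of x] by linarith
      then have "K * k^3 * cmod (x - y) \<le> Kq * k^3 * cmod (x - y)" by (intro mult_right_mono) (auto simp: Kq_def)
      then show ?thesis using E(2)[rule_format, OF k] by linarith
    qed
    have "\<exists>u. attracting_polar_curve (\<lambda>w. \<mu> g * w + c1 g * w^2 * cnj w + E w) (\<rho> g) u"
    proof (rule \<epsilon>(2)[rule_format, OF \<rho> \<rho>m(1) _ _ _ _ E(1) E'])
      have qg: "c1 g / \<mu> g = q g" by (simp add: q_def)
      show "1 \<le> cmod (\<mu> g)" using elim(2) by simp
      show "cmod (c1 g / \<mu> g) \<le> Kq" using elim(4) unfolding qg Kq_def by linarith
      show "d \<le> - Re (c1 g / \<mu> g)" using elim(3) unfolding qg by linarith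
      show "ln (cmod (\<mu> g)) = - Re (c1 g / \<mu> g) * (\<rho> g)^2" unfolding qg \<rho>2 using q by simp
    qed
    then obtain u where u: "attracting_polar_curve (\<lambda>w. \<mu> g * w + c1 g * w^2 * cnj w + E w) (\<rho> g) u" by blast
    let ?C = "T ` polar_curve (\<rho> g) u"
    have T': "dist (T x) (T y) \<le> K * dist x y" if "x \<in> ball 0 m" "y \<in> ball 0 m" for x y using T(3) that m(2) by auto
    have inj: "inj_on T (ball 0 m)" by (rule inj_on_subset[OF T(2)]) (use m in auto)
    have semi: "V r g (T w) = T (\<mu> g * w + c1 g * w^2 * cnj w + E w)" if "w \<in> ball 0 m" for w
      using conj[rule_format, of w] that by (simp add: Let_def)
    have sub: "?C \<subseteq> cball (E2 r g) (K * (2 * \<rho> g))"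
    proof clarify
      fix w assume "w \<in> polar_curve (\<rho> g) u"
      then obtain \<theta> where w: "w = polar_point (\<rho> g) (u \<theta>) \<theta>" unfolding polar_curve_def by blast
      have "\<bar>u \<theta>\<bar> < 1/4" using u unfolding attracting_polar_curve_def by blast
      then have "u \<theta> < 1/2" by linarith
      then have "exp (u \<theta>) < exp (1/2)" by simp
      moreover have "exp (1/2) \<le> (2::real)" using exp_bound_half[of "1/2::real"] by simp
      ultimately have "\<rho> g * exp (u \<theta>) < \<rho> g * 2" using \<rho> by (intro mult_strict_left_mono) linarith+
      then have wn: "cmod w < 2 * \<rho> g" using \<rho> by (simp add: w norm_polar_point)
      then have "dist (T 0) (T w) \<le> K * dist 0 w" using \<rho>m m by (intro T') auto
      also have "\<dots> \<le> K * (2 * \<rho> g)" using wn K by (intro mult_left_mono) auto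
      finally show "T w \<in> cball (E2 r g) (K * (2 * \<rho> g))" by (simp add: T(1))
    qed
    note image = attracting_polar_image[where T = T and K = K and f = "V r g" and
        F = "\<lambda>w. \<mu> g * w + c1 g * w^2 * cnj w + E w", OF \<rho> \<rho>m(2) T' inj semi u]
    have "closed_curve_around ?C (E2 r g)" unfolding T(1)[symmetric] by (rule image(1))
    moreover have "V r g ` ?C = ?C" by (rule image(2))
    moreover have "attracting_set (V r g) ?C" by (rule image(3))
    ultimately have "good g ?C" unfolding good_def using sub by (intro conjI)
    then show ?case by blast
  qed
  then have good: "\<forall>\<^sub>F g in at_right \<gamma>0. good g (SOME C. good g C)"
    by (rule eventually_mono) (rule someI_ex)
  have "attracting_invariant_closed_curve_bifurcates_right (V r) (E2 r) \<gamma>0"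
    unfolding attracting_invariant_closed_curve_bifurcates_right_def
  proof (intro exI[of _ "\<lambda>g. SOME C. good g C"] conjI allI impI)
    show "\<forall>\<^sub>F g in at_right \<gamma>0. closed_curve_around (SOME C. good g C) (E2 r g) \<and>
        V r g ` (SOME C. good g C) = (SOME C. good g C) \<and> attracting_set (V r g) (SOME C. good g C)"
      using good by eventually_elim (simp add: good_def)
    fix e :: real assume e: "0 < e"
    have "isCont (\<lambda>g. dist (E2 r \<gamma>0) (E2 r g) + K * (2 * \<rho> g)) \<gamma>0"
      using E2_cont \<rho>_cont by (intro continuous_intros)
    then have "\<forall>\<^sub>F g in nhds \<gamma>0. dist (E2 r \<gamma>0) (E2 r g) + K * (2 * \<rho> g) < e"
      by (rule eventually_less_nhds) (use \<rho>0 e in simp)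
    from ev_right[OF this] good show "\<forall>\<^sub>F g in at_right \<gamma>0. (SOME C. good g C) \<subseteq> ball (E2 r \<gamma>0) e"
    proof eventually_elim
      case (elim g)
      have "cball (E2 r g) (K * (2 * \<rho> g)) \<subseteq> ball (E2 r \<gamma>0) e"
      proof
        fix x assume "x \<in> cball (E2 r g) (K * (2 * \<rho> g))"
        then show "x \<in> ball (E2 r \<gamma>0) e"
          using elim(1) dist_triangle[of "E2 r \<gamma>0" x "E2 r g"] by simp
      qed
      then show ?case using elim(2) unfolding good_def by blast
    qed
  qed
  with \<open>neimark_sacker_bifurcation (V r) (E2 r) \<gamma>0\<close> show ?thesis by blast
qed

end
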